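(* Let $N\ge 1$ and $1<p_1,\dots,p_N<\infty$ be such that $\min\bigl\{1,\sum_{i=1}^N\frac1{p_i}\bigr\}=1$. Then the dual space $(\ell_{p_1}\hat\otimes\cdots\hat\otimes\ell_{p_N})^*$ is primary.
   Context: $\hat\otimes$ denotes the (completed) projective tensor product of Banach spaces. A Banach space $X$ is primary if whenever $X=Y\oplus Z$ (a topological direct sum of closed subspaces), $X$ is isomorphic (linearly homeomorphic) to $Y$ or to $Z$. *)

theory Defs
  imports "HOL-Analysis.Analysis"
begin

text \<open>
  The exponents and the number of factors are variables of the theorem, so the Banach spaces
  cannot be types. A normed space is given by an explicit carrier, operations and norm;
  the values of the operations and of the norm outside the carrier are irrelevant.

  Scalars form a \<open>real_normed_field\<close>. If it is moreover a \<open>euclidean_space\<close>, it is a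
  finite-dimensional real field with multiplicative norm, i.e. the reals or the complex numbers
  up to isometric isomorphism.
\<close>

record ('k, 'v) nspace =
  vcarrier :: "'v set"
  vzero :: 'v
  vadd :: "'v \<Rightarrow> 'v \<Rightarrow> 'v"
  vscale :: "'k \<Rightarrow> 'v \<Rightarrow> 'v"
  vnorm :: "'v \<Rightarrow> real"

definition vdiff :: "('k::real_normed_field, 'v) nspace \<Rightarrow> 'v \<Rightarrow> 'v \<Rightarrow> 'v" where
  "vdiff X x y = vadd X x (vscale X (- 1) y)"

locale normed_vspace =
  fixes X :: "('k::real_normed_field, 'v) nspace"
  assumes zero_closed: "vzero X \<in> vcarrier X"
    and add_closed: "\<And>x y. x \<in> vcarrier X \<Longrightarrow> y \<in> vcarrier X \<Longrightarrow> vadd X x y \<in> vcarrier X"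
    and scale_closed: "\<And>c x. x \<in> vcarrier X \<Longrightarrow> vscale X c x \<in> vcarrier X"
    and add_assoc: "\<And>x y z. x \<in> vcarrier X \<Longrightarrow> y \<in> vcarrier X \<Longrightarrow> z \<in> vcarrier X \<Longrightarrow>
          vadd X (vadd X x y) z = vadd X x (vadd X y z)"
    and add_commute: "\<And>x y. x \<in> vcarrier X \<Longrightarrow> y \<in> vcarrier X \<Longrightarrow> vadd X x y = vadd X y x"
    and add_zero: "\<And>x. x \<in> vcarrier X \<Longrightarrow> vadd X x (vzero X) = x"
    and add_minus: "\<And>x. x \<in> vcarrier X \<Longrightarrow> vdiff X x x = vzero X"
    and scale_add_right: "\<And>c x y. x \<in> vcarrier X \<Longrightarrow> y \<in> vcarrier X \<Longrightarrow>
          vscale X c (vadd X x y) = vadd X (vscale X c x) (vscale X c y)"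
    and scale_add_left: "\<And>c d x. x \<in> vcarrier X \<Longrightarrow>
          vscale X (c + d) x = vadd X (vscale X c x) (vscale X d x)"
    and scale_scale: "\<And>c d x. x \<in> vcarrier X \<Longrightarrow> vscale X c (vscale X d x) = vscale X (c * d) x"
    and scale_one: "\<And>x. x \<in> vcarrier X \<Longrightarrow> vscale X 1 x = x"
    and norm_nonneg: "\<And>x. x \<in> vcarrier X \<Longrightarrow> 0 \<le> vnorm X x"
    and norm_eq_zero: "\<And>x. x \<in> vcarrier X \<Longrightarrow> vnorm X x = 0 \<longleftrightarrow> x = vzero X"
    and norm_scale: "\<And>c x. x \<in> vcarrier X \<Longrightarrow> vnorm X (vscale X c x) = norm c * vnorm X x"
    and norm_triangle: "\<And>x y. x \<in> vcarrier X \<Longrightarrow> y \<in> vcarrier X \<Longrightarrow>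
          vnorm X (vadd X x y) \<le> vnorm X x + vnorm X y"

definition cauchy_seqs :: "('k::real_normed_field, 'v) nspace \<Rightarrow> (nat \<Rightarrow> 'v) set" where
  "cauchy_seqs X = {s. (\<forall>n. s n \<in> vcarrier X) \<and>
     (\<forall>e>0. \<exists>M. \<forall>m\<ge>M. \<forall>n\<ge>M. vnorm X (vdiff X (s m) (s n)) < e)}"

definition converges_to :: "('k::real_normed_field, 'v) nspace \<Rightarrow> (nat \<Rightarrow> 'v) \<Rightarrow> 'v \<Rightarrow> bool" where
  "converges_to X s x \<longleftrightarrow> (\<lambda>n. vnorm X (vdiff X (s n) x)) \<longlonglongrightarrow> 0"

definition banach_space :: "('k::real_normed_field, 'v) nspace \<Rightarrow> bool" where
  "banach_space X \<longleftrightarrow> normed_vspace X \<and>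
     (\<forall>s \<in> cauchy_seqs X. \<exists>x \<in> vcarrier X. converges_to X s x)"

definition linear_between ::
    "('k::real_normed_field, 'v) nspace \<Rightarrow> ('k, 'w) nspace \<Rightarrow> ('v \<Rightarrow> 'w) \<Rightarrow> bool" where
  "linear_between X Y T \<longleftrightarrow>
     (\<forall>x \<in> vcarrier X. T x \<in> vcarrier Y) \<and>
     (\<forall>x \<in> vcarrier X. \<forall>y \<in> vcarrier X. T (vadd X x y) = vadd Y (T x) (T y)) \<and>
     (\<forall>c. \<forall>x \<in> vcarrier X. T (vscale X c x) = vscale Y c (T x))"

definition isomorphic_spaces ::
    "('k::real_normed_field, 'v) nspace \<Rightarrow> ('k, 'w) nspace \<Rightarrow> bool" where
  "isomorphic_spaces X Y \<longleftrightarrow> (\<exists>T. linear_between X Y T \<and> bij_betw T (vcarrier X) (vcarrier Y) \<and>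
     (\<exists>C. \<forall>x \<in> vcarrier X. vnorm Y (T x) \<le> C * vnorm X x) \<and>
     (\<exists>C. \<forall>x \<in> vcarrier X. vnorm X x \<le> C * vnorm Y (T x)))"

definition closed_subspace :: "('k::real_normed_field, 'v) nspace \<Rightarrow> 'v set \<Rightarrow> bool" where
  "closed_subspace X Y \<longleftrightarrow> Y \<subseteq> vcarrier X \<and> vzero X \<in> Y \<and>
     (\<forall>x \<in> Y. \<forall>y \<in> Y. vadd X x y \<in> Y) \<and> (\<forall>c. \<forall>x \<in> Y. vscale X c x \<in> Y) \<and>
     (\<forall>s. \<forall>x \<in> vcarrier X. (\<forall>n. s n \<in> Y) \<longrightarrow> converges_to X s x \<longrightarrow> x \<in> Y)"

text \<open>The last conjunct says that the two projections are bounded.\<close>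

definition topological_direct_sum ::
    "('k::real_normed_field, 'v) nspace \<Rightarrow> 'v set \<Rightarrow> 'v set \<Rightarrow> bool" where
  "topological_direct_sum X Y Z \<longleftrightarrow> closed_subspace X Y \<and> closed_subspace X Z \<and>
     Y \<inter> Z = {vzero X} \<and> (\<forall>x \<in> vcarrier X. \<exists>y \<in> Y. \<exists>z \<in> Z. x = vadd X y z) \<and>
     (\<exists>C. \<forall>y \<in> Y. \<forall>z \<in> Z. vnorm X y + vnorm X z \<le> C * vnorm X (vadd X y z))"

definition primary :: "('k::real_normed_field, 'v) nspace \<Rightarrow> bool" where
  "primary X \<longleftrightarrow> banach_space X \<and>
     (\<forall>Y Z. topological_direct_sum X Y Z \<longrightarrow>
        isomorphic_spaces X (X\<lparr>vcarrier := Y\<rparr>) \<or> isomorphic_spaces X (X\<lparr>vcarrier := Z\<rparr>))"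

definition lp_space :: "real \<Rightarrow> ('k::real_normed_field, nat \<Rightarrow> 'k) nspace" where
  "lp_space p = \<lparr>
     vcarrier = {x. summable (\<lambda>n. norm (x n) powr p)},
     vzero = (\<lambda>_. 0),
     vadd = (\<lambda>x y n. x n + y n),
     vscale = (\<lambda>c x n. c * x n),
     vnorm = (\<lambda>x. (\<Sum>n. norm (x n) powr p) powr (1 / p))\<rparr>"

definition scalar_space :: "('k::real_normed_field, 'k) nspace" where
  "scalar_space = \<lparr>vcarrier = UNIV, vzero = 0, vadd = (+), vscale = (*), vnorm = norm\<rparr>"

text \<open>Functionals are \<open>extensional\<close>, so that equality of functions is equality on the carrier.\<close>

definition dual_space :: "('k::real_normed_field, 'v) nspace \<Rightarrow> ('k, 'v \<Rightarrow> 'k) nspace" where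
  "dual_space X = \<lparr>
     vcarrier = {f \<in> extensional (vcarrier X). linear_between X scalar_space f \<and>
        (\<exists>C. \<forall>x \<in> vcarrier X. norm (f x) \<le> C * vnorm X x)},
     vzero = (\<lambda>x \<in> vcarrier X. 0),
     vadd = (\<lambda>f g. \<lambda>x \<in> vcarrier X. f x + g x),
     vscale = (\<lambda>c f. \<lambda>x \<in> vcarrier X. c * f x),
     vnorm = (\<lambda>f. SUP x \<in> {x \<in> vcarrier X. vnorm X x \<le> 1}. norm (f x))\<rparr>"

text \<open>Completion: Cauchy sequences modulo sequences converging to zero.\<close>

definition null_rel :: "('k::real_normed_field, 'v) nspace \<Rightarrow> ((nat \<Rightarrow> 'v) \<times> (nat \<Rightarrow> 'v)) set" where
  "null_rel X = {(s, t). s \<in> cauchy_seqs X \<and> t \<in> cauchy_seqs X \<and>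
     (\<lambda>n. vnorm X (vdiff X (s n) (t n))) \<longlonglongrightarrow> 0}"

definition completion :: "('k::real_normed_field, 'v) nspace \<Rightarrow> ('k, (nat \<Rightarrow> 'v) set) nspace" where
  "completion X = \<lparr>
     vcarrier = cauchy_seqs X // null_rel X,
     vzero = null_rel X `` {\<lambda>_. vzero X},
     vadd = (\<lambda>A B. \<Union>s\<in>A. \<Union>t\<in>B. null_rel X `` {\<lambda>n. vadd X (s n) (t n)}),
     vscale = (\<lambda>c A. \<Union>s\<in>A. null_rel X `` {\<lambda>n. vscale X c (s n)}),
     vnorm = (\<lambda>A. lim (\<lambda>n. vnorm X ((SOME s. s \<in> A) n)))\<rparr>"

text \<open>
  The algebraic tensor product of the family \<open>X i\<close>, \<open>i \<in> I\<close>, is realised as in Ryan's book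
  on tensor products of Banach spaces: the elementary tensor of \<open>x\<close> is evaluation
  \<open>A \<mapsto> A x\<close> on the space of all (not necessarily bounded) multilinear forms \<open>A\<close>,
  and the tensor product is the linear span of the elementary tensors.
\<close>

definition multilinear_forms ::
    "'i set \<Rightarrow> ('i \<Rightarrow> ('k::real_normed_field, 'v) nspace) \<Rightarrow> (('i \<Rightarrow> 'v) \<Rightarrow> 'k) set" where
  "multilinear_forms I X = {A \<in> extensional (\<Pi>\<^sub>E i\<in>I. vcarrier (X i)).
     \<forall>x \<in> (\<Pi>\<^sub>E i\<in>I. vcarrier (X i)). \<forall>i \<in> I.
       linear_between (X i) scalar_space (\<lambda>v. A (x(i := v)))}"

definition tensor_sum ::
    "'i set \<Rightarrow> ('i \<Rightarrow> ('k::real_normed_field, 'v) nspace) \<Rightarrow> nat \<Rightarrow> (nat \<Rightarrow> 'k) \<Rightarrow>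
     (nat \<Rightarrow> 'i \<Rightarrow> 'v) \<Rightarrow> (('i \<Rightarrow> 'v) \<Rightarrow> 'k) \<Rightarrow> 'k" where
  "tensor_sum I X n c x = (\<lambda>A \<in> multilinear_forms I X. \<Sum>j<n. c j * A (x j))"

definition represents ::
    "'i set \<Rightarrow> ('i \<Rightarrow> ('k::real_normed_field, 'v) nspace) \<Rightarrow> ((('i \<Rightarrow> 'v) \<Rightarrow> 'k) \<Rightarrow> 'k) \<Rightarrow>
     nat \<Rightarrow> (nat \<Rightarrow> 'k) \<Rightarrow> (nat \<Rightarrow> 'i \<Rightarrow> 'v) \<Rightarrow> bool" where
  "represents I X u n c x \<longleftrightarrow>
     (\<forall>j<n. x j \<in> (\<Pi>\<^sub>E i\<in>I. vcarrier (X i))) \<and> u = tensor_sum I X n c x"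

definition alg_tensor ::
    "'i set \<Rightarrow> ('i \<Rightarrow> ('k::real_normed_field, 'v) nspace) \<Rightarrow>
     ('k, (('i \<Rightarrow> 'v) \<Rightarrow> 'k) \<Rightarrow> 'k) nspace" where
  "alg_tensor I X = \<lparr>
     vcarrier = {u. \<exists>n c x. represents I X u n c x},
     vzero = (\<lambda>A \<in> multilinear_forms I X. 0),
     vadd = (\<lambda>u v. \<lambda>A \<in> multilinear_forms I X. u A + v A),
     vscale = (\<lambda>c u. \<lambda>A \<in> multilinear_forms I X. c * u A),
     vnorm = (\<lambda>u. Inf {(\<Sum>j<n. norm (c j) * (\<Prod>i\<in>I. vnorm (X i) (x j i))) | n c x.
        represents I X u n c x})\<rparr>"

definition proj_tensor ::
    "'i set \<Rightarrow> ('i \<Rightarrow> ('k::real_normed_field, 'v) nspace) \<Rightarrow>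
     ('k, (nat \<Rightarrow> (('i \<Rightarrow> 'v) \<Rightarrow> 'k) \<Rightarrow> 'k) set) nspace" where
  "proj_tensor I X = completion (alg_tensor I X)"

end

theory Submission
  imports Defs "HOL-Library.Function_Algebras" "HOL-Library.Diagonal_Subsequence"
begin

text \<open>
  The dual is the space \<open>V\<close> of bounded multilinear forms, given by their arrays of entries. Since
  \<open>\<Sum> 1 / p i \<ge> 1\<close>, a block-diagonal form is bounded as soon as its blocks are uniformly bounded, so the
  \<open>\<ell>\<^sub>\<infinity>\<close>-sum \<open>W\<close> of the spaces of forms on finite cubes is complemented in \<open>V\<close>; conversely \<open>V\<close> is
  complemented in \<open>W\<close> by an ultralimit. Given a bounded projection \<open>P\<close> on \<open>V\<close>, a gliding hump argument
  yields a sequence of blocks along which \<open>P\<close> is determined by its matrix entries; inside the blocks a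
  random choice of subgrids makes the off-diagonal entries small, because \<open>p i > 1\<close> leaves only
  boundedly many large entries on every line, and Ramsey's theorem makes the diagonal entries almost
  constant. Hence \<open>P\<close> compressed to a copy of \<open>W\<close> is a small perturbation of \<open>\<kappa> I\<close>. One of \<open>\<kappa>\<close> and
  \<open>1 - \<kappa>\<close> is not small, so \<open>W\<close> is complemented in the range or in the kernel of \<open>P\<close>, and as
  \<open>W\<close> is isomorphic to its own \<open>\<ell>\<^sub>\<infinity>\<close>-sum, Pelczynski's decomposition method identifies that space with
  \<open>W\<close>, and \<open>V\<close> with \<open>W\<close>.
\<close>

section \<open>Function spaces normed by a bounding relation\<close>

text \<open>Forms behave like bounded sequences: a form need not be a norm limit of its finite
  truncations, so an operator on \<open>V\<close> is not determined by its matrix entries, just as a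
  nonzero functional on \<open>\<ell>\<^sub>\<infinity>\<close> may vanish on all finitely supported
  sequences. This is the obstacle behind the gliding hump: entries control the operator only along a
  sequence of blocks so thin that every entry functional is small on the blocks far out. Small
  entries are turned into a small norm by the crudest estimate, the number of entries times their
  size. This is affordable because the tolerance, polynomial in the cube side, is fixed before the
  grid is chosen inside an infinite block. The space \<open>W\<close> takes part because repeating
  every cube size infinitely often makes it isometric to its own
  \<open>\<ell>\<^sub>\<infinity>\<close>-sum by mere reindexing. The constants 1/2 and 1/4 belong
  together: \<kappa> and 1 - \<kappa> add up to 1, so one of them has norm at least 1/2, and an
  error of norm at most 1/4 is at most half of it, which makes a Neumann series converge.\<close>

definition sc :: "'k::times \<Rightarrow> ('x \<Rightarrow> 'k) \<Rightarrow> 'x \<Rightarrow> 'k" where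
  "sc c a = (\<lambda>x. c * a x)"

lemma sc_apply [simp]: "sc c a x = c * a x"
  by (simp add: sc_def)

lemma sc_sc [simp]: "sc c (sc d a) = sc (c * d) (a :: 'x \<Rightarrow> 'k::comm_ring_1)"
  by (simp add: fun_eq_iff mult.assoc)

lemma sc_1 [simp]: "sc 1 a = (a :: 'x \<Rightarrow> 'k::comm_ring_1)"
  by (simp add: fun_eq_iff)

lemma sc_0 [simp]: "sc 0 a = (0 :: 'x \<Rightarrow> 'k::comm_ring_1)"
  by (simp add: fun_eq_iff)

lemma sc_zero [simp]: "sc c 0 = (0 :: 'x \<Rightarrow> 'k::comm_ring_1)"
  by (simp add: fun_eq_iff)

lemma sc_add: "sc c (a + b) = sc c a + sc c (b :: 'x \<Rightarrow> 'k::comm_ring_1)"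
  by (simp add: fun_eq_iff distrib_left)

lemma sc_diff: "sc c (a - b) = sc c a - sc c (b :: 'x \<Rightarrow> 'k::comm_ring_1)"
  by (simp add: fun_eq_iff right_diff_distrib)

lemma minus_eq_sc: "- a = sc (-1) (a :: 'x \<Rightarrow> 'k::comm_ring_1)"
  by (simp add: fun_eq_iff)

lemma sum_fun_apply: "(\<Sum>i\<in>A. f i) x = (\<Sum>i\<in>A. f i x)"
  by (induction A rule: infinite_finite_induct) auto

lemma unimodular_factor:
  obtains c :: "'k::real_normed_field" where "norm c = 1" and "c * z = of_real (norm z)"
proof (cases "z = 0")
  case True
  then show ?thesis using that[of 1] by auto
next
  case False
  then show ?thesis using that[of "of_real (norm z) / z"] by (auto simp: norm_divide)
qed

text \<open>
  A norm on a function space is encoded by the relation \<open>bd a C\<close>, to be read as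
  \<open>\<parallel>a\<parallel> \<le> C\<close>; the space consists of the functions \<open>a\<close> with \<open>bd a C\<close> for some \<open>C\<close>.
\<close>

definition car :: "('a \<Rightarrow> real \<Rightarrow> bool) \<Rightarrow> 'a \<Rightarrow> bool" where
  "car bd a \<longleftrightarrow> (\<exists>C. bd a C)"

text \<open>\<open>bd_entry\<close> says that evaluation at a point is contractive. Bounds are
  therefore nonnegative and only 0 has bound 0, so the relation behaves like a norm although the
  best constant is never named.\<close>

locale function_norm =
  fixes bd :: "('x \<Rightarrow> 'k::{real_normed_field, euclidean_space}) \<Rightarrow> real \<Rightarrow> bool"
  assumes bd_add: "bd a C \<Longrightarrow> bd b D \<Longrightarrow> bd (a + b) (C + D)"
    and bd_sc: "bd a C \<Longrightarrow> bd (sc c a) (norm c * C)"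
    and bd_entry: "bd a C \<Longrightarrow> norm (a x) \<le> C"
    and bd_zero: "bd 0 0"
    and bd_mono: "bd a C \<Longrightarrow> C \<le> D \<Longrightarrow> bd a D"
begin

lemma bd_nonneg: "bd a C \<Longrightarrow> 0 \<le> C"
  by (meson bd_entry norm_ge_zero order_trans)

lemma bd_eq_0: "bd a 0 \<Longrightarrow> a = 0"
  using bd_entry[of a 0] by (auto simp: fun_eq_iff)

lemma bd_zero': "0 \<le> C \<Longrightarrow> bd 0 C"
  using bd_mono bd_zero by blast

lemma bd_minus: "bd a C \<Longrightarrow> bd (- a) C"
  using bd_sc[of a C "-1"] by (simp add: minus_eq_sc)

lemma bd_diff: "bd a C \<Longrightarrow> bd b D \<Longrightarrow> bd (a - b) (C + D)"
  using bd_add[of a C "- b" D] bd_minus by simp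

lemma bd_sum: "finite A \<Longrightarrow> (\<And>i. i \<in> A \<Longrightarrow> bd (f i) (C i)) \<Longrightarrow> bd (\<Sum>i\<in>A. f i) (\<Sum>i\<in>A. C i)"
  by (induction A rule: finite_induct) (auto intro: bd_add bd_zero)

lemma carI: "bd a C \<Longrightarrow> car bd a"
  by (auto simp: car_def)

lemma car_zero [simp]: "car bd 0"
  using bd_zero by (auto simp: car_def)

lemma car_add [simp]: "car bd a \<Longrightarrow> car bd b \<Longrightarrow> car bd (a + b)"
  unfolding car_def using bd_add by blast

lemma car_diff [simp]: "car bd a \<Longrightarrow> car bd b \<Longrightarrow> car bd (a - b)"
  unfolding car_def using bd_diff by blast

lemma car_sc [simp]: "car bd a \<Longrightarrow> car bd (sc c a)"
  unfolding car_def using bd_sc by blast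

lemma car_sum: "finite A \<Longrightarrow> (\<And>i. i \<in> A \<Longrightarrow> car bd (f i)) \<Longrightarrow> car bd (\<Sum>i\<in>A. f i)"
  by (induction A rule: finite_induct) auto

end

text \<open>Balls closed under pointwise limits take the role of completeness: a series is summed
  entry by entry, and the sum inherits the bound of the partial sums.\<close>

locale closed_function_norm = function_norm bd
  for bd :: "('x \<Rightarrow> 'k::{real_normed_field, euclidean_space}) \<Rightarrow> real \<Rightarrow> bool" +
  assumes bd_lim: "(\<And>n::nat. bd (f n) C) \<Longrightarrow> (\<And>x. (\<lambda>n. f n x) \<longlonglongrightarrow> g x) \<Longrightarrow> bd g C"

section \<open>Bounded operators, retracts and isomorphisms\<close>

definition blin :: "(('x \<Rightarrow> 'k::{real_normed_field, euclidean_space}) \<Rightarrow> real \<Rightarrow> bool) \<Rightarrow>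
    (('y \<Rightarrow> 'k) \<Rightarrow> real \<Rightarrow> bool) \<Rightarrow> (('x \<Rightarrow> 'k) \<Rightarrow> 'y \<Rightarrow> 'k) \<Rightarrow> bool" where
  "blin bd1 bd2 T \<longleftrightarrow>
     (\<forall>a b. car bd1 a \<longrightarrow> car bd1 b \<longrightarrow> T (a + b) = T a + T b) \<and>
     (\<forall>c a. car bd1 a \<longrightarrow> T (sc c a) = sc c (T a)) \<and>
     (\<exists>K\<ge>0. \<forall>a C. bd1 a C \<longrightarrow> bd2 (T a) (K * C))"

lemma blinI:
  assumes "\<And>a b. car bd1 a \<Longrightarrow> car bd1 b \<Longrightarrow> T (a + b) = T a + T b"
    and "\<And>c a. car bd1 a \<Longrightarrow> T (sc c a) = sc c (T a)"
    and "0 \<le> K" and "\<And>a C. bd1 a C \<Longrightarrow> bd2 (T a) (K * C)"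
  shows "blin bd1 bd2 T"
  using assms unfolding blin_def by blast

lemma blin_add: "blin bd1 bd2 T \<Longrightarrow> car bd1 a \<Longrightarrow> car bd1 b \<Longrightarrow> T (a + b) = T a + T b"
  by (simp add: blin_def)

lemma blin_sc: "blin bd1 bd2 T \<Longrightarrow> car bd1 a \<Longrightarrow> T (sc c a) = sc c (T a)"
  by (simp add: blin_def)

lemma blin_bound:
  assumes "blin bd1 bd2 T"
  shows "\<exists>K\<ge>0. \<forall>a C. bd1 a C \<longrightarrow> bd2 (T a) (K * C)"
  using assms unfolding blin_def by blast

lemma blin_car: "blin bd1 bd2 T \<Longrightarrow> car bd1 a \<Longrightarrow> car bd2 (T a)"
  unfolding blin_def car_def by blast

lemma blin_zero: "function_norm bd1 \<Longrightarrow> blin bd1 bd2 T \<Longrightarrow> T 0 = 0"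
  using blin_sc[of bd1 bd2 T 0 0] function_norm.car_zero[of bd1] by simp

lemma blin_diff:
  assumes "function_norm bd1" "blin bd1 bd2 T" "car bd1 a" "car bd1 b"
  shows "T (a - b) = T a - T b"
proof -
  interpret function_norm bd1 by fact
  have "T (a + sc (-1) b) = T a + sc (-1) (T b)"
    using blin_add[OF assms(2,3), of "sc (-1) b"] blin_sc[OF assms(2,4), of "-1"] assms(4) by simp
  then show ?thesis by (simp flip: minus_eq_sc)
qed

lemma blin_sum:
  assumes "function_norm bd1" "blin bd1 bd2 T" "finite A" "\<And>i. i \<in> A \<Longrightarrow> car bd1 (f i)"
  shows "T (\<Sum>i\<in>A. f i) = (\<Sum>i\<in>A. T (f i))"
  using assms(3,4)
proof (induction A rule: finite_induct)
  case empty
  show ?case using blin_zero[OF assms(1,2)] by (simp only: sum.empty)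
next
  case (insert i A)
  have "car bd1 (f i)" "car bd1 (\<Sum>i\<in>A. f i)"
    using insert function_norm.car_sum[OF assms(1)] by auto
  then have "T (f i + (\<Sum>i\<in>A. f i)) = T (f i) + (\<Sum>i\<in>A. T (f i))"
    using blin_add[OF assms(2)] insert by (metis insertI2)
  then show ?case
    by (simp only: sum.insert[OF insert(1,2)])
qed

lemma blin_comp:
  assumes "blin bd1 bd2 T" "blin bd2 bd3 S"
  shows "blin bd1 bd3 (\<lambda>a. S (T a))"
proof -
  obtain K where K: "0 \<le> K" "\<And>a C. bd1 a C \<Longrightarrow> bd2 (T a) (K * C)" using blin_bound[OF assms(1)] by blast
  obtain L where L: "0 \<le> L" "\<And>a C. bd2 a C \<Longrightarrow> bd3 (S a) (L * C)" using blin_bound[OF assms(2)] by blast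
  show ?thesis
  proof (rule blinI[where K = "L * K"])
    fix a C assume "bd1 a C"
    then show "bd3 (S (T a)) (L * K * C)" using K L by (metis mult.assoc)
  qed (use assms K L in \<open>auto simp: blin_add[OF assms(1)] blin_add[OF assms(2)] blin_sc[OF assms(1)]
      blin_sc[OF assms(2)] blin_car[OF assms(1)]\<close>)
qed

lemma blin_minus:
  assumes "function_norm bd2" "blin bd1 bd2 T" "blin bd1 bd2 S"
  shows "blin bd1 bd2 (\<lambda>a. T a - S a)"
proof -
  obtain K where K: "0 \<le> K" "\<And>a C. bd1 a C \<Longrightarrow> bd2 (T a) (K * C)" using blin_bound[OF assms(2)] by blast
  obtain L where L: "0 \<le> L" "\<And>a C. bd1 a C \<Longrightarrow> bd2 (S a) (L * C)" using blin_bound[OF assms(3)] by blast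
  show ?thesis
  proof (rule blinI[where K = "K + L"])
    fix a C assume "bd1 a C"
    then show "bd2 (T a - S a) ((K + L) * C)"
      using function_norm.bd_diff[OF assms(1)] K L by (simp add: distrib_right)
  qed (use K L in \<open>auto simp: blin_add[OF assms(2)] blin_add[OF assms(3)] blin_sc[OF assms(2)]
      blin_sc[OF assms(3)] algebra_simps sc_diff\<close>)
qed

lemma blin_id: "blin bd1 bd1 (\<lambda>a. a)"
  by (rule blinI[where K = 1]) auto

text \<open>\<open>j\<close> embeds the first space in the second, and \<open>j\<close> after
  \<open>q\<close> is a bounded projection onto the image: the first space is isomorphic to a
  complemented subspace of the second.\<close>

definition norm_retract :: "(('x \<Rightarrow> 'k::{real_normed_field, euclidean_space}) \<Rightarrow> real \<Rightarrow> bool) \<Rightarrow>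
    (('y \<Rightarrow> 'k) \<Rightarrow> real \<Rightarrow> bool) \<Rightarrow> bool" where
  "norm_retract bd1 bd2 \<longleftrightarrow>
     (\<exists>j q. blin bd1 bd2 j \<and> blin bd2 bd1 q \<and> (\<forall>a. car bd1 a \<longrightarrow> q (j a) = a))"

lemma norm_retract_trans:
  assumes "norm_retract bd1 bd2" "norm_retract bd2 bd3"
  shows "norm_retract bd1 bd3"
proof -
  obtain j q where 1: "blin bd1 bd2 j" "blin bd2 bd1 q" "\<And>a. car bd1 a \<Longrightarrow> q (j a) = a"
    using assms(1) unfolding norm_retract_def by blast
  obtain j' q' where 2: "blin bd2 bd3 j'" "blin bd3 bd2 q'" "\<And>a. car bd2 a \<Longrightarrow> q' (j' a) = a"
    using assms(2) unfolding norm_retract_def by blast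
  have "q (q' (j' (j a))) = a" if "car bd1 a" for a
    using 1 2 that blin_car by metis
  then show ?thesis
    unfolding norm_retract_def using blin_comp[OF 1(1) 2(1)] blin_comp[OF 2(2) 1(2)] by blast
qed

definition norm_iso :: "(('x \<Rightarrow> 'k::{real_normed_field, euclidean_space}) \<Rightarrow> real \<Rightarrow> bool) \<Rightarrow>
    (('y \<Rightarrow> 'k) \<Rightarrow> real \<Rightarrow> bool) \<Rightarrow> bool" where
  "norm_iso bd1 bd2 \<longleftrightarrow> (\<exists>T S. blin bd1 bd2 T \<and> blin bd2 bd1 S \<and>
     (\<forall>a. car bd1 a \<longrightarrow> S (T a) = a) \<and> (\<forall>b. car bd2 b \<longrightarrow> T (S b) = b))"

lemma norm_iso_sym: "norm_iso bd1 bd2 \<Longrightarrow> norm_iso bd2 bd1"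
  unfolding norm_iso_def by blast

lemma norm_iso_trans:
  assumes "norm_iso bd1 bd2" "norm_iso bd2 bd3"
  shows "norm_iso bd1 bd3"
proof -
  obtain T S where 1: "blin bd1 bd2 T" "blin bd2 bd1 S" "\<And>a. car bd1 a \<Longrightarrow> S (T a) = a"
      "\<And>b. car bd2 b \<Longrightarrow> T (S b) = b"
    using assms(1) unfolding norm_iso_def by blast
  obtain T' S' where 2: "blin bd2 bd3 T'" "blin bd3 bd2 S'" "\<And>a. car bd2 a \<Longrightarrow> S' (T' a) = a"
      "\<And>b. car bd3 b \<Longrightarrow> T' (S' b) = b"
    using assms(2) unfolding norm_iso_def by blast
  have "S (S' (T' (T a))) = a" if "car bd1 a" for a
    using 1 2 that blin_car by metis
  moreover have "T' (T (S (S' b))) = b" if "car bd3 b" for b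
    using 1 2 that blin_car by metis
  ultimately show ?thesis
    unfolding norm_iso_def using blin_comp[OF 1(1) 2(1)] blin_comp[OF 2(2) 1(2)] by blast
qed

text \<open>The hypothesis on \<open>f\<close> says that \<open>W\<close> is isometric to \<open>\<ell>\<^sub>\<infinity>(W)\<close>, by reindexing along \<open>f\<close>.\<close>

lemma pelczynski_decomposition:
  fixes bdW :: "('x \<Rightarrow> 'k::{real_normed_field, euclidean_space}) \<Rightarrow> real \<Rightarrow> bool"
    and bdY :: "('y \<Rightarrow> 'k) \<Rightarrow> real \<Rightarrow> bool" and f :: "nat \<times> 'x \<Rightarrow> 'x"
  assumes "function_norm bdW" "function_norm bdY" "bij f"
    and f: "\<And>w C. bdW w C \<longleftrightarrow> (\<forall>n. bdW (\<lambda>x. w (f (n, x))) C)"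
    and "norm_retract bdY bdW" "norm_retract bdW bdY"
  shows "norm_iso bdW bdY"
proof -
  interpret W: function_norm bdW by fact
  interpret Y: function_norm bdY by fact
  obtain i r where i: "blin bdY bdW i" and r: "blin bdW bdY r" and ri: "\<And>y. car bdY y \<Longrightarrow> r (i y) = y"
    using assms(5) unfolding norm_retract_def by blast
  obtain j q where j: "blin bdW bdY j" and q: "blin bdY bdW q" and qj: "\<And>w. car bdW w \<Longrightarrow> q (j w) = w"
    using assms(6) unfolding norm_retract_def by blast
  define cmp where "cmp n w = (\<lambda>x. w (f (n, x)))" for n and w :: "'x \<Rightarrow> 'k"
  define join where "join u = (\<lambda>x. u (fst (inv f x)) (snd (inv f x)))" for u :: "nat \<Rightarrow> 'x \<Rightarrow> 'k"
  have cj: "cmp n (join u) = u n" for n u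
    unfolding cmp_def join_def using \<open>bij f\<close> by (simp add: bij_is_inj)
  have jc: "join (\<lambda>n. cmp n w) = w" for w
    unfolding cmp_def join_def using \<open>bij f\<close> by (simp add: bij_is_surj surj_f_inv_f)
  have cmp_lin: "cmp n (a + b) = cmp n a + cmp n b" "cmp n (sc c a) = sc c (cmp n a)" for n a b c
    by (auto simp: cmp_def fun_eq_iff)
  have join_lin: "join (\<lambda>n. u n + v n) = join u + join v" "join (\<lambda>n. sc c (u n)) = sc c (join u)" for u v c
    by (auto simp: join_def fun_eq_iff)
  have cmp_bd: "bdW (cmp n w) C" if "bdW w C" for n w C
    using that f unfolding cmp_def by blast
  have join_bd: "bdW (join u) C" if "\<And>n. bdW (u n) C" for u C
    using f[of "join u" C] cj that unfolding cmp_def by presburger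
  have cmp_car [simp]: "car bdW (cmp n w)" if "car bdW w" for n w
    using that cmp_bd unfolding car_def by blast
  have [simp]: "car bdW (i y)" "car bdW (q y)" if "car bdY y" for y
    using blin_car[OF i that] blin_car[OF q that] by auto
  have [simp]: "car bdY (r w)" "car bdY (j w)" if "car bdW w" for w
    using blin_car[OF r that] blin_car[OF j that] by auto
  note lin = blin_add[OF i] blin_add[OF r] blin_add[OF j] blin_add[OF q]
    blin_diff[OF assms(2) i] blin_diff[OF assms(1) r] blin_diff[OF assms(1) j] blin_diff[OF assms(2) q]
    blin_sc[OF i] blin_sc[OF r] blin_sc[OF j] blin_sc[OF q] ri qj
  define P where "P w = i (r w)" for w
  have [simp]: "car bdW (P w)" if "car bdW w" for w
    using that by (simp add: P_def)
  have P1: "P (a + b) = P a + P b" "P (a - b) = P a - P b"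
    if "car bdW a" "car bdW b" for a b
    using that by (simp_all add: P_def lin)
  have P2: "P (sc c a) = sc c (P a)" "P (P a) = P a" if "car bdW a" for a c
    using that by (simp_all add: P_def lin)
  note Plin = P1 P2
  obtain Ki where Ki: "0 \<le> Ki" "\<And>a C. bdY a C \<Longrightarrow> bdW (i a) (Ki * C)" using blin_bound[OF i] by blast
  obtain Kr where Kr: "0 \<le> Kr" "\<And>a C. bdW a C \<Longrightarrow> bdY (r a) (Kr * C)" using blin_bound[OF r] by blast
  obtain Kj where Kj: "0 \<le> Kj" "\<And>a C. bdW a C \<Longrightarrow> bdY (j a) (Kj * C)" using blin_bound[OF j] by blast
  obtain Kq where Kq: "0 \<le> Kq" "\<And>a C. bdY a C \<Longrightarrow> bdW (q a) (Kq * C)" using blin_bound[OF q] by blast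
  define Kp where "Kp = Ki * Kr"
  have Kp: "0 \<le> Kp" "\<And>a C. bdW a C \<Longrightarrow> bdW (P a) (Kp * C)"
    using Ki Kr unfolding Kp_def P_def by (auto simp: mult.assoc)

  \<comment> \<open>Regrouping of infinitely many copies. Each component splits into its part in the
    range of \<open>P\<close>, a copy of Y, and its part in the kernel. The kernel part of component
    m is joined to the range part of component m + 1. What remains, \<open>r (cmp 0 u)\<close> in Y,
    splits along the projection \<open>j\<close> after \<open>q\<close>: its W-coordinate becomes
    component 0, and its part in the kernel of \<open>q\<close> stays outside \<open>j\<close> in
    \<open>\<Theta>\<close>.\<close>
  define V where "V u n = (case n of 0 \<Rightarrow> q (r (cmp 0 u))
      | Suc m \<Rightarrow> (cmp m u - P (cmp m u)) + P (cmp (Suc m) u))" for u n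
  define \<Theta> where "\<Theta> u = j (join (V u)) + (r (cmp 0 u) - j (q (r (cmp 0 u))))" for u
  \<comment> \<open>The regrouping undone: component 0 gets back the element of Y with W-coordinate
    \<open>cmp 0 (q y)\<close> and kernel part \<open>y - j (q y)\<close>, and the parts in the
    kernel of \<open>P\<close> move down one place.\<close>
  define U where "U y n = (case n of
      0 \<Rightarrow> i (j (cmp 0 (q y)) + (y - j (q y))) + (cmp 1 (q y) - P (cmp 1 (q y)))
    | Suc m \<Rightarrow> P (cmp (Suc m) (q y)) + (cmp (Suc (Suc m)) (q y) - P (cmp (Suc (Suc m)) (q y))))" for y n
  define \<Xi> where "\<Xi> y = join (U y)" for y

  define KV where "KV = Kq * Kr + 1 + 2 * Kp"
  have KV: "0 \<le> KV" unfolding KV_def using Kq Kr Kp by auto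
  have V_bd: "bdW (V u n) (KV * C)" if "bdW u C" for u C n
  proof (cases n)
    case 0
    have "bdW (V u 0) (Kq * (Kr * C))" unfolding V_def using Kq Kr cmp_bd[OF that] by simp
    moreover have "Kq * (Kr * C) \<le> KV * C"
      unfolding KV_def using W.bd_nonneg[OF that] Kp by (simp add: distrib_right)
    ultimately show ?thesis using 0 W.bd_mono by blast
  next
    case (Suc m)
    have "bdW (V u n) ((C + Kp * C) + Kp * C)" unfolding V_def Suc nat.case
      by (intro W.bd_add W.bd_diff Kp cmp_bd that)
    moreover have "(C + Kp * C) + Kp * C \<le> KV * C"
      unfolding KV_def using W.bd_nonneg[OF that] Kq Kr by (simp add: distrib_right)
    ultimately show ?thesis using W.bd_mono by blast
  qed
  have V_car: "car bdW (join (V u))" if "car bdW u" for u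
    using that V_bd join_bd unfolding car_def by blast
  define KU where "KU = Ki * (Kj * Kq + (1 + Kj * Kq)) + Kq + 2 * (Kp * Kq) "
  have U_bd: "bdW (U y n) (KU * C)" if "bdY y C" for y C n
  proof (cases n)
    case 0
    have "bdW (U y 0) (Ki * (Kj * (Kq * C) + (C + Kj * (Kq * C))) + (Kq * C + Kp * (Kq * C)))"
      unfolding U_def nat.case
      by (intro W.bd_add W.bd_diff Y.bd_add Y.bd_diff Ki Kj Kp Kq cmp_bd that)
    moreover have "Ki * (Kj * (Kq * C) + (C + Kj * (Kq * C))) + (Kq * C + Kp * (Kq * C)) \<le> KU * C"
      unfolding KU_def using Y.bd_nonneg[OF that] Kp Kq by (simp add: algebra_simps)
    ultimately show ?thesis using 0 W.bd_mono by blast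
  next
    case (Suc m)
    have "bdW (U y n) (Kp * (Kq * C) + (Kq * C + Kp * (Kq * C)))"
      unfolding U_def Suc nat.case by (intro W.bd_add W.bd_diff Kp Kq cmp_bd that)
    moreover have "Kp * (Kq * C) + (Kq * C + Kp * (Kq * C)) \<le> KU * C"
      unfolding KU_def using Y.bd_nonneg[OF that] Kp Kq Ki Kj by (simp add: algebra_simps)
    ultimately show ?thesis using W.bd_mono by blast
  qed
  have U_car: "car bdW (join (U y))" if "car bdY y" for y
    using that U_bd join_bd unfolding car_def by blast

  have \<Theta>: "blin bdW bdY \<Theta>"
  proof (rule blinI[where K = "Kj * KV + (Kr + Kj * (Kq * Kr))"])
    fix a b assume ab: "car bdW a" "car bdW b"
    have "V (a + b) = (\<lambda>n. V a n + V b n)"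
      unfolding V_def using ab by (auto simp: fun_eq_iff lin cmp_lin Plin algebra_simps split: nat.split)
    then show "\<Theta> (a + b) = \<Theta> a + \<Theta> b"
      unfolding \<Theta>_def using ab V_car by (simp add: lin cmp_lin join_lin)
  next
    fix c a assume a: "car bdW a"
    have "V (sc c a) = (\<lambda>n. sc c (V a n))"
      unfolding V_def using a by (auto simp: lin cmp_lin Plin sc_add sc_diff split: nat.split)
    then show "\<Theta> (sc c a) = sc c (\<Theta> a)"
      unfolding \<Theta>_def using a V_car by (simp add: lin cmp_lin join_lin sc_add sc_diff)
  next
    fix u C assume u: "bdW u C"
    have "bdY (\<Theta> u) (Kj * (KV * C) + (Kr * C + Kj * (Kq * (Kr * C))))"
      unfolding \<Theta>_def by (intro Y.bd_add Y.bd_diff Kj Kr Kq join_bd cmp_bd V_bd u)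
    then show "bdY (\<Theta> u) ((Kj * KV + (Kr + Kj * (Kq * Kr))) * C)"
      by (simp add: algebra_simps)
  qed (use Kj Kr Kq KV in auto)
  have \<Xi>: "blin bdY bdW \<Xi>"
  proof (rule blinI[where K = KU])
    fix a b assume ab: "car bdY a" "car bdY b"
    have "U (a + b) = (\<lambda>n. U a n + U b n)"
      unfolding U_def using ab by (auto simp: fun_eq_iff lin cmp_lin Plin algebra_simps split: nat.split)
    then show "\<Xi> (a + b) = \<Xi> a + \<Xi> b"
      unfolding \<Xi>_def by (simp add: join_lin)
  next
    fix c a assume a: "car bdY a"
    have "U (sc c a) = (\<lambda>n. sc c (U a n))"
      unfolding U_def using a
      by (intro ext) (simp add: lin cmp_lin Plin sc_add sc_diff right_diff_distrib distrib_left split: nat.split)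
    then show "\<Xi> (sc c a) = sc c (\<Xi> a)"
      unfolding \<Xi>_def by (simp add: join_lin)
  next
    fix u C assume u: "bdY u C"
    then show "bdW (\<Xi> u) (KU * C)"
      unfolding \<Xi>_def by (intro join_bd U_bd)
  qed (use Ki Kj Kq Kp in \<open>auto simp: KU_def\<close>)

  have "\<Xi> (\<Theta> u) = u" if u: "car bdW u" for u
  proof -
    define v where "v = join (V u)"
    have v: "car bdW v" unfolding v_def using V_car[OF u] .
    define b where "b = r (cmp 0 u) - j (q (r (cmp 0 u)))"
    have b: "car bdY b" "q b = 0" unfolding b_def using u by (simp_all add: lin)
    have \<Theta>u: "\<Theta> u = j v + b" unfolding \<Theta>_def v_def b_def ..
    have q\<Theta>: "q (\<Theta> u) = v" unfolding \<Theta>u using v b by (simp add: lin)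
    have "U (\<Theta> u) n = cmp n u" for n
    proof (cases n)
      case 0
      have 1: "cmp 0 v = q (r (cmp 0 u))" "cmp 1 v = (cmp 0 u - P (cmp 0 u)) + P (cmp 1 u)"
        by (simp_all add: v_def cj V_def fun_eq_iff)
      have 2: "P (cmp 1 v) = P (cmp 1 u)"
        unfolding 1 using u by (simp add: Plin)
      have 3: "j (cmp 0 v) + (\<Theta> u - j v) = r (cmp 0 u)"
        unfolding 1 \<Theta>u b_def by simp
      show ?thesis
        unfolding 0 U_def q\<Theta> nat.case 3 2 unfolding 1 P_def by simp
    next
      case (Suc m)
      show ?thesis
      proof -
        have 1: "cmp (Suc k) v = (cmp k u - P (cmp k u)) + P (cmp (Suc k) u)" for k
          by (simp add: v_def cj V_def fun_eq_iff)
        have 2: "P (cmp (Suc k) v) = P (cmp (Suc k) u)" for k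
          unfolding 1 using u by (simp add: Plin)
        show ?thesis unfolding Suc U_def q\<Theta> nat.case 2 unfolding 1 by simp
      qed
    qed
    then have "U (\<Theta> u) = (\<lambda>n. cmp n u)" by blast
    then show ?thesis unfolding \<Xi>_def using jc[of u] by metis
  qed
  moreover have "\<Theta> (\<Xi> y) = y" if y: "car bdY y" for y
  proof -
    define y0 where "y0 = j (cmp 0 (q y)) + (y - j (q y))"
    have y0: "car bdY y0" unfolding y0_def using y by simp
    have c: "cmp n (\<Xi> y) = U y n" for n unfolding \<Xi>_def by (rule cj)
    have "r (U y 0) = y0"
      unfolding U_def nat.case y0_def[symmetric] using y y0 by (simp add: lin P_def)
    moreover have PU: "P (U y 0) = i y0" using calculation by (simp add: P_def)
    moreover have "q y0 = cmp 0 (q y)"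
      unfolding y0_def using y by (simp add: lin)
    moreover have "V (\<Xi> y) n = cmp n (q y)" for n
    proof (cases n)
      case 0
      then show ?thesis unfolding V_def c using calculation by simp
    next
      case (Suc m)
      have P: "P (U y (Suc k)) = P (cmp (Suc k) (q y))" for k
        unfolding U_def using y by (simp add: Plin)
      show ?thesis
      proof (cases m)
        case 0
        then show ?thesis unfolding V_def c Suc nat.case P using PU by (simp add: U_def y0_def[symmetric])
      next
        case (Suc m')
        then show ?thesis unfolding V_def c \<open>n = Suc m\<close> nat.case P Suc by (simp add: U_def)
      qed
    qed
    then have "V (\<Xi> y) = (\<lambda>n. cmp n (q y))" by auto
    then have "join (V (\<Xi> y)) = q y" by (simp add: jc)
    ultimately show ?thesis unfolding \<Theta>_def c by (simp add: y0_def)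
  qed
  ultimately show ?thesis
    unfolding norm_iso_def using \<Theta> \<Xi> by blast
qed

section \<open>Series and perturbations of scalar multiples\<close>

context closed_function_norm
begin

lemma bd_suminf:
  assumes u: "\<And>n. bd (u n) (C / 2 ^ n)"
  shows "summable (\<lambda>n. u n x)"
    and "bd (\<lambda>x. \<Sum>n. u n x) (2 * C)"
proof -
  have sumC: "(\<lambda>n. C / 2 ^ n) sums (2 * C)"
    using geometric_sums[of "1/2::real"] sums_mult[of "\<lambda>n. (1/2)^n" 2 C]
    by (simp add: power_divide mult.commute)
  show 1: "summable (\<lambda>n. u n x)" for x
    by (rule summable_comparison_test'[OF sums_summable[OF sumC], of 0]) (use u bd_entry in auto)
  have "bd (\<Sum>n<m. u n) (2 * C)" for m
  proof -
    have "bd (\<Sum>n<m. u n) (\<Sum>n<m. C / 2 ^ n)"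
      using u by (intro bd_sum) auto
    moreover have "(\<Sum>n<m. C / 2 ^ n) \<le> (\<Sum>n. C / 2 ^ n)"
      by (intro sum_le_suminf sums_summable[OF sumC]) (use bd_nonneg[OF u] in auto)
    ultimately show ?thesis using bd_mono sums_unique[OF sumC] by metis
  qed
  then show "bd (\<lambda>x. \<Sum>n. u n x) (2 * C)"
    by (rule bd_lim) (use summable_LIMSEQ[OF 1] in \<open>simp add: sum_fun_apply\<close>)
qed

text \<open>With E = S - \<mu>, the operator E / \<mu> has norm at most 1/2, so the Neumann series
  for the inverse converges. A right inverse makes the space a retract of every space through which
  \<open>S\<close> factors, and this is its purpose.\<close>

lemma bounded_right_inverse:
  assumes S: "blin bd bd S" and \<mu>: "1 / 2 \<le> norm \<mu>"
    and E: "\<And>w C. bd w C \<Longrightarrow> bd (S w - sc \<mu> w) (C / 4)"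
  obtains G where "blin bd bd G" and "\<And>w. car bd w \<Longrightarrow> S (G w) = w"
proof -
  have \<mu>0: "\<mu> \<noteq> 0" using \<mu> by auto
  then have \<mu>2: "1 / norm \<mu> \<le> 2" using \<mu> by (simp add: field_simps)
  \<comment> \<open>The n-th term of the Neumann series: -E / \<mu>, iterated n times, applied to w
    / \<mu>.\<close>
  define u where "u w = rec_nat (sc (1 / \<mu>) w) (\<lambda>n v. sc (- 1 / \<mu>) (S v - sc \<mu> v))" for w
  have u0: "u w 0 = sc (1 / \<mu>) w" and uS: "u w (Suc n) = sc (- 1 / \<mu>) (S (u w n) - sc \<mu> (u w n))" for w n
    by (simp_all add: u_def)
  have u: "bd (u w n) ((2 * C) / 2 ^ n)" if "bd w C" for w n C
  proof (induction n)
    case 0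
    have "norm (1 / \<mu>) * C \<le> 2 * C"
      using \<mu>2 bd_nonneg[OF that] by (intro mult_right_mono) (auto simp: norm_divide)
    then have "bd (u w 0) (2 * C)" unfolding u0 using bd_sc[OF that, of "1 / \<mu>"] bd_mono by blast
    then show ?case by simp
  next
    case (Suc n)
    have "norm (- 1 / \<mu>) * ((2 * C) / 2 ^ n / 4) \<le> 2 * ((2 * C) / 2 ^ n / 4)"
      using \<mu>2 bd_nonneg[OF that] by (intro mult_right_mono) (auto simp: norm_divide)
    then have "bd (u w (Suc n)) (2 * ((2 * C) / 2 ^ n / 4))"
      unfolding uS using bd_sc[OF E[OF Suc], of "- 1 / \<mu>"] bd_mono by blast
    then show ?case by simp
  qed
  have ucar: "car bd (u w n)" if "car bd w" for w n
    using that u unfolding car_def by blast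
  define G where "G w = (\<lambda>x. \<Sum>n. u w n x)" for w
  have summ: "summable (\<lambda>n. u w n x)" if "car bd w" for w x
    using that bd_suminf(1)[of "u w"] u unfolding car_def by blast
  have Gbd: "bd (G w) (4 * C)" if "bd w C" for w C
    using bd_suminf(2)[OF u[OF that]] unfolding G_def by simp
  have G: "blin bd bd G"
  proof (rule blinI[where K = 4])
    fix a b assume ab: "car bd a" "car bd b"
    have "u (a + b) n = u a n + u b n" for n
    proof (induction n)
      case (Suc n)
      show ?case
        unfolding uS Suc blin_add[OF S ucar[OF ab(1)] ucar[OF ab(2)]]
        by (simp add: fun_eq_iff field_simps flip: add_divide_distrib)
    qed (simp only: u0 sc_add)
    then show "G (a + b) = G a + G b"
      unfolding G_def using ab summ by (auto simp: fun_eq_iff suminf_add)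
  next
    fix c a assume a: "car bd a"
    have "u (sc c a) n = sc c (u a n)" for n
    proof (induction n)
      case (Suc n)
      show ?case
        unfolding uS Suc blin_sc[OF S ucar[OF a]] by (simp add: fun_eq_iff field_simps)
    qed (simp add: u0 fun_eq_iff)
    then show "G (sc c a) = sc c (G a)"
      unfolding G_def using a summ by (auto simp: fun_eq_iff suminf_mult)
  qed (use Gbd in auto)
  have "S (G w) = w" if w: "car bd w" for w
  proof
    fix x
    obtain C where C: "bd w C" using w by (auto simp: car_def)
    obtain K where K: "0 \<le> K" "\<And>a C. bd a C \<Longrightarrow> bd (S a) (K * C)" using blin_bound[OF S] by blast
    have Suu: "S (u w n) = sc \<mu> (u w n) - sc \<mu> (u w (Suc n))" for n
      using \<mu>0 by (simp add: uS fun_eq_iff)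
    have partial: "S (\<Sum>k<n. u w k) = w - sc \<mu> (u w n)" for n
    proof -
      have "S (\<Sum>k<n. u w k) = (\<Sum>k<n. sc \<mu> (u w k) - sc \<mu> (u w (Suc k)))"
        using blin_sum[OF function_norm_axioms S, of "{..<n}"] ucar[OF w] Suu by simp
      also have "\<dots> = sc \<mu> (u w 0) - sc \<mu> (u w n)"
        by (rule sum_lessThan_telescope')
      also have "sc \<mu> (u w 0) = w" using \<mu>0 by (simp add: u0)
      finally show ?thesis .
    qed
    \<comment> \<open>\<open>S\<close> is bounded but need not respect entrywise limits, so it can
      be applied to \<open>G w\<close> only after the tail of the series has been shown to be small
      for \<open>bd\<close>.\<close>
    have tail: "bd (G w - (\<Sum>k<n. u w k)) (4 * C / 2 ^ n)" for n
    proof -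
      have "bd (\<lambda>x. \<Sum>k. u w (k + n) x) (2 * (2 * C / 2 ^ n))"
      proof (rule bd_suminf)
        show "bd (u w (k + n)) (2 * C / 2 ^ n / 2 ^ k)" for k
          using u[OF C, of "k + n"] by (simp add: power_add mult.commute)
      qed
      moreover have "(\<lambda>x. \<Sum>k. u w (k + n) x) = G w - (\<Sum>k<n. u w k)"
        unfolding G_def using suminf_minus_initial_segment[OF summ[OF w]]
        by (auto simp: fun_eq_iff sum_fun_apply)
      ultimately show ?thesis by simp
    qed
    have "norm (S (G w) x - w x) \<le> (4 * K * C + norm \<mu> * (2 * C)) * (1 / 2) ^ n" for n
    proof -
      define t where "t = G w - (\<Sum>k<n. u w k)"
      have "car bd (\<Sum>k<n. u w k)" "car bd t"
        using ucar[OF w] tail carI unfolding t_def by (auto intro!: car_sum)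
      then have "S (t + (\<Sum>k<n. u w k)) = S t + (w - sc \<mu> (u w n))"
        using blin_add[OF S] partial by simp
      then have "S (G w) = S t + (w - sc \<mu> (u w n))" by (simp add: t_def)
      then have "norm (S (G w) x - w x) = norm (S t x - \<mu> * u w n x)" by simp
      also have "\<dots> \<le> norm (S t x) + norm (\<mu> * u w n x)"
        by (rule norm_triangle_ineq4)
      also have "\<dots> \<le> K * (4 * C / 2 ^ n) + norm \<mu> * (2 * C / 2 ^ n)"
        using bd_entry[OF K(2)[OF tail]] bd_entry[OF u[OF C]] unfolding t_def
        by (intro add_mono) (simp_all add: norm_mult mult_left_mono del: times_divide_eq_right)
      finally show ?thesis by (simp add: field_simps power_divide)
    qed
    moreover have "(\<lambda>n. (4 * K * C + norm \<mu> * (2 * C)) * (1 / 2) ^ n) \<longlonglongrightarrow> (4 * K * C + norm \<mu> * (2 * C)) * 0"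
      by (intro tendsto_mult_left LIMSEQ_realpow_zero) auto
    ultimately have "norm (S (G w) x - w x) \<le> (4 * K * C + norm \<mu> * (2 * C)) * 0"
      by (intro LIMSEQ_le_const) blast+
    then show "S (G w) x = w x" by simp
  qed
  then show ?thesis using that G by blast
qed

end

section \<open>Ultralimits\<close>

text \<open>Zorn's lemma for the proper filters below \<open>sequentially\<close>, finer ones
  counting as larger. A finest one decides every predicate, since otherwise intersecting it with the
  predicate would refine it further.\<close>

lemma free_ultrafilter_exists:
  obtains U :: "nat filter" where "U \<noteq> bot" and "U \<le> sequentially"
    and "\<And>P. eventually P U \<or> eventually (\<lambda>x. \<not> P x) U"
proof -
  let ?A = "{F :: nat filter. F \<noteq> bot \<and> F \<le> sequentially}"
  have "\<exists>U\<in>?A. \<forall>F\<in>?A. F \<le> U \<longrightarrow> F = U"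
  proof (rule predicate_Zorn[where P = "(\<ge>)"])
    show "partial_order_on ?A (relation_of (\<ge>) ?A)"
      by (rule partial_order_on_relation_ofI) auto
  next
    fix C assume C: "C \<in> Chains (relation_of (\<ge>) ?A)"
    have sub: "C \<subseteq> ?A" and tot: "\<And>F G. F \<in> C \<Longrightarrow> G \<in> C \<Longrightarrow> F \<le> G \<or> G \<le> F"
      using C by (auto simp: Chains_def relation_of_def)
    show "\<exists>u\<in>?A. \<forall>a\<in>C. u \<le> a"
    proof (cases "C = {}")
      case True
      then show ?thesis by (intro bexI[of _ sequentially]) auto
    next
      case False
      \<comment> \<open>A chain of filters is a filter base, so its infimum is proper:
        \<open>False\<close> would hold eventually already in a member of the chain.\<close>
      have "eventually P (Inf C) \<longleftrightarrow> (\<exists>F\<in>C. eventually P F)" for P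
        by (rule eventually_Inf_base[OF False]) (use tot in \<open>metis inf_greatest order_refl\<close>)
      then have "Inf C \<noteq> bot"
        using sub unfolding trivial_limit_def by blast
      moreover have "Inf C \<le> sequentially"
      proof -
        obtain F where "F \<in> C" using False by blast
        then show ?thesis using sub Inf_lower[of F C] order_trans by blast
      qed
      ultimately show ?thesis by (intro bexI[of _ "Inf C"]) (auto intro: Inf_lower)
    qed
  qed
  then obtain U where U: "U \<noteq> bot" "U \<le> sequentially"
    and max: "\<And>F. F \<noteq> bot \<Longrightarrow> F \<le> sequentially \<Longrightarrow> F \<le> U \<Longrightarrow> F = U"
    by auto
  have "eventually P U \<or> eventually (\<lambda>x. \<not> P x) U" for P
  proof (rule disjCI)
    assume "\<not> eventually (\<lambda>x. \<not> P x) U"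
    then have "inf U (principal {x. P x}) \<noteq> bot"
      by (auto simp: trivial_limit_def eventually_inf_principal)
    then have "inf U (principal {x. P x}) = U"
      using max U by (meson inf_le1 order_trans)
    then show "eventually P U"
      using eventually_inf_principal[of P U "{x. P x}"] by simp
  qed
  then show ?thesis using that U by blast
qed

definition free_ultra :: "nat filter" where
  "free_ultra = (SOME U. U \<noteq> bot \<and> U \<le> sequentially \<and>
     (\<forall>P. eventually P U \<or> eventually (\<lambda>x. \<not> P x) U))"

lemma free_ultra:
  shows free_ultra_neq_bot: "free_ultra \<noteq> bot"
    and free_ultra_le: "free_ultra \<le> sequentially"
    and free_ultra_dichotomy: "eventually P free_ultra \<or> eventually (\<lambda>x. \<not> P x) free_ultra"
proof -
  have "\<exists>U::nat filter. U \<noteq> bot \<and> U \<le> sequentially \<and>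
     (\<forall>P. eventually P U \<or> eventually (\<lambda>x. \<not> P x) U)"
    using free_ultrafilter_exists by metis
  from someI_ex[OF this, folded free_ultra_def]
  show "free_ultra \<noteq> bot" "free_ultra \<le> sequentially"
    "eventually P free_ultra \<or> eventually (\<lambda>x. \<not> P x) free_ultra" by auto
qed

text \<open>Ultralimits exist for all bounded sequences of scalars and respect sums and scalar
  multiples; this gives linear operators where ordinary limits might fail to exist.\<close>

definition ulim :: "(nat \<Rightarrow> 'a::t2_space) \<Rightarrow> 'a" where
  "ulim f = Lim free_ultra f"

lemma ulim_eqI: "(f \<longlongrightarrow> l) free_ultra \<Longrightarrow> ulim f = l"
  unfolding ulim_def using free_ultra_neq_bot by (rule tendsto_Lim)

lemma ulim_LIMSEQ: "f \<longlonglongrightarrow> l \<Longrightarrow> ulim f = l"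
  by (meson ulim_eqI filterlim_mono free_ultra_le order_refl)

text \<open>By compactness the image filter has a cluster point, and an ultrafilter converges to
  each of its cluster points.\<close>

lemma tendsto_ulim:
  fixes f :: "nat \<Rightarrow> 'a::{real_normed_vector, heine_borel}"
  assumes "\<And>n. norm (f n) \<le> C"
  shows "(f \<longlongrightarrow> ulim f) free_ultra"
proof -
  have "eventually (\<lambda>y. y \<in> cball 0 C) (filtermap f free_ultra)"
    using assms by (simp add: eventually_filtermap)
  moreover have "filtermap f free_ultra \<noteq> bot"
    using free_ultra_neq_bot by (simp add: filtermap_bot_iff)
  ultimately obtain l where l: "inf (nhds l) (filtermap f free_ultra) \<noteq> bot"
    using compact_cball[of "0::'a" C] unfolding compact_filter by meson
  have "(f \<longlongrightarrow> l) free_ultra"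
  proof (rule topological_tendstoI)
    fix S assume "open S" "l \<in> S"
    have False if "eventually (\<lambda>x. f x \<notin> S) free_ultra"
    proof -
      have "eventually (\<lambda>y. y \<in> S) (nhds l)"
        using \<open>open S\<close> \<open>l \<in> S\<close> by (simp add: eventually_nhds_in_open)
      moreover have "eventually (\<lambda>y. y \<notin> S) (filtermap f free_ultra)"
        using that by (simp add: eventually_filtermap)
      ultimately have "eventually (\<lambda>y. False) (inf (nhds l) (filtermap f free_ultra))"
        unfolding eventually_inf by blast
      then show False using l by (simp add: trivial_limit_def)
    qed
    then show "eventually (\<lambda>x. f x \<in> S) free_ultra"
      using free_ultra_dichotomy by blast
  qed
  then show ?thesis using ulim_eqI by metis
qed

section \<open>Multilinear forms as arrays\<close>

type_synonym 'k arr = "(nat \<Rightarrow> nat) \<Rightarrow> 'k"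
type_synonym 'k blocks = "nat \<times> (nat \<Rightarrow> nat) \<Rightarrow> 'k"

locale exponents =
  fixes I :: "nat set" and p :: "nat \<Rightarrow> real"
  assumes finite_I: "finite I" and I_nonempty: "I \<noteq> {}"
    and p_gt_1: "\<And>l. l \<in> I \<Longrightarrow> 1 < p l"
    and sum_inverse_p: "1 \<le> (\<Sum>l\<in>I. 1 / p l)"
begin

definition idx :: "(nat \<Rightarrow> nat) set" where
  "idx = (\<Pi>\<^sub>E l\<in>I. UNIV)"

definition cube :: "nat \<Rightarrow> (nat \<Rightarrow> nat) set" where
  "cube n = (\<Pi>\<^sub>E l\<in>I. {..<n})"

definition form :: "('k::{real_normed_field, euclidean_space}) arr \<Rightarrow> (nat \<Rightarrow> nat set) \<Rightarrow>
    (nat \<Rightarrow> nat \<Rightarrow> 'k) \<Rightarrow> 'k" where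
  "form a A x = (\<Sum>i\<in>Pi\<^sub>E I A. a i * (\<Prod>l\<in>I. x l (i l)))"

definition pnorm :: "nat \<Rightarrow> nat set \<Rightarrow> (nat \<Rightarrow> 'k::{real_normed_field, euclidean_space}) \<Rightarrow> real" where
  "pnorm l A x = (\<Sum>s\<in>A. norm (x s) powr p l) powr (1 / p l)"

text \<open>Coordinates of \<open>x l\<close> outside \<open>A l\<close> are ignored, so a test
  amounts to a finitely supported vector in the unit ball of each factor, and the norm of a form is
  defined through finite sums alone.\<close>

definition unit_test :: "(nat \<Rightarrow> nat set) \<Rightarrow> (nat \<Rightarrow> nat \<Rightarrow> 'k::{real_normed_field, euclidean_space}) \<Rightarrow> bool" where
  "unit_test A x \<longleftrightarrow> (\<forall>l\<in>I. finite (A l) \<and> (\<Sum>s\<in>A l. norm (x l s) powr p l) \<le> 1)"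

text \<open>
  The dual of the projective tensor product is the space of bounded multilinear forms; \<open>a i\<close> is the
  value of the form at \<open>(e\<^bsub>i 1\<^esub>, \<dots>, e\<^bsub>i N\<^esub>)\<close>, and \<open>bd a C\<close> says that the norm of the form is at most \<open>C\<close>.
\<close>

definition bd :: "('k::{real_normed_field, euclidean_space}) arr \<Rightarrow> real \<Rightarrow> bool" where
  "bd a C \<longleftrightarrow> (\<forall>i. i \<notin> idx \<longrightarrow> a i = 0) \<and> (\<forall>A x. unit_test A x \<longrightarrow> norm (form a A x) \<le> C)"

lemma p_pos: "l \<in> I \<Longrightarrow> 0 < p l"
  using p_gt_1 by fastforce

lemma pnorm_nonneg [simp]: "0 \<le> pnorm l A x"
  by (simp add: pnorm_def)

lemma pnorm_powr: "l \<in> I \<Longrightarrow> pnorm l A x powr p l = (\<Sum>s\<in>A. norm (x s) powr p l)"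
  using p_pos[of l] by (simp add: pnorm_def powr_powr sum_nonneg)

lemma finite_cube [simp]: "finite (cube n)"
  unfolding cube_def using finite_I by (intro finite_PiE) auto

lemma cube_subset_idx: "cube n \<subseteq> idx"
  unfolding cube_def idx_def by (intro PiE_mono) auto

lemma card_cube: "card (cube n) = n ^ card I"
  unfolding cube_def using finite_I by (simp add: card_PiE)

lemma countable_idx: "countable idx"
  unfolding idx_def using finite_I by (intro countable_PiE) auto

lemma bd_support: "bd a C \<Longrightarrow> i \<notin> idx \<Longrightarrow> a i = 0"
  by (auto simp: bd_def)

lemma form_le: "bd a C \<Longrightarrow> unit_test A x \<Longrightarrow> norm (form a A x) \<le> C"
  by (auto simp: bd_def)

lemma unit_test_entry:
  assumes "unit_test A x" "l \<in> I" "s \<in> A l"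
  shows "norm (x l s) \<le> 1"
proof -
  have "norm (x l s) powr p l \<le> (\<Sum>s\<in>A l. norm (x l s) powr p l)"
    using assms by (intro member_le_sum) (auto simp: unit_test_def)
  also have "\<dots> \<le> 1" using assms by (auto simp: unit_test_def)
  finally show ?thesis
    using powr_less_mono2[OF p_pos[OF assms(2)], of 1 "norm (x l s)"] powr_one_eq_one[of "p l"] by linarith
qed

text \<open>By homogeneity each factor is scaled to norm one. A factor of norm zero cannot be
  scaled, but it vanishes on \<open>A l\<close> and makes the form vanish.\<close>

lemma form_le_pnorm:
  assumes a: "bd a C" and A: "\<And>l. l \<in> I \<Longrightarrow> finite (A l)"
  shows "norm (form a A x) \<le> C * (\<Prod>l\<in>I. pnorm l (A l) (x l))"
proof (cases "\<exists>l\<in>I. pnorm l (A l) (x l) = 0")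
  case True
  then obtain l where l: "l \<in> I" "pnorm l (A l) (x l) = 0" by blast
  then have "(\<Sum>s\<in>A l. norm (x l s) powr p l) = 0"
    using p_pos by (auto simp: pnorm_def)
  then have "x l s = 0" if "s \<in> A l" for s
    using A[OF l(1)] that by (auto simp: sum_nonneg_eq_0_iff)
  then have "(\<Prod>l\<in>I. x l (i l)) = 0" if "i \<in> Pi\<^sub>E I A" for i
    using that l(1) finite_I by (auto intro!: prod_zero bexI[of _ l])
  then have "form a A x = 0" by (simp add: form_def)
  moreover have "(\<Prod>l\<in>I. pnorm l (A l) (x l)) = 0"
    using l finite_I by (auto intro!: prod_zero bexI[of _ l])
  ultimately show ?thesis by simp
next
  case False
  define t where "t l = pnorm l (A l) (x l)" for l
  have t: "0 < t l" if "l \<in> I" for l using False that pnorm_nonneg[of l] unfolding t_def by (metis less_eq_real_def)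
  define y where "y l s = x l s / of_real (t l)" for l s
  have "unit_test A y"
    unfolding unit_test_def
  proof (intro ballI conjI A)
    fix l assume l: "l \<in> I"
    have "(\<Sum>s\<in>A l. norm (y l s) powr p l) = (\<Sum>s\<in>A l. norm (x l s) powr p l / t l powr p l)"
      using t[OF l] by (auto simp: y_def norm_divide powr_divide intro!: sum.cong)
    also have "\<dots> = 1"
    proof -
      have "0 < t l powr p l" using t[OF l] by simp
      then show ?thesis
        using pnorm_powr[OF l, of "A l" "x l"] unfolding t_def by (simp flip: sum_divide_distrib)
    qed
    finally show "(\<Sum>s\<in>A l. norm (y l s) powr p l) \<le> 1" by simp
  qed
  then have *: "norm (form a A y) \<le> C" using a form_le by blast
  have "form a A x = of_real (\<Prod>l\<in>I. t l) * form a A y"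
  proof -
    have "(\<Prod>l\<in>I. x l (i l)) = of_real (\<Prod>l\<in>I. t l) * (\<Prod>l\<in>I. y l (i l))" for i
    proof -
      have "(\<Prod>l\<in>I. x l (i l)) = (\<Prod>l\<in>I. of_real (t l) * y l (i l))"
        by (intro prod.cong) (use t in \<open>auto simp: y_def\<close>, fastforce)
      then show ?thesis by (simp add: prod.distrib)
    qed
    then show ?thesis unfolding form_def by (simp add: sum_distrib_left mult_ac)
  qed
  then have "norm (form a A x) = (\<Prod>l\<in>I. t l) * norm (form a A y)"
    using t by (simp add: norm_mult abs_prod prod_nonneg less_imp_le del: of_real_prod)
  also have "\<dots> \<le> (\<Prod>l\<in>I. t l) * C"
    using * t by (intro mult_left_mono prod_nonneg) (auto simp: less_imp_le)
  finally show ?thesis by (simp add: t_def mult.commute)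
qed

lemma form_add: "form (a + b) A x = form a A x + form b A x"
  by (simp add: form_def sum.distrib distrib_right)

lemma form_sc: "form (sc c a) A x = c * form a A x"
  by (simp add: form_def sum_distrib_left mult.assoc)

lemma form_singleton:
  assumes "i \<in> idx"
  shows "form a (\<lambda>l. {i l}) x = a i * (\<Prod>l\<in>I. x l (i l))"
proof -
  have "Pi\<^sub>E I (\<lambda>l. {i l}) = {i}" using assms PiE_singleton[of i I] unfolding idx_def by (auto simp: PiE_iff)
  then show ?thesis by (simp add: form_def)
qed

text \<open>Each coordinate of a unit test has modulus at most one, so only the number of entries
  counts. This crude bound decides how small the entries have to be made in
  \<open>compression\<close>.\<close>

lemma form_finite_support:
  assumes "finite S" "\<And>i. i \<notin> S \<Longrightarrow> a i = 0" "\<And>i. norm (a i) \<le> \<epsilon>" "unit_test A x"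
  shows "norm (form a A x) \<le> real (card S) * \<epsilon>"
proof -
  have fin: "finite (Pi\<^sub>E I A)" using assms(4) finite_I by (intro finite_PiE) (auto simp: unit_test_def)
  have "0 \<le> \<epsilon>" using assms(3) norm_ge_zero order_trans by blast
  have "form a A x = (\<Sum>i\<in>Pi\<^sub>E I A \<inter> S. a i * (\<Prod>l\<in>I. x l (i l)))"
    unfolding form_def by (rule sum.mono_neutral_right) (use fin assms(2) in auto)
  also have "norm \<dots> \<le> (\<Sum>i\<in>Pi\<^sub>E I A \<inter> S. \<epsilon> :: real)"
  proof (rule sum_norm_le)
    fix i assume i: "i \<in> Pi\<^sub>E I A \<inter> S"
    have "norm (\<Prod>l\<in>I. x l (i l)) \<le> 1"
      unfolding prod_norm[symmetric] using i unit_test_entry[OF assms(4)]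
      by (intro prod_le_1) (auto simp: PiE_iff)
    then show "norm (a i * (\<Prod>l\<in>I. x l (i l))) \<le> \<epsilon>"
      using assms(3)[of i] \<open>0 \<le> \<epsilon>\<close> unfolding norm_mult
      by (metis mult.right_neutral mult_mono norm_ge_zero)
  qed
  also have "\<dots> \<le> real (card S) * \<epsilon>"
    using \<open>0 \<le> \<epsilon>\<close> assms(1) by (auto intro!: mult_right_mono card_mono)
  finally show ?thesis .
qed

lemma bd_finite_support:
  assumes "finite S" "S \<subseteq> idx" "\<And>i. i \<notin> S \<Longrightarrow> a i = 0" "\<And>i. norm (a i) \<le> \<epsilon>"
  shows "bd a (real (card S) * \<epsilon>)"
  unfolding bd_def
proof (intro conjI allI impI)
  show "norm (form a A x) \<le> real (card S) * \<epsilon>" if "unit_test A x" for A x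
    by (rule form_finite_support[OF assms(1) _ assms(4) that]) (rule assms(3))
qed (use assms in auto)

lemma closed_function_norm_bd: "closed_function_norm (bd :: ('k::{real_normed_field, euclidean_space}) arr \<Rightarrow> real \<Rightarrow> bool)"
proof
  fix a b :: "'k arr" and C D :: real and c :: 'k and f :: "nat \<Rightarrow> 'k arr" and g :: "'k arr"
  show "bd (a + b) (C + D)" if "bd a C" "bd b D"
    using that norm_triangle_mono unfolding bd_def form_add by fastforce
  show "bd (sc c a) (norm c * C)" if "bd a C"
    using that unfolding bd_def form_sc by (auto simp: norm_mult mult_left_mono)
  show "bd (0 :: 'k arr) 0"
    by (simp add: bd_def form_def)
  show "bd a D" if "bd a C" "C \<le> D"
    using that unfolding bd_def by (meson order_trans)
  show "norm (a i) \<le> C" if "bd a C" for i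
  proof (cases "i \<in> idx")
    case True
    have "unit_test (\<lambda>l. {i l}) (\<lambda>_ _. 1)" by (simp add: unit_test_def)
    from form_le[OF that this] show ?thesis by (simp add: form_singleton[OF True])
  next
    case False
    have "unit_test (\<lambda>l. {}) (\<lambda>_ _. 1)" by (simp add: unit_test_def)
    then have "0 \<le> C" using form_le[OF that] norm_ge_zero order_trans by blast
    then show ?thesis using bd_support[OF that False] by simp
  qed
  show "bd g C" if "\<And>n. bd (f n) C" "\<And>x. (\<lambda>n. f n x) \<longlonglongrightarrow> g x"
    unfolding bd_def
  proof (intro conjI allI impI)
    fix i assume "i \<notin> idx"
    then have "(\<lambda>n. f n i) = (\<lambda>_. 0)" using that(1) bd_support by blast
    then show "g i = 0" using that(2)[of i] LIMSEQ_unique tendsto_const by metis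
  next
    fix A x assume "unit_test A (x :: nat \<Rightarrow> nat \<Rightarrow> 'k)"
    then have "norm (form (f n) A x) \<le> C" for n using that(1) form_le by blast
    moreover have "(\<lambda>n. norm (form (f n) A x)) \<longlonglongrightarrow> norm (form g A x)"
      unfolding form_def by (intro tendsto_intros that(2))
    ultimately show "norm (form g A x) \<le> C" by (meson LIMSEQ_le_const2)
  qed
qed

sublocale V: closed_function_norm bd
  by (rule closed_function_norm_bd)

section \<open>Restriction to boxes and transport along grids\<close>

lemma form_Int:
  assumes "\<And>l. l \<in> I \<Longrightarrow> finite (A l)"
    and "\<And>i. i \<in> Pi\<^sub>E I A \<Longrightarrow> a i = (if \<forall>l\<in>I. i l \<in> B l then b i else 0)"
  shows "form a A x = form b (\<lambda>l. A l \<inter> B l) x"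
proof -
  have "form a A x = (\<Sum>i\<in>Pi\<^sub>E I (\<lambda>l. A l \<inter> B l). a i * (\<Prod>l\<in>I. x l (i l)))"
    unfolding form_def
  proof (rule sum.mono_neutral_right)
    show "finite (Pi\<^sub>E I A)" using assms(1) finite_I by (rule finite_PiE[rotated])
    show "Pi\<^sub>E I (\<lambda>l. A l \<inter> B l) \<subseteq> Pi\<^sub>E I A" by (rule PiE_mono) auto
    show "\<forall>i\<in>Pi\<^sub>E I A - Pi\<^sub>E I (\<lambda>l. A l \<inter> B l). a i * (\<Prod>l\<in>I. x l (i l)) = 0"
    proof
      fix i assume i: "i \<in> Pi\<^sub>E I A - Pi\<^sub>E I (\<lambda>l. A l \<inter> B l)"
      then have "\<not> (\<forall>l\<in>I. i l \<in> B l)" by (auto simp: PiE_iff)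
      then show "a i * (\<Prod>l\<in>I. x l (i l)) = 0" using assms(2) i by auto
    qed
  qed
  also have "\<dots> = form b (\<lambda>l. A l \<inter> B l) x"
    unfolding form_def by (rule sum.cong) (use assms(2) in \<open>auto simp: PiE_iff\<close>)
  finally show ?thesis .
qed

lemma unit_test_mono:
  assumes "unit_test A x" "\<And>l. l \<in> I \<Longrightarrow> B l \<subseteq> A l"
  shows "unit_test B x"
  unfolding unit_test_def
proof (intro ballI conjI)
  fix l assume l: "l \<in> I"
  show fin: "finite (B l)" using assms l finite_subset unfolding unit_test_def by blast
  have "(\<Sum>s\<in>B l. norm (x l s) powr p l) \<le> (\<Sum>s\<in>A l. norm (x l s) powr p l)"
    using assms l by (intro sum_mono2) (auto simp: unit_test_def)
  then show "(\<Sum>s\<in>B l. norm (x l s) powr p l) \<le> 1"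
    using assms(1) l unfolding unit_test_def by fastforce
qed

text \<open>Cutting a form down to a box amounts to composing it with coordinate projections, which
  do not increase the norms of the test vectors.\<close>

lemma bd_restrict:
  assumes "bd a C"
  shows "bd (\<lambda>i. if \<forall>l\<in>I. i l \<in> B l then a i else 0) C"
  unfolding bd_def
proof (intro conjI allI impI)
  fix A x assume t: "unit_test A (x :: nat \<Rightarrow> nat \<Rightarrow> 'a)"
  have "form (\<lambda>i. if \<forall>l\<in>I. i l \<in> B l then a i else 0) A x = form a (\<lambda>l. A l \<inter> B l) x"
    by (rule form_Int) (use t in \<open>auto simp: unit_test_def\<close>)
  also have "norm \<dots> \<le> C"
    using assms by (rule form_le) (rule unit_test_mono[OF t], auto)
  finally show "norm (form (\<lambda>i. if \<forall>l\<in>I. i l \<in> B l then a i else 0) A x) \<le> C" .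
qed (use bd_support[OF assms] in auto)

definition grid :: "(nat \<Rightarrow> nat \<Rightarrow> nat) \<Rightarrow> (nat \<Rightarrow> nat) \<Rightarrow> nat \<Rightarrow> nat" where
  "grid \<tau> v = (\<lambda>l\<in>I. \<tau> l (v l))"

lemma grid_in_idx [simp]: "grid \<tau> v \<in> idx"
  by (auto simp: grid_def idx_def)

lemma grid_apply: "l \<in> I \<Longrightarrow> grid \<tau> v l = \<tau> l (v l)"
  by (simp add: grid_def)

lemma inj_on_grid:
  assumes "\<And>l. l \<in> I \<Longrightarrow> inj_on (\<tau> l) (A l)"
  shows "inj_on (grid \<tau>) (Pi\<^sub>E I A)"
proof (rule inj_onI)
  fix v w assume v: "v \<in> Pi\<^sub>E I A" and w: "w \<in> Pi\<^sub>E I A" and eq: "grid \<tau> v = grid \<tau> w"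
  have "v l = w l" if "l \<in> I" for l
    using assms[OF that] eq v w that by (metis PiE_mem grid_apply inj_on_def)
  then show "v = w" using v w PiE_ext by blast
qed

lemma grid_image:
  "grid \<tau> ` Pi\<^sub>E I A = Pi\<^sub>E I (\<lambda>l. \<tau> l ` A l)"
proof
  show "grid \<tau> ` Pi\<^sub>E I A \<subseteq> Pi\<^sub>E I (\<lambda>l. \<tau> l ` A l)" by (auto simp: grid_def)
  show "Pi\<^sub>E I (\<lambda>l. \<tau> l ` A l) \<subseteq> grid \<tau> ` Pi\<^sub>E I A"
  proof
    fix i assume i: "i \<in> Pi\<^sub>E I (\<lambda>l. \<tau> l ` A l)"
    then have "\<forall>l\<in>I. \<exists>s. s \<in> A l \<and> i l = \<tau> l s" by (auto simp: PiE_iff)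
    then obtain v where v: "\<And>l. l \<in> I \<Longrightarrow> v l \<in> A l \<and> i l = \<tau> l (v l)" by metis
    have "i = grid \<tau> (restrict v I)"
      using i v by (auto simp: grid_def PiE_iff extensional_def fun_eq_iff)
    moreover have "restrict v I \<in> Pi\<^sub>E I A" using v by auto
    ultimately show "i \<in> grid \<tau> ` Pi\<^sub>E I A" by blast
  qed
qed

lemma form_grid:
  assumes "\<And>l. l \<in> I \<Longrightarrow> inj_on (\<tau> l) (A l)"
    and "\<And>v. v \<in> Pi\<^sub>E I A \<Longrightarrow> b v = a (grid \<tau> v)"
    and "\<And>l s. l \<in> I \<Longrightarrow> s \<in> A l \<Longrightarrow> y l s = x l (\<tau> l s)"
  shows "form a (\<lambda>l. \<tau> l ` A l) x = form b A y"
proof -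
  have "form a (\<lambda>l. \<tau> l ` A l) x = (\<Sum>v\<in>Pi\<^sub>E I A. a (grid \<tau> v) * (\<Prod>l\<in>I. x l (grid \<tau> v l)))"
    unfolding form_def grid_image[symmetric] using inj_on_grid[OF assms(1)] by (simp add: sum.reindex)
  also have "\<dots> = form b A y"
    unfolding form_def
    by (intro sum.cong arg_cong2[where f = "(*)"] prod.cong) (use assms in \<open>auto simp: grid_apply PiE_iff\<close>)
  finally show ?thesis .
qed

lemma unit_test_grid:
  assumes "\<And>l. l \<in> I \<Longrightarrow> inj_on (\<tau> l) (A l)" "\<And>l. l \<in> I \<Longrightarrow> finite (A l)"
    and "\<And>l s. l \<in> I \<Longrightarrow> s \<in> A l \<Longrightarrow> y l s = x l (\<tau> l s)"
  shows "unit_test (\<lambda>l. \<tau> l ` A l) x \<longleftrightarrow> unit_test A y"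
  unfolding unit_test_def
proof (rule ball_cong[OF refl])
  fix l assume l: "l \<in> I"
  have "(\<Sum>s\<in>\<tau> l ` A l. norm (x l s) powr p l) = (\<Sum>s\<in>A l. norm (y l s) powr p l)"
    using assms l by (simp add: sum.reindex)
  then show "(finite (\<tau> l ` A l) \<and> (\<Sum>s\<in>\<tau> l ` A l. norm (x l s) powr p l) \<le> 1) \<longleftrightarrow>
      (finite (A l) \<and> (\<Sum>s\<in>A l. norm (y l s) powr p l) \<le> 1)"
    using assms(2)[OF l] by simp
qed

text \<open>An injective renumbering of unit vectors is an isometric embedding, and composing a form
  with isometries does not increase its norm.\<close>

lemma bd_subgrid:
  assumes a: "bd a C" and inj: "\<And>l. l \<in> I \<Longrightarrow> inj_on (\<tau> l) {..<n}"
  shows "bd (\<lambda>v. if v \<in> cube n then a (grid \<tau> v) else 0) C"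
  unfolding bd_def
proof (intro conjI allI impI)
  fix v assume "v \<notin> idx"
  then show "(if v \<in> cube n then a (grid \<tau> v) else 0) = 0" using cube_subset_idx by auto
next
  fix A x assume t: "unit_test A (x :: nat \<Rightarrow> nat \<Rightarrow> 'a)"
  let ?b = "\<lambda>v. if v \<in> cube n then a (grid \<tau> v) else 0"
  let ?B = "\<lambda>l. A l \<inter> {..<n}"
  have inj': "inj_on (\<tau> l) (?B l)" if "l \<in> I" for l
    using inj[OF that] by (rule inj_on_subset) auto
  define y where "y l t = x l (inv_into (?B l) (\<tau> l) t)" for l t
  have y: "x l s = y l (\<tau> l s)" if "l \<in> I" "s \<in> ?B l" for l s
    unfolding y_def using inj'[OF that(1)] that(2) by (simp only: inv_into_f_f)
  have "form ?b A x = form (\<lambda>v. a (grid \<tau> v)) ?B x"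
    by (rule form_Int) (use t in \<open>auto simp: unit_test_def cube_def PiE_iff\<close>)
  also have "\<dots> = form a (\<lambda>l. \<tau> l ` ?B l) y"
    by (rule form_grid[symmetric]) (use inj' y in auto)
  also have "norm \<dots> \<le> C"
  proof (rule form_le[OF a])
    have "unit_test ?B x" by (rule unit_test_mono[OF t]) auto
    then show "unit_test (\<lambda>l. \<tau> l ` ?B l) y"
      by (subst unit_test_grid[where y = x]) (use inj' y t in \<open>auto simp: unit_test_def\<close>)
  qed
  finally show "norm (form ?b A x) \<le> C" .
qed

text \<open>Transport in the opposite direction: \<open>w\<close> is composed with the coordinate
  projections onto the images of the embeddings, followed by the inverse renumberings.\<close>

lemma bd_spread:
  assumes w: "bd w C" and supp: "\<And>v. v \<notin> cube n \<Longrightarrow> w v = 0"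
    and inj: "\<And>l. l \<in> I \<Longrightarrow> inj_on (\<tau> l) {..<n}"
    and a: "\<And>v. v \<in> cube n \<Longrightarrow> a (grid \<tau> v) = w v" "\<And>i. i \<notin> grid \<tau> ` cube n \<Longrightarrow> a i = 0"
  shows "bd a C"
  unfolding bd_def
proof (intro conjI allI impI)
  fix i assume "i \<notin> idx"
  then have "i \<notin> grid \<tau> ` cube n" by auto
  then show "a i = 0" using a(2) by blast
next
  fix A x assume t: "unit_test A (x :: nat \<Rightarrow> nat \<Rightarrow> 'a)"
  let ?B = "\<lambda>l. {s. s < n \<and> \<tau> l s \<in> A l}"
  have inj': "inj_on (\<tau> l) (?B l)" if "l \<in> I" for l
    using inj[OF that] by (rule inj_on_subset) auto
  have AB: "A l \<inter> \<tau> l ` {..<n} = \<tau> l ` ?B l" for l by auto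
  have "form a A x = form a (\<lambda>l. A l \<inter> \<tau> l ` {..<n}) x"
  proof (rule form_Int)
    fix i assume "i \<in> Pi\<^sub>E I A"
    show "a i = (if \<forall>l\<in>I. i l \<in> \<tau> l ` {..<n} then a i else 0)"
    proof (cases "\<forall>l\<in>I. i l \<in> \<tau> l ` {..<n}")
      case False
      then have "i \<notin> grid \<tau> ` cube n" unfolding cube_def grid_image by auto
      then show ?thesis using a(2) by auto
    qed auto
  qed (use t in \<open>auto simp: unit_test_def\<close>)
  also have "\<dots> = form w ?B (\<lambda>l s. x l (\<tau> l s))"
    unfolding AB
  proof (rule form_grid)
    fix v assume "v \<in> Pi\<^sub>E I ?B"
    then have "v \<in> cube n" unfolding cube_def by (auto simp: PiE_iff)
    then show "w v = a (grid \<tau> v)" using a(1) by simp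
  qed (use inj' in auto)
  also have "norm \<dots> \<le> C"
  proof (rule form_le[OF w])
    have "unit_test (\<lambda>l. \<tau> l ` ?B l) x" by (rule unit_test_mono[OF t]) auto
    then show "unit_test ?B (\<lambda>l s. x l (\<tau> l s))"
      by (subst (asm) unit_test_grid) (use inj' in auto)
  qed
  finally show "norm (form a A x) \<le> C" .
qed

text \<open>\<open>prod_decode\<close> splits the natural numbers into infinitely many infinite
  classes, which serve as blocks of coordinates in every factor. Being infinite, each block has room
  for grids of any size.\<close>

definition blk :: "nat \<Rightarrow> nat" where
  "blk s = fst (prod_decode s)"

definition block_part :: "nat \<Rightarrow> ('k::{real_normed_field, euclidean_space}) arr \<Rightarrow> 'k arr" where
  "block_part b a = (\<lambda>i. if \<forall>l\<in>I. blk (i l) = b then a i else 0)"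

definition block_diag :: "nat set \<Rightarrow> ('k::{real_normed_field, euclidean_space}) arr \<Rightarrow> bool" where
  "block_diag M a \<longleftrightarrow> (\<forall>i. a i \<noteq> 0 \<longrightarrow> i \<in> idx \<and> (\<exists>b\<in>M. \<forall>l\<in>I. blk (i l) = b))"

lemma bd_block_part: "bd a C \<Longrightarrow> bd (block_part b a) C"
  using bd_restrict[of a C "\<lambda>_. {s. blk s = b}"] by (simp add: block_part_def)

text \<open>
  This is where \<open>\<Sum> 1 / p l \<ge> 1\<close> enters; it makes the norm of a block-diagonal form comparable to the
  largest norm of a block.
\<close>

lemma prod_powr_le_sum:
  assumes "\<And>l. l \<in> I \<Longrightarrow> 0 \<le> u l" "\<And>l. l \<in> I \<Longrightarrow> u l \<le> 1"
  shows "(\<Prod>l\<in>I. u l powr (1 / p l)) \<le> (\<Sum>l\<in>I. u l)"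
proof (cases "\<exists>l\<in>I. u l = 0")
  case True
  then have "(\<Prod>l\<in>I. u l powr (1 / p l)) = 0"
    using finite_I by (auto intro!: prod_zero)
  then show ?thesis using assms by (simp add: sum_nonneg)
next
  case False
  define m where "m = Max (u ` I)"
  have m: "u l \<le> m" if "l \<in> I" for l using that finite_I by (auto simp: m_def)
  have "m \<in> u ` I" unfolding m_def using finite_I I_nonempty by (intro Max_in) auto
  then obtain l0 where l0: "l0 \<in> I" "m = u l0" by auto
  then have m01: "0 < m" "m \<le> 1" using assms False by (auto simp: less_le)
  \<comment> \<open>With \<open>m\<close> the largest \<open>u l\<close>, the product is at most
    \<open>m\<close> to the power \<Sum> 1 / p l, hence at most \<open>m\<close>, because
    \<open>m\<close> is at most one and the exponent is at least one.\<close>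
  have "(\<Prod>l\<in>I. u l powr (1 / p l)) \<le> (\<Prod>l\<in>I. m powr (1 / p l))"
    using assms m p_pos by (intro prod_mono) (auto intro!: powr_mono2 simp: less_imp_le)
  also have "\<dots> = m powr (\<Sum>l\<in>I. 1 / p l)"
    using m01 finite_I by (simp add: powr_sum)
  also have "\<dots> \<le> m powr 1"
    using m01 sum_inverse_p by (intro powr_mono') auto
  also have "\<dots> \<le> (\<Sum>l\<in>I. u l)"
    using l0 m01 assms finite_I by (auto intro: member_le_sum)
  finally show ?thesis .
qed

text \<open>A block sees only the part of each \<open>x l\<close> that lies in it. Its value is
  bounded by the product of the norms of these parts, which \<open>prod_powr_le_sum\<close> turns
  into a sum over l of p-th powers; adding up over the blocks leaves at most 1 for each factor,
  whence the constant \<open>card I\<close>.\<close>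

lemma bd_block_diag:
  assumes diag: "block_diag UNIV a" and parts: "\<And>b. bd (block_part b a) C"
  shows "bd a (real (card I) * C)"
  unfolding bd_def
proof (intro conjI allI impI)
  fix i assume "i \<notin> idx"
  then show "a i = 0" using diag unfolding block_diag_def by blast
next
  fix A x assume t: "unit_test A (x :: nat \<Rightarrow> nat \<Rightarrow> 'a)"
  have fin: "finite (A l)" if "l \<in> I" for l using t that by (simp add: unit_test_def)
  have finP: "finite (Pi\<^sub>E I A)" using fin finite_I by (intro finite_PiE)
  define Bs where "Bs = (\<Union>l\<in>I. blk ` A l)"
  have finBs: "finite Bs" unfolding Bs_def using fin finite_I by auto
  have C0: "0 \<le> C" using V.bd_nonneg[OF parts] .
  define u where "u b l = (\<Sum>s\<in>A l \<inter> {s. blk s = b}. norm (x l s) powr p l)" for b l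
  have a_sum: "a i = (\<Sum>b\<in>Bs. block_part b a i)" if i: "i \<in> Pi\<^sub>E I A" for i
  proof (cases "a i = 0")
    case False
    then obtain b where b: "\<And>l. l \<in> I \<Longrightarrow> blk (i l) = b"
      using diag unfolding block_diag_def by blast
    obtain l0 where "l0 \<in> I" using I_nonempty by blast
    then have "b \<in> Bs" and "\<And>b'. (\<forall>l\<in>I. blk (i l) = b') \<longleftrightarrow> b' = b"
      unfolding Bs_def using i b by (auto simp: PiE_iff)
    then show ?thesis using finBs by (simp add: block_part_def)
  next
    case True
    then have "block_part b a i = 0" for b by (simp add: block_part_def)
    then show ?thesis using True by simp
  qed
  have "form a A x = (\<Sum>b\<in>Bs. form (block_part b a) A x)"
    unfolding form_def by (subst sum.swap) (auto simp: a_sum sum_distrib_right intro!: sum.cong)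
  also have "norm \<dots> \<le> (\<Sum>b\<in>Bs. C * (\<Sum>l\<in>I. u b l))"
  proof (rule sum_norm_le)
    fix b assume "b \<in> Bs"
    have "form (block_part b a) A x = form (block_part b a) (\<lambda>l. A l \<inter> {s. blk s = b}) x"
      by (rule form_Int) (use fin in \<open>auto simp: block_part_def\<close>)
    also have "norm \<dots> \<le> C * (\<Prod>l\<in>I. pnorm l (A l \<inter> {s. blk s = b}) (x l))"
      using parts fin by (intro form_le_pnorm) auto
    also have "\<dots> \<le> C * (\<Sum>l\<in>I. u b l)"
    proof (rule mult_left_mono[OF _ C0])
      have "u b l \<le> 1" if "l \<in> I" for l
      proof -
        have "u b l \<le> (\<Sum>s\<in>A l. norm (x l s) powr p l)"
          unfolding u_def using fin[OF that] by (intro sum_mono2) auto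
        then show ?thesis using t that unfolding unit_test_def by fastforce
      qed
      then show "(\<Prod>l\<in>I. pnorm l (A l \<inter> {s. blk s = b}) (x l)) \<le> (\<Sum>l\<in>I. u b l)"
        unfolding pnorm_def u_def[symmetric] by (intro prod_powr_le_sum) (auto simp: u_def sum_nonneg)
    qed
    finally show "norm (form (block_part b a) A x) \<le> C * (\<Sum>l\<in>I. u b l)" .
  qed
  also have "\<dots> = C * (\<Sum>l\<in>I. \<Sum>b\<in>Bs. u b l)"
    by (subst sum.swap) (simp add: sum_distrib_left)
  also have "\<dots> \<le> C * (\<Sum>l\<in>I. 1)"
  proof (intro mult_left_mono[OF _ C0] sum_mono)
    fix l assume l: "l \<in> I"
    have "(\<Sum>b\<in>Bs. u b l) = (\<Sum>s\<in>A l. norm (x l s) powr p l)"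
    proof -
      have "(\<Sum>b\<in>Bs. \<Sum>s | s \<in> A l \<and> blk s = b. norm (x l s) powr p l) = (\<Sum>s\<in>A l. norm (x l s) powr p l)"
        by (rule sum.group) (use fin[OF l] finBs l in \<open>auto simp: Bs_def\<close>)
      then show ?thesis unfolding u_def by (simp add: Int_def)
    qed
    then show "(\<Sum>b\<in>Bs. u b l) \<le> 1" using t l by (simp add: unit_test_def)
  qed
  finally show "norm (form a A x) \<le> real (card I) * C" by (simp add: mult.commute)
qed

text \<open>
  \<open>W\<close> is the \<open>\<ell>\<^sub>\<infinity>\<close>-sum of the spaces of forms on cubes, every cube size occurring infinitely often.
\<close>

definition bsize :: "nat \<Rightarrow> nat" where
  "bsize b = snd (prod_decode b)"

definition bdW :: "('k::{real_normed_field, euclidean_space}) blocks \<Rightarrow> real \<Rightarrow> bool" where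
  "bdW w C \<longleftrightarrow> (\<forall>b. bd (\<lambda>i. w (b, i)) C) \<and> (\<forall>b i. i \<notin> cube (bsize b) \<longrightarrow> w (b, i) = 0)"

lemma bsize_le: "bsize b \<le> b"
  using le_prod_encode_2[of "snd (prod_decode b)" "fst (prod_decode b)"] by (simp add: bsize_def)

lemma bdW_block: "bdW w C \<Longrightarrow> bd (\<lambda>i. w (b, i)) C"
  by (simp add: bdW_def)

lemma bdW_support: "bdW w C \<Longrightarrow> i \<notin> cube (bsize b) \<Longrightarrow> w (b, i) = 0"
  by (simp add: bdW_def)

lemma closed_function_norm_bdW:
  "closed_function_norm (bdW :: ('k::{real_normed_field, euclidean_space}) blocks \<Rightarrow> real \<Rightarrow> bool)"
proof
  fix u v :: "'k blocks" and C D :: real and c :: 'k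
    and f :: "nat \<Rightarrow> 'k blocks" and g :: "'k blocks"
  show "bdW (u + v) (C + D)" if "bdW u C" "bdW v D"
    unfolding bdW_def
  proof (intro conjI allI impI)
    fix b
    have "bd ((\<lambda>i. u (b, i)) + (\<lambda>i. v (b, i))) (C + D)"
      using that by (intro V.bd_add bdW_block)
    then show "bd (\<lambda>i. (u + v) (b, i)) (C + D)" by (simp add: plus_fun_def)
  qed (use that in \<open>simp add: bdW_def\<close>)
  show "bdW (sc c u) (norm c * C)" if "bdW u C"
    unfolding bdW_def
  proof (intro conjI allI impI)
    fix b
    have "bd (sc c (\<lambda>i. u (b, i))) (norm c * C)"
      using that by (intro V.bd_sc bdW_block)
    then show "bd (\<lambda>i. sc c u (b, i)) (norm c * C)" by (simp add: sc_def)
  qed (use that in \<open>simp add: bdW_def\<close>)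
  show "norm (u x) \<le> C" if "bdW u C" for x
    using V.bd_entry[OF bdW_block[OF that, of "fst x"], of "snd x"] by simp
  show "bdW (0 :: 'k blocks) 0"
    using V.bd_zero by (simp add: bdW_def zero_fun_def)
  show "bdW u D" if "bdW u C" "C \<le> D"
    using that V.bd_mono unfolding bdW_def by blast
  show "bdW g C" if f: "\<And>n. bdW (f n) C" and g: "\<And>x. (\<lambda>n. f n x) \<longlonglongrightarrow> g x"
    unfolding bdW_def
  proof (intro conjI allI impI)
    fix b
    show "bd (\<lambda>i. g (b, i)) C"
      by (rule V.bd_lim[where f = "\<lambda>n i. f n (b, i)"]) (use bdW_block[OF f] g in auto)
  next
    fix b i assume "i \<notin> cube (bsize b)"
    then have "(\<lambda>n. f n (b, i)) = (\<lambda>_. 0)" using bdW_support[OF f] by blast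
    then show "g (b, i) = 0" using g[of "(b, i)"] LIMSEQ_unique tendsto_const by metis
  qed
qed

sublocale W: closed_function_norm bdW
  by (rule closed_function_norm_bdW)

text \<open>A block number is a pair of a copy number and a size. The new index is absorbed by the
  copy number alone, so that block sizes, and with them the bounds, are unchanged.\<close>

lemma W_reindex:
  obtains f :: "nat \<times> nat \<times> (nat \<Rightarrow> nat) \<Rightarrow> nat \<times> (nat \<Rightarrow> nat)" where "bij f"
    and "\<And>w :: ('k::{real_normed_field, euclidean_space}) blocks. \<And>C. bdW w C \<longleftrightarrow> (\<forall>n. bdW (\<lambda>x. w (f (n, x))) C)"
proof -
  define h where "h n b = prod_encode (prod_encode (n, fst (prod_decode b)), snd (prod_decode b))" for n b
  define f where "f = (\<lambda>(n, b, i :: nat \<Rightarrow> nat). (h n b, i))"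
  have h: "\<exists>n b'. b = h n b'" for b
    by (intro exI[of _ "fst (prod_decode (fst (prod_decode b)))"]
        exI[of _ "prod_encode (snd (prod_decode (fst (prod_decode b))), snd (prod_decode b))"])
      (simp add: h_def)
  have inj: "h n b = h m b' \<longleftrightarrow> n = m \<and> b = b'" for n m b b'
    unfolding h_def by (auto simp: prod_eq_iff intro: prod_decode_eq[THEN iffD1])
  have bij: "bij f"
    unfolding bij_def inj_def surj_def f_def using inj h by fastforce
  have sz: "bsize (h n b) = bsize b" for n b by (simp add: h_def bsize_def)
  have "bdW w C \<longleftrightarrow> (\<forall>n. bdW (\<lambda>x. w (f (n, x))) C)" for w :: "'k blocks" and C
    unfolding bdW_def f_def prod.case using h sz by metis
  then show ?thesis using that[OF bij] by blast
qed

lemma eventually_in_cube: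
  assumes "i \<in> idx"
  shows "eventually (\<lambda>n. i \<in> cube n) sequentially"
proof -
  have "i \<in> cube n" if "n \<ge> Suc (Max (i ` I))" for n
    unfolding cube_def
  proof (rule PiE_I)
    fix l assume "l \<in> I"
    then have "i l \<le> Max (i ` I)" using finite_I by simp
    then show "i l \<in> {..<n}" using that by simp
  qed (use assms in \<open>auto simp: idx_def PiE_iff extensional_def\<close>)
  then show ?thesis unfolding eventually_sequentially by blast
qed

text \<open>A form is recovered from its restrictions to the cubes by an ultralimit.\<close>

lemma V_retract_W:
  "norm_retract (bd :: ('k::{real_normed_field, euclidean_space}) arr \<Rightarrow> real \<Rightarrow> bool) bdW"
proof -
  define j where "j a = (\<lambda>(b, i). if i \<in> cube (bsize b) then a i else 0)" for a :: "'k arr"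
  \<comment> \<open>The blocks \<open>prod_encode (0, s)\<close> supply one cube of every side
    s.\<close>
  define q where "q w = (\<lambda>i. ulim (\<lambda>s. w (prod_encode (0, s), i)))" for w :: "'k blocks"
  have j: "blin bd bdW j"
  proof (rule blinI[where K = 1])
    fix a :: "'k arr" and C assume a: "bd a C"
    have "bd (\<lambda>i. j a (b, i)) C" for b
    proof -
      have "(\<lambda>i. j a (b, i)) = (\<lambda>i. if \<forall>l\<in>I. i l \<in> {..<bsize b} then a i else 0)"
        using bd_support[OF a] by (auto simp: j_def cube_def idx_def fun_eq_iff PiE_iff)
      then show ?thesis using bd_restrict[OF a, of "\<lambda>_. {..<bsize b}"] by (simp only:)
    qed
    then show "bdW (j a) (1 * C)" by (simp add: bdW_def) (simp add: j_def)
  qed (auto simp: j_def fun_eq_iff)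
  have lim: "((\<lambda>s. w (prod_encode (0, s), i)) \<longlongrightarrow> q w i) free_ultra" if "car bdW w"
    for w :: "'k blocks" and i
    using that W.bd_entry unfolding car_def q_def by (metis tendsto_ulim)
  have q: "blin bdW bd q"
  proof (rule blinI[where K = 1])
    fix w w' :: "'k blocks" assume "car bdW w" "car bdW w'"
    then show "q (w + w') = q w + q w'"
      by (intro ext) (simp add: q_def[of "w + w'"] ulim_eqI tendsto_add lim)
  next
    fix c and w :: "'k blocks" assume "car bdW w"
    then show "q (sc c w) = sc c (q w)"
      by (intro ext) (simp add: q_def[of "sc c w"] ulim_eqI tendsto_mult lim)
  next
    fix w :: "'k blocks" and C assume w: "bdW w C"
    show "bd (q w) (1 * C)"
      unfolding bd_def
    proof (intro conjI allI impI)
      fix i assume "i \<notin> idx"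
      then have "(\<lambda>s. w (prod_encode (0, s), i)) = (\<lambda>_. 0)"
        using bdW_support[OF w] cube_subset_idx by (metis subsetD)
      then show "q w i = 0" unfolding q_def by (simp add: ulim_LIMSEQ)
    next
      fix A x assume t: "unit_test A (x :: nat \<Rightarrow> nat \<Rightarrow> 'k)"
      have "((\<lambda>s. form (\<lambda>i. w (prod_encode (0, s), i)) A x) \<longlongrightarrow> form (q w) A x) free_ultra"
        unfolding form_def by (intro tendsto_intros lim W.carI[OF w])
      then have "((\<lambda>s. norm (form (\<lambda>i. w (prod_encode (0, s), i)) A x)) \<longlongrightarrow> norm (form (q w) A x)) free_ultra"
        by (rule tendsto_norm)
      then show "norm (form (q w) A x) \<le> 1 * C"
        by (rule tendsto_upperbound) (use form_le[OF bdW_block[OF w] t] free_ultra_neq_bot in auto)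
    qed
  qed auto
  have "q (j a) = a" if a: "car bd a" for a
  proof
    fix i
    show "q (j a) i = a i"
    proof (cases "i \<in> idx")
      case True
      have "eventually (\<lambda>s. j a (prod_encode (0, s), i) = a i) sequentially"
        using eventually_in_cube[OF True] by eventually_elim (simp add: j_def bsize_def)
      then show ?thesis unfolding q_def by (intro ulim_LIMSEQ tendsto_eventually)
    next
      case False
      then have "j a (b, i) = 0" "a i = 0" for b
        using cube_subset_idx a bd_support by (auto simp: j_def car_def)
      then show ?thesis unfolding q_def by (simp add: ulim_LIMSEQ)
    qed
  qed
  then show ?thesis unfolding norm_retract_def using j q by blast
qed

text \<open>The cube of block \<open>b\<close> is embedded by \<open>\<tau> b\<close> into the
  coordinates of block \<open>m b\<close>. As \<open>m\<close> is injective, different cubes occupy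
  different diagonal blocks, so \<open>bd_block_diag\<close> bounds \<open>scatter\<close>. Each
  placement thus yields a complemented copy of \<open>W\<close> in \<open>V\<close>, with
  \<open>gather\<close> as left inverse of the embedding.\<close>

definition placement :: "(nat \<Rightarrow> nat) \<Rightarrow> (nat \<Rightarrow> nat \<Rightarrow> nat \<Rightarrow> nat) \<Rightarrow> bool" where
  "placement m \<tau> \<longleftrightarrow> inj m \<and> (\<forall>b. \<forall>l\<in>I. inj_on (\<tau> b l) {..<bsize b} \<and> (\<forall>s<bsize b. blk (\<tau> b l s) = m b))"

definition gather :: "(nat \<Rightarrow> nat \<Rightarrow> nat \<Rightarrow> nat) \<Rightarrow> 'k arr \<Rightarrow>
    ('k::{real_normed_field, euclidean_space}) blocks" where
  "gather \<tau> a = (\<lambda>(b, v). if v \<in> cube (bsize b) then a (grid (\<tau> b) v) else 0)"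

text \<open>For a placement nothing depends on the choice: by \<open>placement_inj\<close> an index
  comes from at most one pair.\<close>

definition scatter :: "(nat \<Rightarrow> nat \<Rightarrow> nat \<Rightarrow> nat) \<Rightarrow> 'k blocks \<Rightarrow>
    ('k::{real_normed_field, euclidean_space}) arr" where
  "scatter \<tau> w = (\<lambda>i. if \<exists>b v. v \<in> cube (bsize b) \<and> i = grid (\<tau> b) v
     then w (SOME (b, v). v \<in> cube (bsize b) \<and> i = grid (\<tau> b) v) else 0)"

lemma cube_nth: "v \<in> cube n \<Longrightarrow> l \<in> I \<Longrightarrow> v l < n"
  by (auto simp: cube_def)

lemma placement_blk:
  assumes "placement m \<tau>" "v \<in> cube (bsize b)" "l \<in> I"
  shows "blk (grid (\<tau> b) v l) = m b"
  using assms cube_nth[OF assms(2,3)] by (simp add: placement_def grid_apply)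

lemma placement_inj:
  assumes pl: "placement m \<tau>" and v: "v \<in> cube (bsize b)" "v' \<in> cube (bsize b')"
    and eq: "grid (\<tau> b) v = grid (\<tau> b') v'"
  shows "b = b' \<and> v = v'"
proof -
  obtain l where l: "l \<in> I" using I_nonempty by blast
  have "m b = m b'" using placement_blk[OF pl v(1) l] placement_blk[OF pl v(2) l] eq by simp
  then have b: "b = b'" using pl by (auto simp: placement_def inj_eq)
  have "inj_on (grid (\<tau> b)) (cube (bsize b))"
    unfolding cube_def using pl by (intro inj_on_grid) (auto simp: placement_def)
  then show ?thesis using b v eq by (auto dest: inj_onD)
qed

lemma scatter_grid:
  assumes pl: "placement m \<tau>" and v: "v \<in> cube (bsize b)"
  shows "scatter \<tau> w (grid (\<tau> b) v) = w (b, v)"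
proof -
  let ?P = "\<lambda>(b', v'). v' \<in> cube (bsize b') \<and> grid (\<tau> b) v = grid (\<tau> b') v'"
  have "(SOME x. ?P x) = (b, v)"
  proof (rule some_equality)
    show "?P (b, v)" using v by simp
    show "x = (b, v)" if "?P x" for x
      using that placement_inj[OF pl v] by (cases x) auto
  qed
  then show ?thesis unfolding scatter_def using v by auto
qed

lemma scatter_eq_0: "(\<And>b v. v \<in> cube (bsize b) \<Longrightarrow> i \<noteq> grid (\<tau> b) v) \<Longrightarrow> scatter \<tau> w i = 0"
  unfolding scatter_def by (metis (mono_tags, lifting))

lemma gather_scatter:
  assumes "placement m \<tau>" "car bdW w"
  shows "gather \<tau> (scatter \<tau> w) = w"
proof
  fix x show "gather \<tau> (scatter \<tau> w) x = w x"
    using scatter_grid[OF assms(1)] bdW_support assms(2)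
    by (cases x) (auto simp: gather_def car_def)
qed

lemma block_diag_scatter:
  assumes pl: "placement m \<tau>"
  shows "block_diag (range m) (scatter \<tau> w)"
  unfolding block_diag_def
proof (intro allI impI)
  fix i assume "scatter \<tau> w i \<noteq> 0"
  then obtain b v where "v \<in> cube (bsize b)" "i = grid (\<tau> b) v" using scatter_eq_0 by blast
  then show "i \<in> idx \<and> (\<exists>b\<in>range m. \<forall>l\<in>I. blk (i l) = b)"
    using placement_blk[OF pl] by auto
qed

lemma block_part_scatter_eq_0:
  assumes pl: "placement m \<tau>" and "b \<notin> range m"
  shows "block_part b (scatter \<tau> w) = 0"
proof
  fix i
  obtain l where l: "l \<in> I" using I_nonempty by blast
  have "scatter \<tau> w i = 0" if "\<forall>l\<in>I. blk (i l) = b"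
    by (rule scatter_eq_0) (use that placement_blk[OF pl _ l] l assms(2) in auto)
  then show "block_part b (scatter \<tau> w) i = 0 i" by (simp add: block_part_def)
qed

lemma bd_block_part_scatter:
  assumes pl: "placement m \<tau>" and w: "bdW w C"
  shows "bd (block_part (m b) (scatter \<tau> w)) C"
proof (rule bd_spread[where w = "\<lambda>i. w (b, i)" and \<tau> = "\<tau> b" and n = "bsize b"])
  fix v assume v: "v \<in> cube (bsize b)"
  then show "block_part (m b) (scatter \<tau> w) (grid (\<tau> b) v) = w (b, v)"
    using placement_blk[OF pl v] scatter_grid[OF pl v] by (simp add: block_part_def)
next
  fix i assume i: "i \<notin> grid (\<tau> b) ` cube (bsize b)"
  obtain l where l: "l \<in> I" using I_nonempty by blast
  have "scatter \<tau> w i = 0" if "\<forall>l\<in>I. blk (i l) = m b"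
  proof (rule scatter_eq_0)
    fix b' v assume v: "v \<in> cube (bsize b')"
    show "i \<noteq> grid (\<tau> b') v"
    proof
      assume eq: "i = grid (\<tau> b') v"
      then have "m b' = m b" using that l placement_blk[OF pl v l] by simp
      then have "b' = b" using pl by (auto simp: placement_def inj_eq)
      then show False using eq v i by blast
    qed
  qed
  then show "block_part (m b) (scatter \<tau> w) i = 0" by (simp add: block_part_def)
qed (use pl w in \<open>auto simp: placement_def bdW_def\<close>)

lemma bd_scatter:
  assumes pl: "placement m \<tau>" and w: "bdW w C"
  shows "bd (scatter \<tau> w) (real (card I) * C)"
proof (rule bd_block_diag)
  show "block_diag UNIV (scatter \<tau> w)"
    using block_diag_scatter[OF pl, of w] unfolding block_diag_def by blast
  show "bd (block_part b (scatter \<tau> w)) C" for b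
  proof (cases "b \<in> range m")
    case True
    then show ?thesis using bd_block_part_scatter[OF pl w] by blast
  next
    case False
    then show ?thesis
      using V.bd_zero'[OF W.bd_nonneg[OF w]] block_part_scatter_eq_0[OF pl False, of w] by (simp only:)
  qed
qed

lemma blin_scatter: "placement m \<tau> \<Longrightarrow> blin bdW bd (scatter \<tau>)"
  by (rule blinI[where K = "real (card I)"])
    (auto simp: bd_scatter, auto simp: scatter_def fun_eq_iff)

lemma blin_gather:
  assumes "placement m \<tau>"
  shows "blin bd bdW (gather \<tau>)"
proof (rule blinI[where K = 1])
  fix a :: "('k::{real_normed_field, euclidean_space}) arr" and C assume a: "bd a C"
  have "bd (\<lambda>v. if v \<in> cube (bsize b) then a (grid (\<tau> b) v) else 0) C" for b
    using assms by (intro bd_subgrid[OF a]) (auto simp: placement_def)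
  then show "bdW (gather \<tau> a) (1 * C)"
    by (simp add: bdW_def gather_def)
qed (auto simp: gather_def fun_eq_iff)

end

section \<open>Large grids with small off-diagonal entries\<close>

text \<open>The union bound in the form of a count. Let \<open>\<omega>\<close> be uniform with
  values in \<open>{..<H}\<close> at the places in \<open>L\<close>. With all other values fixed, at
  most \<open>c\<close> of the \<open>H\<close> values at \<open>slot q\<close> make
  \<open>q\<close> bad, so \<open>q\<close> is bad with probability at most c / H, and
  \<open>card Q * c < H\<close>.\<close>

lemma avoid_bad_events:
  fixes B :: "'q \<Rightarrow> ('s \<Rightarrow> nat) \<Rightarrow> bool"
  assumes L: "finite L" and Q: "finite Q" and slot: "\<And>q. q \<in> Q \<Longrightarrow> slot q \<in> L"
    and few: "\<And>q \<omega>. q \<in> Q \<Longrightarrow> card {s. s < H \<and> B q (fun_upd \<omega> (slot q) s)} \<le> c"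
    and H: "card Q * c < H"
  obtains \<omega> where "\<And>q. q \<in> Q \<Longrightarrow> \<not> B q \<omega>"
proof -
  let ?\<Omega> = "\<Pi>\<^sub>E l\<in>L. {..<H}"
  have fin\<Omega>: "finite ?\<Omega>" using L by (intro finite_PiE) auto
  have card\<Omega>: "0 < card ?\<Omega>" using L H by (simp add: card_PiE)
  have bound: "H * card {\<omega> \<in> ?\<Omega>. B q \<omega>} \<le> c * card ?\<Omega>" if q: "q \<in> Q" for q
  proof -
    \<comment> \<open>Double counting by swapping the value at \<open>slot q\<close> with
      \<open>s\<close>. The swap is its own inverse and matches the pairs counted in
      \<open>few\<close> with the pairs of a bad \<open>\<omega>\<close> and an arbitrary
      value.\<close>
    let ?f = "\<lambda>(\<omega>, s). (fun_upd \<omega> (slot q) s, \<omega> (slot q))"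
    let ?S = "SIGMA \<omega>:?\<Omega>. {s. s < H \<and> B q (fun_upd \<omega> (slot q) s)}"
    have upd: "fun_upd \<omega> (slot q) s \<in> ?\<Omega>" if "\<omega> \<in> ?\<Omega>" "s < H" for \<omega> s
      using that slot[OF q] by (auto simp: PiE_iff extensional_def)
    have mem: "\<omega> (slot q) < H" if "\<omega> \<in> ?\<Omega>" for \<omega>
      using that slot[OF q] by auto
    have "bij_betw ?f ?S ({\<omega> \<in> ?\<Omega>. B q \<omega>} \<times> {..<H})"
    proof (rule bij_betw_byWitness[where f' = ?f])
      show "?f ` ?S \<subseteq> {\<omega> \<in> ?\<Omega>. B q \<omega>} \<times> {..<H}"
      proof
        fix z assume "z \<in> ?f ` ?S"
        then obtain \<omega> s where "z = ?f (\<omega>, s)" "\<omega> \<in> ?\<Omega>" "s < H" "B q (fun_upd \<omega> (slot q) s)"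
          by blast
        then show "z \<in> {\<omega> \<in> ?\<Omega>. B q \<omega>} \<times> {..<H}" using upd mem by simp
      qed
      show "?f ` ({\<omega> \<in> ?\<Omega>. B q \<omega>} \<times> {..<H}) \<subseteq> ?S"
      proof
        fix z assume "z \<in> ?f ` ({\<omega> \<in> ?\<Omega>. B q \<omega>} \<times> {..<H})"
        then obtain \<omega> s where "z = ?f (\<omega>, s)" "\<omega> \<in> ?\<Omega>" "s < H" "B q \<omega>"
          by blast
        then show "z \<in> ?S" using upd mem by simp
      qed
    qed auto
    then have "card ({\<omega> \<in> ?\<Omega>. B q \<omega>} \<times> {..<H}) = card ?S"
      by (simp add: bij_betw_same_card)
    also have "\<dots> = (\<Sum>\<omega>\<in>?\<Omega>. card {s. s < H \<and> B q (fun_upd \<omega> (slot q) s)})"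
      using fin\<Omega> by (simp add: card_SigmaI)
    also have "\<dots> \<le> (\<Sum>\<omega>\<in>?\<Omega>. c)"
      using few[OF q] by (intro sum_mono)
    finally show ?thesis by (simp add: card_cartesian_product mult.commute)
  qed
  have "\<exists>\<omega>\<in>?\<Omega>. \<forall>q\<in>Q. \<not> B q \<omega>"
  proof (rule ccontr)
    assume "\<not> ?thesis"
    then have "?\<Omega> = (\<Union>q\<in>Q. {\<omega> \<in> ?\<Omega>. B q \<omega>})" by blast
    then have "card ?\<Omega> \<le> (\<Sum>q\<in>Q. card {\<omega> \<in> ?\<Omega>. B q \<omega>})"
      using card_UN_le[OF Q] by metis
    then have "H * card ?\<Omega> \<le> (\<Sum>q\<in>Q. H * card {\<omega> \<in> ?\<Omega>. B q \<omega>})"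
      by (simp flip: sum_distrib_left)
    also have "\<dots> \<le> (\<Sum>q\<in>Q. c * card ?\<Omega>)"
      using bound by (intro sum_mono)
    also have "\<dots> < H * card ?\<Omega>"
      using H card\<Omega> by (simp flip: mult.assoc)
    finally show False by simp
  qed
  then show ?thesis using that by blast
qed

text \<open>Induction on the number of factors: each value of the new coordinate induces a colouring
  of the remaining grid, and since there are only finitely many of these, many values induce the
  same one.\<close>

lemma monochromatic_grid:
  assumes "finite I"
  shows "\<exists>M. \<forall>f :: (nat \<Rightarrow> nat) \<Rightarrow> nat. (\<forall>v\<in>(\<Pi>\<^sub>E l\<in>I. {..<M}). f v < c) \<longrightarrow>
    (\<exists>S col. (\<forall>l\<in>I. S l \<subseteq> {..<M} \<and> card (S l) = n) \<and> (\<forall>v\<in>Pi\<^sub>E I S. f v = col))"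
  using assms
proof (induction I rule: finite_induct)
  case empty
  then show ?case by auto
next
  case (insert l I)
  then obtain M0 where M0: "\<And>f :: (nat \<Rightarrow> nat) \<Rightarrow> nat. (\<forall>v\<in>(\<Pi>\<^sub>E l\<in>I. {..<M0}). f v < c) \<Longrightarrow>
    \<exists>S col. (\<forall>l\<in>I. S l \<subseteq> {..<M0} \<and> card (S l) = n) \<and> (\<forall>v\<in>Pi\<^sub>E I S. f v = col)"
    by metis
  let ?G = "\<Pi>\<^sub>E l\<in>I. {..<M0}"
  define \<K> where "\<K> = (?G \<rightarrow>\<^sub>E {..<c})"
  have fin: "finite \<K>" unfolding \<K>_def using insert(1) by (intro finite_PiE) auto
  \<comment> \<open>Pigeonhole: with this many values of the new coordinate, some colouring in
    \<open>\<K>\<close> is induced by at least \<open>n\<close> of them.\<close>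
  define L where "L = card \<K> * n + 1"
  define M where "M = max M0 L"
  show ?case
  proof (intro exI[of _ M] allI impI)
    fix f :: "(nat \<Rightarrow> nat) \<Rightarrow> nat"
    assume f: "\<forall>v\<in>(\<Pi>\<^sub>E l\<in>insert l I. {..<M}). f v < c"
    define h where "h s = restrict (\<lambda>w. f (w(l := s))) ?G" for s
    have ext: "w(l := s) \<in> (\<Pi>\<^sub>E l\<in>insert l I. {..<M})" if "w \<in> ?G" "s < L" for w s
      using that unfolding M_def by (auto simp: PiE_iff extensional_def)
    have h\<K>: "h s \<in> \<K>" if "s < L" for s
      unfolding h_def \<K>_def using f ext that by auto
    have "\<exists>\<phi>\<in>\<K>. n \<le> card {s. s < L \<and> h s = \<phi>}"
    proof (rule ccontr)
      assume "\<not> ?thesis"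
      then have *: "card {s. s < L \<and> h s = \<phi>} \<le> n" if "\<phi> \<in> \<K>" for \<phi> using that by fastforce
      have "{..<L} = (\<Union>\<phi>\<in>\<K>. {s. s < L \<and> h s = \<phi>})" using h\<K> by auto
      then have "L \<le> (\<Sum>\<phi>\<in>\<K>. card {s. s < L \<and> h s = \<phi>})"
        using card_UN_le[OF fin] by (metis card_lessThan)
      also have "\<dots> \<le> (\<Sum>\<phi>\<in>\<K>. n)" using * by (intro sum_mono)
      finally show False by (simp add: L_def)
    qed
    then obtain \<phi> where \<phi>: "\<phi> \<in> \<K>" "n \<le> card {s. s < L \<and> h s = \<phi>}" by blast
    obtain R where R: "R \<subseteq> {s. s < L \<and> h s = \<phi>}" "card R = n"
      using obtain_subset_with_card_n[OF \<phi>(2)] by blast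
    obtain S col where S: "\<And>l. l \<in> I \<Longrightarrow> S l \<subseteq> {..<M0} \<and> card (S l) = n" "\<And>v. v \<in> Pi\<^sub>E I S \<Longrightarrow> \<phi> v = col"
      using M0[of \<phi>] \<phi>(1) unfolding \<K>_def by (metis PiE_mem lessThan_iff)
    have "f v = col" if v: "v \<in> Pi\<^sub>E (insert l I) (S(l := R))" for v
    proof -
      define w where "w = v(l := undefined)"
      have w: "w \<in> Pi\<^sub>E I S"
        unfolding w_def using v insert(2) by (auto simp: PiE_iff extensional_def)
      have "w \<in> ?G" using w S(1) PiE_mono[of I S "\<lambda>_. {..<M0}"] by blast
      moreover have "v l \<in> R" using PiE_mem[OF v, of l] by simp
      ultimately have "f (w(l := v l)) = \<phi> w" using R(1) unfolding h_def by auto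
      then show ?thesis using S(2)[OF w] by (simp add: w_def)
    qed
    moreover have "\<forall>k\<in>insert l I. (S(l := R)) k \<subseteq> {..<M} \<and> card ((S(l := R)) k) = n"
    proof
      fix k assume "k \<in> insert l I"
      moreover have "R \<subseteq> {..<M}" using R(1) unfolding M_def by auto
      moreover have "S k \<subseteq> {..<M}" if "k \<in> I" using S(1)[OF that] unfolding M_def by auto
      ultimately show "(S(l := R)) k \<subseteq> {..<M} \<and> card ((S(l := R)) k) = n"
        using S(1) R(2) by (cases "k = l") auto
    qed
    ultimately show "\<exists>S col. (\<forall>l\<in>insert l I. S l \<subseteq> {..<M} \<and> card (S l) = n) \<and> (\<forall>v\<in>Pi\<^sub>E (insert l I) S. f v = col)"
      by (intro exI[of _ "S(l := R)"] exI[of _ col]) simp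
  qed
qed

text \<open>Division by \<open>m powr \<theta>\<close> leaves a positive power of \<open>m\<close>
  on the left.\<close>

lemma sublinear_bound:
  fixes m :: real
  assumes "0 \<le> m" "0 < \<epsilon>" "\<theta> < 1" "m * \<epsilon> \<le> D * m powr \<theta>"
  shows "m \<le> (D / \<epsilon>) powr (1 / (1 - \<theta>))"
proof (cases "m = 0")
  case False
  then have m: "0 < m" using assms by auto
  have "m powr (1 - \<theta>) * (m powr \<theta> * \<epsilon>) = m * \<epsilon>"
    using m by (simp add: powr_diff)
  also have "\<dots> \<le> D * m powr \<theta>" by fact
  finally have "m powr (1 - \<theta>) \<le> D / \<epsilon>"
    using m assms by (simp add: field_simps)
  then have "(m powr (1 - \<theta>)) powr (1 / (1 - \<theta>)) \<le> (D / \<epsilon>) powr (1 / (1 - \<theta>))"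
    using assms by (intro powr_mono2) auto
  then show ?thesis using assms m by (simp add: powr_powr)
qed simp

section \<open>Large matrix entries along a line\<close>

context exponents
begin

definition unit :: "(nat \<Rightarrow> nat) \<Rightarrow> ('k::{real_normed_field, euclidean_space}) arr" where
  "unit i = (\<lambda>k. if k = i then 1 else 0)"

lemma bd_unit: "i \<in> idx \<Longrightarrow> bd (unit i) 1"
proof -
  assume "i \<in> idx"
  then have "bd (unit i) (real (card {i}) * 1)" by (intro bd_finite_support) (auto simp: unit_def)
  then show ?thesis by simp
qed

lemma car_unit [simp]: "i \<in> idx \<Longrightarrow> car bd (unit i)"
  using bd_unit by (auto simp: car_def)

lemma idx_upd [simp]: "i \<in> idx \<Longrightarrow> l \<in> I \<Longrightarrow> i(l := s) \<in> idx"
  by (auto simp: idx_def PiE_iff extensional_def)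

lemma form_sum: "finite S \<Longrightarrow> form (\<Sum>s\<in>S. f s) A x = (\<Sum>s\<in>S. form (f s) A x)"
proof (induction S rule: finite_induct)
  case (insert s S)
  show ?case by (simp only: sum.insert[OF insert(1,2)] form_add insert(3))
qed (simp add: form_def)

lemma form_unit:
  assumes "\<And>l. l \<in> I \<Longrightarrow> finite (A l)"
  shows "form (unit i) A x = (if i \<in> Pi\<^sub>E I A then \<Prod>l\<in>I. x l (i l) else 0)"
proof -
  have "finite (Pi\<^sub>E I A)" using assms finite_I by (intro finite_PiE)
  then show ?thesis unfolding form_def unit_def by (simp add: if_distrib[of "\<lambda>t. t * _"] cong: if_cong)
qed

text \<open>The test uses unimodular coefficients on \<open>S\<close> in factor l, chosen so that
  all terms become nonnegative, and a single unit vector in every other factor. The vector in factor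
  l has norm \<open>card S\<close> to the power 1 / p l.\<close>

lemma row_line_sum:
  assumes a: "bd a C" and i: "i \<in> idx" and l: "l \<in> I" and S: "finite S"
    and big: "\<And>s. s \<in> S \<Longrightarrow> \<epsilon> \<le> norm (a (i(l := s)))"
  shows "real (card S) * \<epsilon> \<le> C * real (card S) powr (1 / p l)"
proof -
  have "\<exists>c. norm c = 1 \<and> c * a (i(l := s)) = of_real (norm (a (i(l := s))))" for s
    using unimodular_factor by metis
  then obtain c where c: "\<And>s. norm (c s) = 1" "\<And>s. c s * a (i(l := s)) = of_real (norm (a (i(l := s))))"
    by metis
  define A where "A k = (if k = l then S else {i k})" for k
  define x where "x k s = (if k = l then c s else 1)" for k s
  have P: "Pi\<^sub>E I A = (\<lambda>s. i(l := s)) ` S"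
  proof
    show "Pi\<^sub>E I A \<subseteq> (\<lambda>s. i(l := s)) ` S"
    proof
      fix k assume k: "k \<in> Pi\<^sub>E I A"
      have "k = i(l := k l)"
      proof
        fix t show "k t = (i(l := k l)) t"
          using k i unfolding A_def idx_def by (cases "t \<in> I") (auto simp: PiE_iff extensional_def split: if_splits)
      qed
      moreover have "k l \<in> S" using k l by (auto simp: A_def PiE_iff)
      ultimately show "k \<in> (\<lambda>s. i(l := s)) ` S" by blast
    qed
    show "(\<lambda>s. i(l := s)) ` S \<subseteq> Pi\<^sub>E I A"
      using i l by (auto simp: A_def idx_def PiE_iff extensional_def)
  qed
  have inj: "inj_on (\<lambda>s. i(l := s)) S" by (metis (mono_tags, lifting) fun_upd_same inj_onI)
  have "form a A x = (\<Sum>s\<in>S. a (i(l := s)) * (\<Prod>k\<in>I. x k ((i(l := s)) k)))"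
    unfolding form_def P using inj by (simp add: sum.reindex)
  also have "\<dots> = (\<Sum>s\<in>S. of_real (norm (a (i(l := s)))))"
  proof (rule sum.cong[OF refl])
    fix s
    have "(\<Prod>k\<in>I. x k ((i(l := s)) k)) = (\<Prod>k\<in>I. if k = l then c s else 1)"
      by (rule prod.cong) (auto simp: x_def)
    then show "a (i(l := s)) * (\<Prod>k\<in>I. x k ((i(l := s)) k)) = of_real (norm (a (i(l := s))))"
      using c(2)[of s] l finite_I by (simp add: mult.commute)
  qed
  also have "norm \<dots> = (\<Sum>s\<in>S. norm (a (i(l := s))))"
    by (simp add: sum_nonneg flip: of_real_sum)
  finally have "(\<Sum>s\<in>S. norm (a (i(l := s)))) = norm (form a A x)" ..
  also have "\<dots> \<le> C * (\<Prod>k\<in>I. pnorm k (A k) (x k))"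
    by (rule form_le_pnorm[OF a]) (use S in \<open>auto simp: A_def\<close>)
  also have "(\<Prod>k\<in>I. pnorm k (A k) (x k)) = (\<Prod>k\<in>I. if k = l then real (card S) powr (1 / p l) else 1)"
    by (rule prod.cong) (auto simp: pnorm_def A_def x_def c)
  also have "\<dots> = real (card S) powr (1 / p l)" using l finite_I by simp
  finally have "(\<Sum>s\<in>S. norm (a (i(l := s)))) \<le> C * real (card S) powr (1 / p l)" .
  moreover have "(\<Sum>s\<in>S. \<epsilon>) \<le> (\<Sum>s\<in>S. norm (a (i(l := s))))"
    using big by (intro sum_mono)
  ultimately show ?thesis by simp
qed

text \<open>A form living on one line is in essence a functional on factor l with unimodular
  coefficients, and its norm is that of the coefficients in the conjugate sequence space, up to the
  factor 2.\<close>

lemma bd_unimodular_line: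
  assumes j: "j \<in> idx" and l: "l \<in> I" and S: "finite S" and c: "\<And>s. norm (c s) = 1"
  shows "bd (\<Sum>s\<in>S. sc (c s) (unit (j(l := s)))) (2 * real (card S) powr (1 - 1 / p l))"
  unfolding bd_def
proof (intro conjI allI impI)
  fix i assume "i \<notin> idx"
  then show "(\<Sum>s\<in>S. sc (c s) (unit (j(l := s)))) i = 0"
    using j l idx_upd by (auto simp: sum_fun_apply unit_def intro!: sum.neutral)
next
  fix A x assume t: "unit_test A (x :: nat \<Rightarrow> nat \<Rightarrow> 'a)"
  have fin: "finite (A k)" if "k \<in> I" for k using t that by (simp add: unit_test_def)
  show "norm (form (\<Sum>s\<in>S. sc (c s) (unit (j(l := s)))) A x) \<le> 2 * real (card S) powr (1 - 1 / p l)"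
  proof (cases "S = {}")
    case True
    then show ?thesis by (simp add: form_def)
  next
    case False
    define m where "m = real (card S)"
    have m: "0 < m" using False S by (simp add: m_def card_gt_0_iff)
    have pl: "1 < p l" using p_gt_1[OF l] .
    have "norm (form (\<Sum>s\<in>S. sc (c s) (unit (j(l := s)))) A x)
        = norm (\<Sum>s\<in>S. c s * form (unit (j(l := s))) A x)"
      using S by (simp add: form_sum form_sc)
    also have "\<dots> \<le> (\<Sum>s\<in>S. m powr (- 1 / p l) * (1 + (if s \<in> A l then m * norm (x l s) powr p l else 0)))"
    proof (rule sum_norm_le)
      fix s assume "s \<in> S"
      let ?r = "m powr (- 1 / p l) * (1 + (if s \<in> A l then m * norm (x l s) powr p l else 0))"
      show "norm (c s * form (unit (j(l := s))) A x) \<le> ?r"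
      proof (cases "j(l := s) \<in> Pi\<^sub>E I A")
        case True
        then have s: "s \<in> A l" using l by (auto simp: PiE_iff)
        have "norm (form (unit (j(l := s)) :: _ \<Rightarrow> 'a) A x) = norm (\<Prod>k\<in>I. x k ((j(l := s)) k))"
          using True fin by (simp add: form_unit)
        also have "\<dots> = norm (x l s) * (\<Prod>k\<in>I - {l}. norm (x k ((j(l := s)) k)))"
          using l finite_I by (simp add: prod.remove[of I l] norm_mult prod_norm)
        also have "\<dots> \<le> norm (x l s) * 1"
          using True unit_test_entry[OF t] by (intro mult_left_mono prod_le_1) (auto simp: PiE_iff)
        finally have 1: "norm (c s * form (unit (j(l := s))) A x) \<le> norm (x l s)" by (simp add: norm_mult c)
        \<comment> \<open>Scaled so that both terms of \<open>t \<le> 1 + t powr p l\<close>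
          contribute at most \<open>m\<close> after summation over \<open>S\<close>; this is the
          origin of the factor 2.\<close>
        define t where "t = m powr (1 / p l) * norm (x l s)"
        have "t \<le> 1 + t powr p l"
        proof (cases "t \<le> 1")
          case False
          then have "t powr 1 \<le> t powr p l" using pl by (intro powr_mono) auto
          then show ?thesis using False by simp
        qed (simp add: add_increasing2)
        moreover have "t powr p l = m * norm (x l s) powr p l"
          unfolding t_def using m pl by (simp add: powr_mult powr_powr)
        moreover have "m powr (- 1 / p l) * t = norm (x l s)"
          unfolding t_def using m by (simp add: powr_minus)
        ultimately have "norm (x l s) \<le> ?r"
          using s m by (metis mult_left_mono powr_ge_zero)
        with 1 show ?thesis by simp
      next
        case False
        have "form (unit (j(l := s)) :: _ \<Rightarrow> 'a) A x = 0"
          by (subst form_unit) (use fin False in auto)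
        then show ?thesis using m by simp
      qed
    qed
    also have "\<dots> = m powr (- 1 / p l) * (m + m * (\<Sum>s\<in>S. if s \<in> A l then norm (x l s) powr p l else 0))"
    proof -
      have "(\<Sum>s\<in>S. 1 + (if s \<in> A l then m * norm (x l s) powr p l else 0))
          = m + m * (\<Sum>s\<in>S. if s \<in> A l then norm (x l s) powr p l else 0)"
        unfolding sum.distrib sum_distrib_left by (auto simp: m_def intro!: sum.cong)
      then show ?thesis by (simp flip: sum_distrib_left)
    qed
    also have "\<dots> \<le> m powr (- 1 / p l) * (m + m * 1)"
    proof -
      have "(\<Sum>s\<in>S. if s \<in> A l then norm (x l s) powr p l else 0) = (\<Sum>s\<in>S \<inter> A l. norm (x l s) powr p l)"
        using S by (simp add: sum.inter_restrict)
      also have "\<dots> \<le> (\<Sum>s\<in>A l. norm (x l s) powr p l)"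
        using fin[OF l] by (intro sum_mono2) auto
      also have "\<dots> \<le> 1" using t l by (simp add: unit_test_def)
      finally show ?thesis using m by (intro mult_left_mono add_left_mono) auto
    qed
    also have "\<dots> = 2 * m powr (1 - 1 / p l)"
      using m by (simp add: powr_diff powr_minus field_simps)
    finally show ?thesis by (simp add: m_def)
  qed
qed

text \<open>\<open>T\<close> is applied to a line of units whose unimodular coefficients make all
  contributions to entry \<open>i\<close> nonnegative; \<open>bd_unimodular_line\<close> bounds the
  argument.\<close>

lemma column_line_sum:
  assumes T: "blin bd bd T" and K: "\<And>a C. bd a C \<Longrightarrow> bd (T a) (K * C)"
    and j: "j \<in> idx" and l: "l \<in> I" and S: "finite S"
    and big: "\<And>s. s \<in> S \<Longrightarrow> \<epsilon> \<le> norm (T (unit (j(l := s))) i)"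
  shows "real (card S) * \<epsilon> \<le> 2 * K * real (card S) powr (1 - 1 / p l)"
proof -
  let ?z = "\<lambda>s. T (unit (j(l := s))) i"
  have "\<exists>c. norm c = 1 \<and> c * ?z s = of_real (norm (?z s))" for s
    using unimodular_factor by metis
  then obtain c where c: "\<And>s. norm (c s) = 1" "\<And>s. c s * ?z s = of_real (norm (?z s))"
    by metis
  have "T (\<Sum>s\<in>S. sc (c s) (unit (j(l := s)))) = (\<Sum>s\<in>S. T (sc (c s) (unit (j(l := s)))))"
    using j l by (intro blin_sum[OF V.function_norm_axioms T S]) simp
  also have "\<dots> = (\<Sum>s\<in>S. sc (c s) (T (unit (j(l := s)))))"
    using j l by (intro sum.cong refl blin_sc[OF T]) simp
  finally have "T (\<Sum>s\<in>S. sc (c s) (unit (j(l := s)))) i = (\<Sum>s\<in>S. of_real (norm (?z s)))"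
    by (simp add: sum_fun_apply c)
  then have "norm (T (\<Sum>s\<in>S. sc (c s) (unit (j(l := s)))) i) = (\<Sum>s\<in>S. norm (?z s))"
    by (simp add: sum_nonneg flip: of_real_sum)
  moreover have "norm (T (\<Sum>s\<in>S. sc (c s) (unit (j(l := s)))) i) \<le> K * (2 * real (card S) powr (1 - 1 / p l))"
    by (rule V.bd_entry[OF K[OF bd_unimodular_line[OF j l S c(1)]]])
  moreover have "(\<Sum>s\<in>S. \<epsilon>) \<le> (\<Sum>s\<in>S. norm (?z s))"
    using big by (intro sum_mono)
  ultimately show ?thesis by simp
qed

text \<open>\<open>row_line_sum\<close> and \<open>column_line_sum\<close> compare
  \<open>card S\<close> with its own powers of exponent \<open>1 / p l\<close> and
  \<open>1 - 1 / p l\<close>. Both exponents are below one, the first because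
  \<open>1 < p l\<close>, so \<open>card S\<close> is bounded independently of the line.\<close>

lemma card_big_lines:
  assumes T: "blin bd bd T" and K: "\<And>a C. bd a C \<Longrightarrow> bd (T a) (K * C)" and "0 < \<epsilon>"
  obtains c :: nat where
    "\<And>i j l S. i \<in> idx \<Longrightarrow> j \<in> idx \<Longrightarrow> l \<in> I \<Longrightarrow> finite S \<Longrightarrow>
      (\<And>s. s \<in> S \<Longrightarrow> \<epsilon> \<le> norm (T (unit j) (i(l := s)))) \<Longrightarrow> card S \<le> c"
    "\<And>i j l S. j \<in> idx \<Longrightarrow> l \<in> I \<Longrightarrow> finite S \<Longrightarrow>
      (\<And>s. s \<in> S \<Longrightarrow> \<epsilon> \<le> norm (T (unit (j(l := s))) i)) \<Longrightarrow> card S \<le> c"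
proof -
  define c1 where "c1 l = (K / \<epsilon>) powr (1 / (1 - 1 / p l))" for l
  define c2 where "c2 l = (2 * K / \<epsilon>) powr (1 / (1 - (1 - 1 / p l)))" for l
  define c where "c = nat \<lceil>\<Sum>l\<in>I. c1 l + c2 l\<rceil>"
  have le: "n \<le> c" if "l \<in> I" "real n \<le> c1 l + c2 l" for l and n :: nat
  proof -
    have "real n \<le> (\<Sum>l\<in>I. c1 l + c2 l)"
      using member_le_sum[of l I "\<lambda>l. c1 l + c2 l"] that finite_I by (auto simp: c1_def c2_def)
    then show ?thesis unfolding c_def by linarith
  qed
  have 1: "card S \<le> c" if "i \<in> idx" "j \<in> idx" "l \<in> I" "finite S"
      "\<And>s. s \<in> S \<Longrightarrow> \<epsilon> \<le> norm (T (unit j) (i(l := s)))" for i j l S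
  proof (rule le[OF \<open>l \<in> I\<close>])
    have "real (card S) * \<epsilon> \<le> K * 1 * real (card S) powr (1 / p l)"
      using that by (intro row_line_sum[OF K[OF bd_unit]])
    then have "real (card S) \<le> c1 l"
      unfolding c1_def using \<open>0 < \<epsilon>\<close> p_gt_1[OF that(3)] by (intro sublinear_bound) auto
    then show "real (card S) \<le> c1 l + c2 l" by (simp add: c2_def add_increasing2)
  qed
  have 2: "card S \<le> c" if "j \<in> idx" "l \<in> I" "finite S"
      "\<And>s. s \<in> S \<Longrightarrow> \<epsilon> \<le> norm (T (unit (j(l := s))) i)" for i j l S
  proof (rule le[OF \<open>l \<in> I\<close>])
    have "real (card S) * \<epsilon> \<le> 2 * K * real (card S) powr (1 - 1 / p l)"
      using that by (intro column_line_sum[OF T K])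
    then have "real (card S) \<le> c2 l"
      unfolding c2_def using \<open>0 < \<epsilon>\<close> p_gt_1[OF that(2)] by (intro sublinear_bound) auto
    then show "real (card S) \<le> c1 l + c2 l" by (simp add: c1_def add_increasing)
  qed
  show ?thesis using that[of c] 1 2 by blast
qed

text \<open>
  The off-diagonal entries are made small by a random choice of the grid, the diagonal entries are
  made almost constant by a Ramsey argument.
\<close>

lemma good_subgrid:
  fixes T :: "('k::{real_normed_field, euclidean_space}) arr \<Rightarrow> 'k arr"
  assumes T: "blin bd bd T" and K: "\<And>a C. bd a C \<Longrightarrow> bd (T a) (K * C)"
    and Q: "finite Q" "Q \<subseteq> idx" and \<epsilon>: "0 < \<epsilon>"
  obtains \<sigma> \<mu> where
    "\<And>l. l \<in> I \<Longrightarrow> inj_on (\<sigma> l) {..<n}" "\<And>l s. l \<in> I \<Longrightarrow> blk (\<sigma> l s) = m" "norm \<mu> \<le> K"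
    "\<And>v. v \<in> cube n \<Longrightarrow> norm (T (unit (grid \<sigma> v)) (grid \<sigma> v) - \<mu>) \<le> \<epsilon>"
    "\<And>v v'. v \<in> cube n \<Longrightarrow> v' \<in> cube n \<Longrightarrow> v \<noteq> v' \<Longrightarrow> norm (T (unit (grid \<sigma> v')) (grid \<sigma> v)) \<le> \<epsilon>"
    "\<And>v j. v \<in> cube n \<Longrightarrow> j \<in> Q \<Longrightarrow> norm (T (unit j) (grid \<sigma> v)) \<le> \<epsilon>"
proof -
  obtain l0 where l0: "l0 \<in> I" using I_nonempty by blast
  have entry: "norm (T (unit j) i) \<le> K" if "j \<in> idx" for i j
    using V.bd_entry[OF K[OF bd_unit[OF that]]] by simp
  \<comment> \<open>A finite \<epsilon>-net of the ball of radius \<open>K\<close> provides the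
    colours: \<open>col z\<close> names a net point within \<epsilon> of \<open>z\<close>.\<close>
  obtain F where F: "finite F" "F \<subseteq> cball 0 K" "cball (0::'k) K \<subseteq> (\<Union>z\<in>F. ball z \<epsilon>)"
  proof (rule compactE_image[OF compact_cball, of "cball 0 K" "\<lambda>z. ball z \<epsilon>" "0::'k" K])
    show "cball (0::'k) K \<subseteq> (\<Union>z\<in>cball 0 K. ball z \<epsilon>)" using \<epsilon> by force
  qed auto
  obtain h where h: "bij_betw h {0..<card F} F" using ex_bij_betw_nat_finite[OF F(1)] by blast
  have "\<exists>c<card F. norm (z - h c) \<le> \<epsilon>" if z: "norm z \<le> K" for z
  proof -
    obtain y where y: "y \<in> F" "z \<in> ball y \<epsilon>"
      using subsetD[OF F(3), of z] z by auto
    then obtain c where "c < card F" "h c = y" using h unfolding bij_betw_def by force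
    then show ?thesis using y by (auto simp: dist_norm norm_minus_commute intro!: exI[of _ c])
  qed
  then obtain col where col: "\<And>z. norm z \<le> K \<Longrightarrow> col z < card F \<and> norm (z - h (col z)) \<le> \<epsilon>" by metis
  \<comment> \<open>The grid is first built with side \<open>M\<close>; the Ramsey argument then
    cuts it down to side \<open>n\<close> with diagonal entries of one colour.\<close>
  obtain M where M: "\<And>f :: (nat \<Rightarrow> nat) \<Rightarrow> nat. (\<forall>v\<in>cube M. f v < card F) \<Longrightarrow>
    \<exists>S col. (\<forall>l\<in>I. S l \<subseteq> {..<M} \<and> card (S l) = n) \<and> (\<forall>v\<in>Pi\<^sub>E I S. f v = col)"
    using monochromatic_grid[OF finite_I, of "card F" n] unfolding cube_def by metis
  \<comment> \<open>Position \<open>s\<close> of factor l goes to a place in block \<open>m\<close>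
    that records \<open>s\<close>, which keeps the map injective, together with the free choice
    \<open>\<omega> (l, s)\<close>.\<close>
  define pos where "pos \<omega> l s = prod_encode (m, prod_encode (s, \<omega> (l, s)))" for \<omega> :: "nat \<times> nat \<Rightarrow> nat" and l s
  obtain c :: nat where c1: "\<And>i j l S. i \<in> idx \<Longrightarrow> j \<in> idx \<Longrightarrow> l \<in> I \<Longrightarrow> finite S \<Longrightarrow>
      (\<And>s. s \<in> S \<Longrightarrow> \<epsilon> \<le> norm (T (unit j) (i(l := s)))) \<Longrightarrow> card S \<le> c"
    and c2: "\<And>i j l S. j \<in> idx \<Longrightarrow> l \<in> I \<Longrightarrow> finite S \<Longrightarrow>
      (\<And>s. s \<in> S \<Longrightarrow> \<epsilon> \<le> norm (T (unit (j(l := s))) i)) \<Longrightarrow> card S \<le> c"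
    using card_big_lines[OF T K \<epsilon>] by blast
  \<comment> \<open>One bad event for each pair and each coordinate in which the pair differs.
    Changing \<open>\<omega>\<close> at \<open>(l, v' l)\<close> moves
    \<open>grid (pos \<omega>) v'\<close> along a line in direction l and leaves
    \<open>grid (pos \<omega>) v\<close> in place, because \<open>v l \<noteq> v' l\<close>; so the
    column bound \<open>c2\<close> applies.\<close>
  define Q1 where "Q1 = {(l, v, v'). l \<in> I \<and> v \<in> cube M \<and> v' \<in> cube M \<and> v l \<noteq> v' l}"
  define Q' where "Q' = Inl ` Q1 \<union> Inr ` (cube M \<times> Q)"
  have "finite Q1"
    by (rule finite_subset[of _ "I \<times> cube M \<times> cube M"]) (auto simp: Q1_def finite_I)
  then have finQ': "finite Q'" unfolding Q'_def using Q by auto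
  define B where "B q \<omega> = (case q of Inl (l, v, v') \<Rightarrow> \<epsilon> < norm (T (unit (grid (pos \<omega>) v')) (grid (pos \<omega>) v))
      | Inr (v, j) \<Rightarrow> \<epsilon> < norm (T (unit j) (grid (pos \<omega>) v)))"
    for q :: "nat \<times> (nat \<Rightarrow> nat) \<times> (nat \<Rightarrow> nat) + (nat \<Rightarrow> nat) \<times> (nat \<Rightarrow> nat)" and \<omega>
  \<comment> \<open>For an \<open>Inr\<close> event the old index \<open>j\<close> is fixed and only
    the output index moves, in the direction of an arbitrary factor \<open>l0\<close>; so the row
    bound \<open>c1\<close> applies.\<close>
  define slot where "slot q = (case q of Inl (l, v, v') \<Rightarrow> (l, v' l) | Inr (v, j) \<Rightarrow> (l0, v l0))"
    for q :: "nat \<times> (nat \<Rightarrow> nat) \<times> (nat \<Rightarrow> nat) + (nat \<Rightarrow> nat) \<times> (nat \<Rightarrow> nat)"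
  have move: "grid (pos (fun_upd \<omega> (l, v l) s)) v = (grid (pos \<omega>) v)(l := prod_encode (m, prod_encode (v l, s)))"
    if "l \<in> I" for \<omega> l v s
    using that by (auto simp: grid_def pos_def fun_eq_iff)
  have stay: "grid (pos (fun_upd \<omega> (l, t) s)) v = grid (pos \<omega>) v" if "v l \<noteq> t" for \<omega> l v s t
    using that by (auto simp: grid_def pos_def fun_eq_iff)
  obtain \<omega> where \<omega>: "\<And>q. q \<in> Q' \<Longrightarrow> \<not> B q \<omega>"
  proof (rule avoid_bad_events[of "I \<times> {..<M}" Q' slot "card Q' * c + 1" B c])
    show "finite (I \<times> {..<M})" using finite_I by simp
    show "slot q \<in> I \<times> {..<M}" if "q \<in> Q'" for q
      using that l0 cube_nth unfolding Q'_def Q1_def slot_def by auto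
    fix q \<omega> assume q: "q \<in> Q'"
    let ?S = "{s. s < card Q' * c + 1 \<and> B q (fun_upd \<omega> (slot q) s)}"
    show "card ?S \<le> c"
    proof (cases q)
      case (Inl r)
      obtain l v v' where r: "r = (l, v, v')" by (cases r)
      then have lv: "l \<in> I" "v l \<noteq> v' l" using q Inl by (auto simp: Q'_def Q1_def)
      let ?g = "\<lambda>s. prod_encode (m, prod_encode (v' l, s))"
      have "card (?g ` ?S) \<le> c"
      proof (rule c2[OF grid_in_idx lv(1)])
        fix s assume "s \<in> ?g ` ?S"
        then obtain t where "s = ?g t" "t \<in> ?S" by blast
        then show "\<epsilon> \<le> norm (T (unit ((grid (pos \<omega>) v')(l := s))) (grid (pos \<omega>) v))"
          using move[OF lv(1)] stay[of v l "v' l"] lv(2) by (simp add: B_def slot_def Inl r)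
      qed simp
      moreover have "card (?g ` ?S) = card ?S" by (intro card_image) (auto intro: inj_onI)
      ultimately show ?thesis by simp
    next
      case (Inr r)
      obtain v j where r: "r = (v, j)" by (cases r)
      then have j: "j \<in> idx" using q Inr Q by (auto simp: Q'_def)
      let ?g = "\<lambda>s. prod_encode (m, prod_encode (v l0, s))"
      have "card (?g ` ?S) \<le> c"
      proof (rule c1[OF grid_in_idx j l0])
        fix s assume "s \<in> ?g ` ?S"
        then obtain t where "s = ?g t" "t \<in> ?S" by blast
        then show "\<epsilon> \<le> norm (T (unit j) ((grid (pos \<omega>) v)(l0 := s)))"
          using move[OF l0] by (simp add: B_def slot_def Inr r)
      qed simp
      moreover have "card (?g ` ?S) = card ?S" by (intro card_image) (auto intro: inj_onI)
      ultimately show ?thesis by simp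
    qed
  qed (use finQ' in auto)
  define \<tau> where "\<tau> = pos \<omega>"
  have offdiag: "norm (T (unit (grid \<tau> v')) (grid \<tau> v)) \<le> \<epsilon>"
    if v: "v \<in> cube M" "v' \<in> cube M" "v \<noteq> v'" for v v'
  proof -
    have "\<exists>l\<in>I. v l \<noteq> v' l" using PiE_ext v unfolding cube_def by blast
    then obtain l where l: "l \<in> I" "v l \<noteq> v' l" by blast
    have "Inl (l, v, v') \<in> Q'" unfolding Q'_def Q1_def using l v by auto
    from \<omega>[OF this] show ?thesis by (simp add: B_def \<tau>_def)
  qed
  have old: "norm (T (unit j) (grid \<tau> v)) \<le> \<epsilon>" if "v \<in> cube M" "j \<in> Q" for v j
    using \<omega>[of "Inr (v, j)"] that by (auto simp: B_def \<tau>_def Q'_def)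
  define f where "f v = col (T (unit (grid \<tau> v)) (grid \<tau> v))" for v
  have "\<forall>v\<in>cube M. f v < card F" using col entry unfolding f_def by simp
  then obtain S k where S: "\<And>l. l \<in> I \<Longrightarrow> S l \<subseteq> {..<M} \<and> card (S l) = n" and k: "\<And>v. v \<in> Pi\<^sub>E I S \<Longrightarrow> f v = k"
    using M by metis
  have "\<exists>e. bij_betw e {..<n} (S l)" if "l \<in> I" for l
    using ex_bij_betw_nat_finite[of "S l"] S[OF that] finite_subset by (metis atLeast0LessThan finite_lessThan)
  then obtain e where e: "\<And>l. l \<in> I \<Longrightarrow> bij_betw (e l) {..<n} (S l)" by metis
  define \<sigma> where "\<sigma> l s = \<tau> l (e l s)" for l s
  have g\<sigma>: "grid \<sigma> v = grid \<tau> (grid e v)" for v by (simp add: grid_def \<sigma>_def fun_eq_iff)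
  have geS: "grid e v \<in> Pi\<^sub>E I S" if "v \<in> cube n" for v
    using e cube_nth[OF that] by (auto simp: grid_def bij_betw_def)
  then have geM: "grid e v \<in> cube M" if "v \<in> cube n" for v
    using that S PiE_mono[of I S "\<lambda>_. {..<M}"] unfolding cube_def by blast
  have ge_inj: "inj_on (grid e) (cube n)"
    unfolding cube_def using e by (intro inj_on_grid) (simp add: bij_betw_def)
  show ?thesis
  \<comment> \<open>For \<open>n = 0\<close> the grid is empty and \<open>k\<close> need not be a
    colour, so \<open>h k\<close> might lie outside the ball of radius \<open>K\<close>; hence the
    default 0.\<close>
  proof (rule that[of \<sigma> "if n = 0 then 0 else h k"])
    fix l s assume l: "l \<in> I"
    have "inj (\<tau> l)" unfolding \<tau>_def pos_def by (auto intro: injI)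
    then show "inj_on (\<sigma> l) {..<n}"
      unfolding \<sigma>_def using e[OF l] by (auto simp: bij_betw_def inj_on_def)
    show "blk (\<sigma> l s) = m" by (simp add: \<sigma>_def \<tau>_def pos_def blk_def)
  next
    have "norm (h k) \<le> K" if "n \<noteq> 0"
    proof -
      have "(\<lambda>l\<in>I. 0) \<in> cube n" using that by (auto simp: cube_def)
      then have "f (grid e (\<lambda>l\<in>I. 0)) = k" using k geS by blast
      then have "k < card F" using col entry unfolding f_def by (metis grid_in_idx)
      then have "h k \<in> F" using h by (auto simp: bij_betw_def)
      then show ?thesis using F(2) by auto
    qed
    moreover have "0 \<le> K" using entry[of "grid \<tau> undefined"] norm_ge_zero order_trans by (metis grid_in_idx)
    ultimately show "norm (if n = 0 then 0 else h k) \<le> K" by auto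
  next
    fix v assume v: "v \<in> cube n"
    have n: "n \<noteq> 0" using cube_nth[OF v l0] by auto
    have "f (grid e v) = k" using k geS[OF v] by blast
    then show "norm (T (unit (grid \<sigma> v)) (grid \<sigma> v) - (if n = 0 then 0 else h k)) \<le> \<epsilon>"
      using col[OF entry] n unfolding f_def g\<sigma> by (metis grid_in_idx)
  next
    fix v v' assume "v \<in> cube n" "v' \<in> cube n" "v \<noteq> v'"
    then show "norm (T (unit (grid \<sigma> v')) (grid \<sigma> v)) \<le> \<epsilon>"
      unfolding g\<sigma> using ge_inj by (intro offdiag geM) (auto dest: inj_onD)
  next
    fix v j assume "v \<in> cube n" "j \<in> Q"
    then show "norm (T (unit j) (grid \<sigma> v)) \<le> \<epsilon>"
      unfolding g\<sigma> by (intro old geM)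
  qed
qed

section \<open>Projections on the space of forms\<close>

text \<open>\<delta> bounds the norm of the functional \<open>a \<mapsto> T a i\<close> restricted
  to the block-diagonal forms with blocks in \<open>M\<close>.\<close>

definition tail_small :: "(('k::{real_normed_field, euclidean_space}) arr \<Rightarrow> 'k arr) \<Rightarrow>
    nat set \<Rightarrow> (nat \<Rightarrow> nat) \<Rightarrow> real \<Rightarrow> bool" where
  "tail_small T M i \<delta> \<longleftrightarrow> (\<forall>a C. bd a C \<longrightarrow> block_diag M a \<longrightarrow> norm (T a i) \<le> \<delta> * C)"

lemma tail_small_mono:
  fixes T :: "('k::{real_normed_field, euclidean_space}) arr \<Rightarrow> 'k arr"
  assumes "tail_small T M i \<delta>" "M' \<subseteq> M" "\<delta> \<le> \<delta>'"
  shows "tail_small T M' i \<delta>'"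
  unfolding tail_small_def
proof (intro allI impI)
  fix a :: "'k arr" and C assume a: "bd a C" "block_diag M' a"
  then have "block_diag M a" using assms(2) unfolding block_diag_def by blast
  then have "norm (T a i) \<le> \<delta> * C" using assms(1) a unfolding tail_small_def by blast
  also have "\<dots> \<le> \<delta>' * C" using assms(3) V.bd_nonneg[OF a(1)] by (rule mult_right_mono)
  finally show "norm (T a i) \<le> \<delta>' * C" .
qed

lemma block_part_eq_0:
  assumes "block_diag M a" "b \<notin> M"
  shows "block_part b a = 0"
proof
  obtain l where l: "l \<in> I" using I_nonempty by blast
  show "block_part b a i = 0 i" for i
  proof (cases "(\<forall>l\<in>I. blk (i l) = b) \<and> a i \<noteq> 0")
    case True
    then obtain b' where "b' \<in> M" "\<forall>l\<in>I. blk (i l) = b'" using assms(1) unfolding block_diag_def by blast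
    then show ?thesis using True l assms(2) by metis
  qed (auto simp: block_part_def)
qed

lemma block_part_sum:
  fixes f :: "'j \<Rightarrow> ('k::{real_normed_field, euclidean_space}) arr"
  shows "block_part b (\<Sum>j\<in>A. f j) = (\<Sum>j\<in>A. block_part b (f j))"
proof
  have gen: "(if q then \<Sum>j\<in>A. g j else 0) = (\<Sum>j\<in>A. if q then g j else 0)" for q and g :: "'j \<Rightarrow> 'k"
    by simp
  show "block_part b (\<Sum>j\<in>A. f j) i = (\<Sum>j\<in>A. block_part b (f j)) i" for i
    unfolding block_part_def sum_fun_apply by (rule gen)
qed

lemma block_diag_sum:
  assumes "\<And>j. j \<in> A \<Longrightarrow> block_diag M (f j)"
  shows "block_diag M (\<Sum>j\<in>A. f j)"
  unfolding block_diag_def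
proof (intro allI impI)
  fix i assume "(\<Sum>j\<in>A. f j) i \<noteq> 0"
  then obtain j where "j \<in> A" "f j i \<noteq> 0" unfolding sum_fun_apply by (meson sum.neutral)
  then show "i \<in> idx \<and> (\<exists>b\<in>M. \<forall>l\<in>I. blk (i l) = b)" using assms unfolding block_diag_def by blast
qed

lemma block_diag_mono: "block_diag M a \<Longrightarrow> M \<subseteq> M' \<Longrightarrow> block_diag M' a"
  unfolding block_diag_def by blast

text \<open>
  A functional that is large on the forms living on each of many disjoint sets of blocks would be
  unbounded, since the block-diagonal sum of bounded forms is bounded.
\<close>

lemma ex_tail_small:
  fixes T :: "('k::{real_normed_field, euclidean_space}) arr \<Rightarrow> 'k arr"
    and s :: "nat \<Rightarrow> nat"
  assumes T: "blin bd bd T" and s: "strict_mono s" and \<delta>: "0 < \<delta>"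
  shows "\<exists>r :: nat \<Rightarrow> nat. strict_mono r \<and> tail_small T (range (s \<circ> r)) i \<delta>"
proof (rule ccontr)
  assume contra: "\<nexists>r :: nat \<Rightarrow> nat. strict_mono r \<and> tail_small T (range (s \<circ> r)) i \<delta>"
  obtain K where K: "0 \<le> K" "\<And>a C. bd a C \<Longrightarrow> bd (T a) (K * C)" using blin_bound[OF T] by blast
  \<comment> \<open>The pairing provides infinitely many increasing sequences with disjoint ranges,
    hence disjoint sets of blocks \<open>range (s \<circ> r j)\<close>.\<close>
  define r where "r j k = prod_encode (j, k)" for j k
  have r: "strict_mono (r j)" for j
    by (rule strict_monoI_Suc) (simp add: r_def prod_encode_def)
  have "\<exists>a C. bd a C \<and> block_diag (range (s \<circ> r j)) a \<and> \<delta> * C < norm (T a i)" for j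
  proof -
    have "\<not> tail_small T (range (s \<circ> r j)) i \<delta>"
    proof
      assume "tail_small T (range (s \<circ> r j)) i \<delta>"
      with r[of j] have "strict_mono (r j) \<and> tail_small T (range (s \<circ> r j)) i \<delta>" by simp
      then have "\<exists>r :: nat \<Rightarrow> nat. strict_mono r \<and> tail_small T (range (s \<circ> r)) i \<delta>" by (rule exI[of _ "r j"])
      with contra show False by contradiction
    qed
    then show ?thesis unfolding tail_small_def by (simp add: not_le)
  qed
  then obtain a C where a: "\<And>j. bd (a j) (C j)" "\<And>j. block_diag (range (s \<circ> r j)) (a j)"
    "\<And>j. \<delta> * C j < norm (T (a j) i)"
    by metis
  have C: "0 < C j" for j
  proof (rule ccontr)
    assume "\<not> 0 < C j"
    then have "C j = 0" using V.bd_nonneg[OF a(1), of j] by simp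
    then have "a j = 0" using a(1)[of j] V.bd_eq_0 by metis
    then have "T (a j) i = 0" using blin_zero[OF V.function_norm_axioms T] by simp
    then show False using a(3)[of j] \<open>C j = 0\<close> by simp
  qed
  have "\<exists>c. norm c = 1 \<and> c * T (a j) i = of_real (norm (T (a j) i))" for j
    using unimodular_factor by metis
  then obtain c where c: "\<And>j. norm (c j) = 1" "\<And>j. c j * T (a j) i = of_real (norm (T (a j) i))" by metis
  \<comment> \<open>Scaled to bound 1 and rotated so that \<open>T (a' j) i\<close> is real and
    above \<delta>: in a sum of n such forms the values add up, while the norm stays below
    \<open>card I\<close>.\<close>
  define a' where "a' j = sc (c j / of_real (C j)) (a j)" for j
  have a'1: "bd (a' j) 1" for j
    using V.bd_sc[OF a(1), of "c j / of_real (C j)" j] C[of j] c(1)[of j] unfolding a'_def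
    by (simp add: norm_divide)
  have a'd: "block_diag (range (s \<circ> r j)) (a' j)" for j
    using a(2)[of j] unfolding block_diag_def a'_def by auto
  have Ta': "T (a' j) i = of_real (norm (T (a j) i) / C j)" for j
  proof -
    have "T (a' j) = sc (c j / of_real (C j)) (T (a j))"
      unfolding a'_def by (rule blin_sc[OF T V.carI[OF a(1)]])
    then show ?thesis using c(2)[of j] by (simp add: mult.commute)
  qed
  obtain n :: nat where n: "K * real (card I) < real n * \<delta>"
    using reals_Archimedean3[OF \<delta>] by blast
  have disj: "j = j'" if "b \<in> range (s \<circ> r j)" "b \<in> range (s \<circ> r j')" for b j j'
    using that s by (auto simp: r_def strict_mono_eq)
  have "bd (block_part b (\<Sum>j<n. a' j)) 1" for b
  proof (cases "\<exists>j<n. b \<in> range (s \<circ> r j)")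
    case True
    then obtain j where j: "j < n" "b \<in> range (s \<circ> r j)" by blast
    have "block_part b (a' j') = (if j' = j then block_part b (a' j) else 0)" for j'
    proof (cases "j' = j")
      case False
      then have "b \<notin> range (s \<circ> r j')" using disj[OF j(2)] by blast
      then show ?thesis using block_part_eq_0[OF a'd] False by simp
    qed simp
    then have "block_part b (\<Sum>j<n. a' j) = (\<Sum>j'<n. if j' = j then block_part b (a' j) else 0)"
      unfolding block_part_sum by simp
    also have "\<dots> = block_part b (a' j)" using j(1) by (simp add: sum.delta)
    finally show ?thesis using bd_block_part[OF a'1] by metis
  next
    case False
    then have "block_part b (a' j) = 0" if "j < n" for j using block_part_eq_0[OF a'd] that by blast
    then have "block_part b (\<Sum>j<n. a' j) = 0" unfolding block_part_sum by simp
    then show ?thesis using V.bd_zero'[OF zero_le_one] by (simp only:)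
  qed
  then have "bd (\<Sum>j<n. a' j) (real (card I) * 1)"
    by (intro bd_block_diag block_diag_sum block_diag_mono[OF a'd]) auto
  from V.bd_entry[OF K(2)[OF this]]
  have "norm (T (\<Sum>j<n. a' j) i) \<le> K * real (card I)" by simp
  moreover have "T (\<Sum>j<n. a' j) i = of_real (\<Sum>j<n. norm (T (a j) i) / C j)"
    using blin_sum[OF V.function_norm_axioms T, of "{..<n}" a'] V.carI[OF a'1] by (simp add: sum_fun_apply Ta')
  moreover have "norm (of_real (\<Sum>j<n. norm (T (a j) i) / C j) :: 'k) = (\<Sum>j<n. norm (T (a j) i) / C j)"
    unfolding norm_of_real using C by (intro abs_of_nonneg sum_nonneg divide_nonneg_nonneg) (auto simp: less_imp_le)
  moreover have "(\<Sum>j<n. \<delta>) \<le> (\<Sum>j<n. norm (T (a j) i) / C j)"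
    by (intro sum_mono) (use a(3) C in \<open>simp add: pos_le_divide_eq less_imp_le\<close>)
  ultimately have "real n * \<delta> \<le> K * real (card I)" by simp
  then show False using n by simp
qed

text \<open>\<open>ex_tail_small\<close> is applied in turn to the countably many pairs of an index
  and a tolerance 1 / (q + 1), and the nested subsequences are merged into a diagonal one. Smaller
  sets of blocks keep \<open>tail_small\<close>, which is what the diagonal argument
  requires.\<close>

lemma diagonal_tail_small:
  fixes T :: "('k::{real_normed_field, euclidean_space}) arr \<Rightarrow> 'k arr"
  assumes T: "blin bd bd T"
  obtains d :: "nat \<Rightarrow> nat" where "strict_mono d"
    and "\<And>i \<delta>. i \<in> idx \<Longrightarrow> 0 < \<delta> \<Longrightarrow> \<exists>t0. tail_small T (d ` {t0..}) i \<delta>"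
proof -
  define P where "P n s = tail_small T (range s) (from_nat_into idx (fst (prod_decode n))) (1 / real (Suc (snd (prod_decode n))))"
    for n and s :: "nat \<Rightarrow> nat"
  interpret subseqs P
    by standard (unfold P_def, rule ex_tail_small[OF T], assumption, simp)
  have P: "P n (diagseq \<circ> (+) (Suc n))" for n
    by (rule diagseq_holds) (auto simp: P_def intro: tail_small_mono)
  have "\<exists>t0. tail_small T (diagseq ` {t0..}) i \<delta>" if i: "i \<in> idx" and \<delta>: "0 < \<delta>" for i \<delta>
  proof -
    obtain k where k: "from_nat_into idx k = i"
      using from_nat_into_surj[OF countable_idx i] by blast
    obtain q where q: "1 / real (Suc q) < \<delta>"
      using nat_approx_posE[OF \<delta>] by blast
    let ?n = "prod_encode (k, q)"
    have "tail_small T (range (diagseq \<circ> (+) (Suc ?n))) i (1 / real (Suc q))"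
      using P[of ?n] k by (simp add: P_def)
    moreover have "diagseq ` {Suc ?n..} \<subseteq> range (diagseq \<circ> (+) (Suc ?n))"
    proof
      fix y assume "y \<in> diagseq ` {Suc ?n..}"
      then obtain t where "t \<ge> Suc ?n" "y = diagseq t" by auto
      then have "y = (diagseq \<circ> (+) (Suc ?n)) (t - Suc ?n)" by simp
      then show "y \<in> range (diagseq \<circ> (+) (Suc ?n))" by blast
    qed
    ultimately show ?thesis using tail_small_mono q by (meson less_imp_le)
  qed
  then show ?thesis using that subseq_diagseq by blast
qed

text \<open>The gliding hump. When block b is chosen, the earlier blocks form a finite set of
  inputs, whose effect on block b is made small by \<open>good_subgrid\<close>; the effect of block
  b and all later ones on earlier entries is made small by going far enough out along
  \<open>d\<close>.\<close>

lemma greedy_blocks: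
  fixes T :: "('k::{real_normed_field, euclidean_space}) arr \<Rightarrow> 'k arr"
  assumes T: "blin bd bd T" and K: "\<And>a C. bd a C \<Longrightarrow> bd (T a) (K * C)"
    and \<epsilon>: "\<And>b. 0 < \<epsilon> b"
    and tail: "\<And>i \<delta>. i \<in> idx \<Longrightarrow> 0 < \<delta> \<Longrightarrow> \<exists>t0. tail_small T (d ` {t0..}) i \<delta>"
  obtains t :: "nat \<Rightarrow> nat" and \<sigma> \<mu> where "strict_mono t"
    "\<And>b l. l \<in> I \<Longrightarrow> inj_on (\<sigma> b l) {..<b}" "\<And>b l s. l \<in> I \<Longrightarrow> blk (\<sigma> b l s) = d (t b)"
    "\<And>b. norm (\<mu> b) \<le> K"
    "\<And>b v. v \<in> cube b \<Longrightarrow> norm (T (unit (grid (\<sigma> b) v)) (grid (\<sigma> b) v) - \<mu> b) \<le> \<epsilon> b"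
    "\<And>b v v'. v \<in> cube b \<Longrightarrow> v' \<in> cube b \<Longrightarrow> v \<noteq> v' \<Longrightarrow> norm (T (unit (grid (\<sigma> b) v')) (grid (\<sigma> b) v)) \<le> \<epsilon> b"
    "\<And>b b' v v'. b' < b \<Longrightarrow> v \<in> cube b \<Longrightarrow> v' \<in> cube b' \<Longrightarrow> norm (T (unit (grid (\<sigma> b') v')) (grid (\<sigma> b) v)) \<le> \<epsilon> b"
    "\<And>b b' v'. b' < b \<Longrightarrow> v' \<in> cube b' \<Longrightarrow> tail_small T (d ` {t b..}) (grid (\<sigma> b') v') (\<epsilon> b)"
proof -
  \<comment> \<open>\<open>Q\<close> collects the indices occupied by the earlier blocks.\<close>
  define good where "good b = (\<lambda>(Q, t, \<sigma>, \<mu>). finite Q \<and> Q \<subseteq> idx \<and>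
    (\<forall>l\<in>I. inj_on (\<sigma> l) {..<b}) \<and> (\<forall>l\<in>I. \<forall>s. blk (\<sigma> l s) = d t) \<and> norm \<mu> \<le> K \<and>
    (\<forall>v\<in>cube b. norm (T (unit (grid \<sigma> v)) (grid \<sigma> v) - \<mu>) \<le> \<epsilon> b) \<and>
    (\<forall>v\<in>cube b. \<forall>v'\<in>cube b. v \<noteq> v' \<longrightarrow> norm (T (unit (grid \<sigma> v')) (grid \<sigma> v)) \<le> \<epsilon> b) \<and>
    (\<forall>v\<in>cube b. \<forall>j\<in>Q. norm (T (unit j) (grid \<sigma> v)) \<le> \<epsilon> b) \<and>
    (\<forall>j\<in>Q. tail_small T (d ` {t..}) j (\<epsilon> b)))"
    for b :: nat
  have step: "\<exists>t>t0. \<exists>\<sigma> \<mu>. good b (Q, t, \<sigma>, \<mu>)" if Q: "finite Q" "Q \<subseteq> idx" for b Q t0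
  proof -
    have "\<forall>j\<in>Q. \<exists>t1. tail_small T (d ` {t1..}) j (\<epsilon> b)" using tail Q \<epsilon> by blast
    then obtain t1 where t1: "\<And>j. j \<in> Q \<Longrightarrow> tail_small T (d ` {t1 j..}) j (\<epsilon> b)" by metis
    \<comment> \<open>The sum is a common upper bound of the finitely many thresholds, and
      \<open>Suc t0\<close> keeps the chosen positions strictly increasing.\<close>
    define t where "t = Suc t0 + (\<Sum>j\<in>Q. t1 j)"
    have "tail_small T (d ` {t..}) j (\<epsilon> b)" if "j \<in> Q" for j
    proof (rule tail_small_mono[OF t1[OF that]])
      have "t1 j \<le> t" using member_le_sum[of j Q t1] that Q(1) by (simp add: t_def)
      then show "d ` {t..} \<subseteq> d ` {t1 j..}" by auto
    qed simp
    moreover obtain \<sigma> \<mu> where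
      "\<And>l. l \<in> I \<Longrightarrow> inj_on (\<sigma> l) {..<b}" "\<And>l s. l \<in> I \<Longrightarrow> blk (\<sigma> l s) = d t" "norm \<mu> \<le> K"
      "\<And>v. v \<in> cube b \<Longrightarrow> norm (T (unit (grid \<sigma> v)) (grid \<sigma> v) - \<mu>) \<le> \<epsilon> b"
      "\<And>v v'. v \<in> cube b \<Longrightarrow> v' \<in> cube b \<Longrightarrow> v \<noteq> v' \<Longrightarrow> norm (T (unit (grid \<sigma> v')) (grid \<sigma> v)) \<le> \<epsilon> b"
      "\<And>v j. v \<in> cube b \<Longrightarrow> j \<in> Q \<Longrightarrow> norm (T (unit j) (grid \<sigma> v)) \<le> \<epsilon> b"
      by (rule good_subgrid[OF T K Q \<epsilon>[of b], where n = b and m = "d t"]) (assumption | rule that)+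
    ultimately have "good b (Q, t, \<sigma>, \<mu>)" unfolding good_def prod.case using Q by blast
    moreover have "t0 < t" by (simp add: t_def)
    ultimately show ?thesis by blast
  qed
  have "\<exists>f. \<forall>b. good b (f b) \<and> fst (f (Suc b)) = fst (f b) \<union> grid (fst (snd (snd (f b)))) ` cube b \<and>
      fst (snd (f b)) < fst (snd (f (Suc b)))"
  proof (rule dependent_nat_choice)
    show "\<exists>x. good 0 x" using step[of "{}" 0] by blast
    fix x b assume x: "good b x"
    obtain Q t \<sigma> \<mu> where xe: "x = (Q, t, \<sigma>, \<mu>)" by (cases x)
    have "finite (Q \<union> grid \<sigma> ` cube b)" "Q \<union> grid \<sigma> ` cube b \<subseteq> idx"
      using x unfolding good_def xe by auto
    then show "\<exists>y. good (Suc b) y \<and> fst y = fst x \<union> grid (fst (snd (snd x))) ` cube b \<and> fst (snd x) < fst (snd y)"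
      using step[of "Q \<union> grid \<sigma> ` cube b" t "Suc b"] unfolding xe by fastforce
  qed
  then obtain f where f: "\<And>b. good b (f b)"
    and fQ: "\<And>b. fst (f (Suc b)) = fst (f b) \<union> grid (fst (snd (snd (f b)))) ` cube b"
    and ft: "\<And>b. fst (snd (f b)) < fst (snd (f (Suc b)))" by blast
  define Q where "Q b = fst (f b)" for b
  define t where "t b = fst (snd (f b))" for b
  define \<sigma> where "\<sigma> b = fst (snd (snd (f b)))" for b
  define \<mu> where "\<mu> b = snd (snd (snd (f b)))" for b
  have g: "good b (Q b, t b, \<sigma> b, \<mu> b)" for b using f[of b] by (simp add: Q_def t_def \<sigma>_def \<mu>_def)
  have Qb: "grid (\<sigma> b') v' \<in> Q b" if "b' < b" "v' \<in> cube b'" for b b' v'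
    using that(1)
  proof (induction b)
    case (Suc b)
    then show ?case using fQ[of b] that(2) unfolding Q_def \<sigma>_def by (cases "b' = b") auto
  qed simp
  show ?thesis
  proof (rule that[of t \<sigma> \<mu>])
    show "strict_mono t" unfolding t_def using ft by (rule strict_monoI_Suc)
    show "tail_small T (d ` {t b..}) (grid (\<sigma> b') v') (\<epsilon> b)" if "b' < b" "v' \<in> cube b'" for b b' v'
      using g[of b] Qb[OF that] unfolding good_def by simp
    show "norm (T (unit (grid (\<sigma> b') v')) (grid (\<sigma> b) v)) \<le> \<epsilon> b" if "b' < b" "v \<in> cube b" "v' \<in> cube b'" for b b' v v'
      using g[of b] Qb[OF that(1,3)] that(2) unfolding good_def by simp
  qed (use g in \<open>auto simp: good_def\<close>)
qed

text \<open>The expansion of a scattered form into units need not converge in norm, so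
  \<open>T\<close> can be expanded into matrix entries only on a finite part; the remainder is left
  to \<open>tail_small\<close>.\<close>

lemma scatter_split:
  fixes w :: "('k::{real_normed_field, euclidean_space}) blocks"
  assumes pl: "placement m \<tau>"
  shows "scatter \<tau> w = (\<Sum>x\<in>(SIGMA b':{..b}. cube (bsize b')). sc (w x) (unit (grid (\<tau> (fst x)) (snd x))))
    + scatter \<tau> (\<lambda>x. if fst x \<le> b then 0 else w x)"
proof
  fix i
  let ?S = "SIGMA b':{..b}. cube (bsize b')"
  let ?g = "\<lambda>x. grid (\<tau> (fst x)) (snd x)"
  have eq: "(\<Sum>x\<in>?S. sc (w x) (unit (?g x))) i = (\<Sum>x\<in>?S. if i = ?g x then w x else 0)"
    by (auto simp: sum_fun_apply unit_def intro!: sum.cong)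
  show "scatter \<tau> w i = ((\<Sum>x\<in>?S. sc (w x) (unit (?g x))) + scatter \<tau> (\<lambda>x. if fst x \<le> b then 0 else w x)) i"
  proof (cases "\<exists>b0 v0. v0 \<in> cube (bsize b0) \<and> i = grid (\<tau> b0) v0")
    case True
    then obtain b0 v0 where v0: "v0 \<in> cube (bsize b0)" "i = grid (\<tau> b0) v0" by blast
    have "i = ?g x \<longleftrightarrow> x = (b0, v0)" if "x \<in> ?S" for x
      using that placement_inj[OF pl v0(1), of "snd x" "fst x"] unfolding v0(2) by (cases x) auto
    then have "(\<Sum>x\<in>?S. if i = ?g x then w x else 0) = (\<Sum>x\<in>?S. if x = (b0, v0) then w x else 0)"
      by (intro sum.cong) auto
    also have "\<dots> = (if b0 \<le> b then w (b0, v0) else 0)"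
      using v0(1) by (subst sum.delta) auto
    finally have sum: "(\<Sum>x\<in>?S. if i = ?g x then w x else 0) = (if b0 \<le> b then w (b0, v0) else 0)" .
    have "scatter \<tau> u i = u (b0, v0)" for u :: "'k blocks"
      unfolding v0(2) by (rule scatter_grid[OF pl v0(1)])
    then show ?thesis unfolding plus_fun_apply eq sum by simp
  next
    case False
    then have "(\<Sum>x\<in>?S. if i = ?g x then w x else 0) = 0" by (intro sum.neutral) auto
    moreover have "scatter \<tau> u i = 0" for u :: "'k blocks" using False by (intro scatter_eq_0) blast
    ultimately show ?thesis unfolding plus_fun_apply eq by simp
  qed
qed

text \<open>The compressed operator is compared first with the multipliers \<open>\<mu>\<close>,
  then with \<open>\<kappa>\<close>. Against \<open>\<mu>\<close> the errors come from the diagonal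
  entry itself, from finitely many entries in the same and in earlier blocks, and from all later
  blocks through \<open>tail_small\<close>; together they cost C / 8 in norm. A convergent
  subsequence brings the multipliers within 1 / 8 of a single \<open>\<kappa>\<close>, which costs
  another C / 8.\<close>

lemma compression:
  fixes T :: "('k::{real_normed_field, euclidean_space}) arr \<Rightarrow> 'k arr"
  assumes T: "blin bd bd T"
  obtains m \<tau> \<kappa> where "placement m \<tau>"
    and "\<And>w C. bdW w C \<Longrightarrow> bdW (gather \<tau> (T (scatter \<tau> w)) - sc \<kappa> w) (C / 4)"
proof -
  obtain K where K: "0 \<le> K" "\<And>a C. bd a C \<Longrightarrow> bd (T a) (K * C)" using blin_bound[OF T] by blast
  obtain d :: "nat \<Rightarrow> nat" where d: "strict_mono d"
    and tail: "\<And>i \<delta>. i \<in> idx \<Longrightarrow> 0 < \<delta> \<Longrightarrow> \<exists>t0. tail_small T (d ` {t0..}) i \<delta>"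
    using diagonal_tail_small[OF T] by blast
  define N where "N = card I"
  have N: "1 \<le> N" using finite_I I_nonempty by (simp add: N_def Suc_le_eq card_gt_0_iff)
  \<comment> \<open>For a cube in stage b, an entry receives at most
    \<open>real (Suc b) ^ (N + 1)\<close> contributions, and passing from entries to the norm costs
    another \<open>real (Suc b) ^ N\<close>. Collecting the three kinds of error costs a factor 3 N,
    so 24 N leaves 1 / 8.\<close>
  define \<epsilon> where "\<epsilon> b = 1 / (24 * real N * real (Suc b) ^ (2 * N + 1))" for b
  have \<epsilon>pos: "0 < \<epsilon> b" for b using N by (simp add: \<epsilon>_def)
  have \<epsilon>dec: "\<epsilon> (Suc b) \<le> \<epsilon> b" for b
    unfolding \<epsilon>_def using N by (intro divide_left_mono mult_left_mono power_mono) auto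
  obtain t :: "nat \<Rightarrow> nat" and \<sigma> \<mu> where t: "strict_mono t"
    and \<sigma>_inj: "\<And>b l. l \<in> I \<Longrightarrow> inj_on (\<sigma> b l) {..<b}" and \<sigma>_blk: "\<And>b l s. l \<in> I \<Longrightarrow> blk (\<sigma> b l s) = d (t b)"
    and \<mu>: "\<And>b. norm (\<mu> b) \<le> K"
    and diag: "\<And>b v. v \<in> cube b \<Longrightarrow> norm (T (unit (grid (\<sigma> b) v)) (grid (\<sigma> b) v) - \<mu> b) \<le> \<epsilon> b"
    and off: "\<And>b v v'. v \<in> cube b \<Longrightarrow> v' \<in> cube b \<Longrightarrow> v \<noteq> v' \<Longrightarrow> norm (T (unit (grid (\<sigma> b) v')) (grid (\<sigma> b) v)) \<le> \<epsilon> b"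
    and low: "\<And>b b' v v'. b' < b \<Longrightarrow> v \<in> cube b \<Longrightarrow> v' \<in> cube b' \<Longrightarrow> norm (T (unit (grid (\<sigma> b') v')) (grid (\<sigma> b) v)) \<le> \<epsilon> b"
    and up: "\<And>b b' v'. b' < b \<Longrightarrow> v' \<in> cube b' \<Longrightarrow> tail_small T (d ` {t b..}) (grid (\<sigma> b') v') (\<epsilon> b)"
    using greedy_blocks[where T = T and K = K and \<epsilon> = \<epsilon> and d = d, OF T K(2) \<epsilon>pos tail] by blast
  have "bounded (range \<mu>)" using \<mu> by (auto simp: bounded_iff)
  then obtain \<kappa> r where r: "strict_mono r" "(\<mu> \<circ> r) \<longlonglongrightarrow> \<kappa>"
    using bounded_imp_convergent_subsequence by blast
  obtain n0 where n0: "\<And>n. n \<ge> n0 \<Longrightarrow> norm (\<mu> (r n) - \<kappa>) < 1 / 8"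
    using r(2) unfolding LIMSEQ_iff o_def by (metis zero_less_divide_1_iff zero_less_numeral)
  \<comment> \<open>Skipping \<open>n0\<close> terms brings all \<open>\<mu> (\<rho> b)\<close>
    within 1 / 8 of \<open>\<kappa>\<close>. Since \<open>bsize b \<le> b \<le> \<rho> b\<close>,
    the cube of block b fits into the grid of stage \<open>\<rho> b\<close>.\<close>
  define \<rho> where "\<rho> b = r (b + n0)" for b
  have \<rho>: "strict_mono \<rho>" unfolding \<rho>_def using r(1) by (simp add: strict_mono_def)
  have \<rho>_ge: "b \<le> \<rho> b" for b using \<rho> by (rule seq_suble)
  have \<mu>\<kappa>: "norm (\<mu> (\<rho> b) - \<kappa>) \<le> 1 / 8" for b using n0[of "b + n0"] by (simp add: \<rho>_def)
  define m where "m b = d (t (\<rho> b))" for b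
  define \<tau> where "\<tau> b = \<sigma> (\<rho> b)" for b
  have cube_sub: "v \<in> cube (\<rho> b)" if "v \<in> cube (bsize b)" for b v
  proof -
    have "cube (bsize b) \<subseteq> cube (\<rho> b)"
      unfolding cube_def using bsize_le[of b] \<rho>_ge[of b] by (intro PiE_mono) auto
    then show ?thesis using that by blast
  qed
  have pl: "placement m \<tau>"
    unfolding placement_def
  proof (intro conjI allI ballI impI)
    show "inj m" unfolding m_def using d t \<rho> by (auto simp: inj_def strict_mono_eq)
    fix b l assume l: "l \<in> I"
    show "inj_on (\<tau> b l) {..<bsize b}"
      unfolding \<tau>_def by (rule inj_on_subset[OF \<sigma>_inj[OF l]]) (use bsize_le[of b] \<rho>_ge[of b] in auto)
    show "blk (\<tau> b l s) = m b" for s using \<sigma>_blk[OF l] by (simp add: \<tau>_def m_def)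
  qed
  have row: "norm (T (scatter \<tau> w) (grid (\<tau> b) v) - \<mu> (\<rho> b) * w (b, v)) \<le> C / (8 * real (Suc (\<rho> b)) ^ N)"
    if w: "bdW w C" and v: "v \<in> cube (bsize b)" for w C b v
  proof -
    define i where "i = grid (\<tau> b) v"
    define B where "B = \<rho> b"
    let ?S = "SIGMA b':{..b}. cube (bsize b')"
    let ?g = "\<lambda>x. grid (\<tau> (fst x)) (snd x)"
    define w' where "w' = (\<lambda>x. if fst x \<le> b then 0 else w x)"
    have C0: "0 \<le> C" using W.bd_nonneg[OF w] .
    have w': "bdW w' C"
      unfolding bdW_def
    proof (intro conjI allI impI)
      fix b'
      show "bd (\<lambda>i. w' (b', i)) C"
      proof (cases "b' \<le> b")
        case True
        then have "(\<lambda>i. w' (b', i)) = 0" by (auto simp: w'_def)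
        then show ?thesis using V.bd_zero'[OF C0] by (simp only:)
      next
        case False
        then show ?thesis using bdW_block[OF w, of b'] by (simp add: w'_def)
      qed
    qed (use bdW_support[OF w] in \<open>simp add: w'_def\<close>)
    have fin: "finite ?S" by (intro finite_SigmaI) auto
    have bv: "(b, v) \<in> ?S" using v by simp
    define a1 where "a1 = (\<Sum>x\<in>?S. sc (w x) (unit (?g x)))"
    have car1: "car bd a1" unfolding a1_def by (intro V.car_sum fin) simp
    have "T a1 = (\<Sum>x\<in>?S. T (sc (w x) (unit (?g x))))"
      unfolding a1_def by (rule blin_sum[OF V.function_norm_axioms T fin]) simp
    also have "\<dots> = (\<Sum>x\<in>?S. sc (w x) (T (unit (?g x))))"
      by (intro sum.cong refl blin_sc[OF T]) simp
    finally have Ta1: "T a1 i = (\<Sum>x\<in>?S. w x * T (unit (?g x)) i)" by (simp add: sum_fun_apply)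
    have "scatter \<tau> w = a1 + scatter \<tau> w'"
      unfolding a1_def w'_def by (rule scatter_split[OF pl])
    then have "T (scatter \<tau> w) = T a1 + T (scatter \<tau> w')"
      using blin_add[OF T car1 V.carI[OF bd_scatter[OF pl w']]] by simp
    then have "T (scatter \<tau> w) i - \<mu> B * w (b, v) = (\<Sum>x\<in>?S. w x * T (unit (?g x)) i) - \<mu> B * w (b, v) + T (scatter \<tau> w') i"
      by (simp add: Ta1)
    also have "\<dots> = w (b, v) * (T (unit i) i - \<mu> B) + (\<Sum>x\<in>?S - {(b, v)}. w x * T (unit (?g x)) i) + T (scatter \<tau> w') i"
      by (subst sum.remove[OF fin bv]) (simp add: i_def algebra_simps)
    finally have "norm (T (scatter \<tau> w) i - \<mu> B * w (b, v)) =
        norm (w (b, v) * (T (unit i) i - \<mu> B) + (\<Sum>x\<in>?S - {(b, v)}. w x * T (unit (?g x)) i) + T (scatter \<tau> w') i)"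
      by (rule arg_cong)
    also have "\<dots> \<le> C * \<epsilon> B + real (card ?S) * (C * \<epsilon> B) + \<epsilon> B * (real N * C)"
    proof (intro norm_triangle_mono)
      have ent: "norm (w x) \<le> C" for x using W.bd_entry[OF w] .
      show "norm (w (b, v) * (T (unit i) i - \<mu> B)) \<le> C * \<epsilon> B"
        unfolding norm_mult i_def B_def \<tau>_def by (intro mult_mono ent diag cube_sub v C0) auto
      have "norm (\<Sum>x\<in>?S - {(b, v)}. w x * T (unit (?g x)) i) \<le> (\<Sum>x\<in>?S - {(b, v)}. C * \<epsilon> B)"
      proof (rule sum_norm_le)
        fix x assume x: "x \<in> ?S - {(b, v)}"
        obtain b' v' where xe: "x = (b', v')" by (cases x)
        have v': "v' \<in> cube (\<rho> b')" using x xe cube_sub by auto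
        have "norm (T (unit (?g x)) i) \<le> \<epsilon> B"
        proof (cases "b' = b")
          case True
          then show ?thesis unfolding i_def B_def \<tau>_def xe using x xe v' cube_sub[OF v] by (auto intro: off)
        next
          case False
          then have "b' < b" using x xe by auto
          then have "\<rho> b' < \<rho> b" using \<rho> by (simp add: strict_mono_def)
          then show ?thesis unfolding i_def B_def \<tau>_def xe using v' cube_sub[OF v] by (auto intro: low)
        qed
        then show "norm (w x * T (unit (?g x)) i) \<le> C * \<epsilon> B"
          unfolding norm_mult by (intro mult_mono ent C0) auto
      qed
      also have "\<dots> \<le> (\<Sum>x\<in>?S. C * \<epsilon> B)"
        using C0 \<epsilon>pos[of B] fin by (intro sum_mono2) auto
      finally show "norm (\<Sum>x\<in>?S - {(b, v)}. w x * T (unit (?g x)) i) \<le> real (card ?S) * (C * \<epsilon> B)" by simp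
      \<comment> \<open>As \<open>\<rho>\<close> is strictly increasing, the later cubes belong to
        stages from \<open>Suc B\<close> on. The index \<open>i\<close> belongs to stage
        \<open>B\<close>, so its tail bound is available exactly from \<open>Suc B\<close>.\<close>
      have "block_diag (d ` {t (Suc B)..}) (scatter \<tau> w')"
        unfolding block_diag_def
      proof (intro allI impI)
        fix k assume k: "scatter \<tau> w' k \<noteq> 0"
        then obtain b' u where u: "u \<in> cube (bsize b')" "k = grid (\<tau> b') u" using scatter_eq_0 by blast
        then have "w' (b', u) \<noteq> 0" using k scatter_grid[OF pl u(1), of w'] by simp
        then have "b < b'" by (auto simp: w'_def split: if_splits)
        then have "\<rho> b < \<rho> b'" using \<rho> by (simp add: strict_mono_def)
        then have "t (Suc B) \<le> t (\<rho> b')" using t by (simp add: B_def strict_mono_less_eq)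
        then have "m b' \<in> d ` {t (Suc B)..}" unfolding m_def by auto
        then show "k \<in> idx \<and> (\<exists>b\<in>d ` {t (Suc B)..}. \<forall>l\<in>I. blk (k l) = b)"
          using placement_blk[OF pl u(1)] u(2) by auto
      qed
      moreover have "tail_small T (d ` {t (Suc B)..}) i (\<epsilon> (Suc B))"
        unfolding i_def \<tau>_def B_def by (intro up cube_sub v) simp
      ultimately have "norm (T (scatter \<tau> w') i) \<le> \<epsilon> (Suc B) * (real N * C)"
        using bd_scatter[OF pl w'] unfolding tail_small_def N_def by blast
      also have "\<dots> \<le> \<epsilon> B * (real N * C)"
        using \<epsilon>dec C0 by (intro mult_right_mono) auto
      finally show "norm (T (scatter \<tau> w') i) \<le> \<epsilon> B * (real N * C)" .
    qed
    also have "\<dots> = (1 + real (card ?S) + real N) * (C * \<epsilon> B)"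
      by (simp add: algebra_simps del: card_SigmaI)
    also have "\<dots> \<le> (3 * real N * real (Suc B) ^ (N + 1)) * (C * \<epsilon> B)"
    proof (rule mult_right_mono)
      \<comment> \<open>There are b + 1 cubes, at most \<open>Suc B\<close> in number, each with at
        most \<open>Suc B ^ N\<close> entries.\<close>
      have "card ?S = (\<Sum>b'\<le>b. card (cube (bsize b')))" by (simp add: card_SigmaI)
      also have "\<dots> \<le> (\<Sum>b'\<le>b. Suc B ^ N)"
      proof (intro sum_mono)
        fix b' assume "b' \<in> {..b}"
        then have "bsize b' \<le> Suc B" using bsize_le[of b'] \<rho>_ge[of b] by (simp add: B_def)
        then show "card (cube (bsize b')) \<le> Suc B ^ N"
          unfolding card_cube N_def by (rule power_mono) simp
      qed
      also have "\<dots> \<le> Suc B ^ (N + 1)"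
        using \<rho>_ge[of b] by (simp add: B_def)
      finally have 1: "real (card ?S) \<le> real (Suc B) ^ (N + 1)"
        by (metis of_nat_le_iff of_nat_power)
      have 2: "1 \<le> real (Suc B) ^ (N + 1)" by (rule one_le_power) simp
      have arith: "1 + c + n \<le> 3 * n * X" if "c \<le> X" "1 \<le> X" "1 \<le> n" for c n X :: real
      proof -
        have "1 * X \<le> n * X" "n * 1 \<le> n * X"
          using that by (auto intro: mult_right_mono mult_left_mono)
        then show ?thesis using that by linarith
      qed
      show "1 + real (card ?S) + real N \<le> 3 * real N * real (Suc B) ^ (N + 1)"
        by (rule arith[OF 1 2]) (use N in simp)
    qed (use C0 \<epsilon>pos[of B] in simp)
    also have "\<dots> = C / (8 * real (Suc B) ^ N)"
    proof -
      have "real (Suc B) ^ (2 * N + 1) = real (Suc B) ^ (N + 1) * real (Suc B) ^ N"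
        by (simp only: flip: power_add) (simp add: mult_2)
      then have "\<epsilon> B = 1 / (24 * real N * (real (Suc B) ^ (N + 1) * real (Suc B) ^ N))"
        unfolding \<epsilon>_def by (simp only:)
      moreover have "real (Suc B) ^ (N + 1) \<noteq> 0" "real (Suc B) ^ N \<noteq> 0" "real N \<noteq> 0" using N by auto
      ultimately show ?thesis by (simp add: field_simps del: power_Suc of_nat_Suc)
    qed
    finally show ?thesis by (simp add: i_def B_def)
  qed
  have "bdW (gather \<tau> (T (scatter \<tau> w)) - sc \<kappa> w) (C / 4)" if w: "bdW w C" for w C
    unfolding bdW_def
  proof (intro conjI allI impI)
    fix b
    define u where "u v = (if v \<in> cube (bsize b) then T (scatter \<tau> w) (grid (\<tau> b) v) - \<mu> (\<rho> b) * w (b, v) else 0)" for v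
    have C0: "0 \<le> C" using W.bd_nonneg[OF w] .
    have "bd u (real (card (cube (bsize b))) * (C / (8 * real (Suc (\<rho> b)) ^ N)))"
      by (rule bd_finite_support) (use cube_subset_idx row[OF w] C0 in \<open>auto simp: u_def\<close>)
    moreover have "real (card (cube (bsize b))) * (C / (8 * real (Suc (\<rho> b)) ^ N)) \<le> C / 8"
    proof -
      have "bsize b \<le> Suc (\<rho> b)" using bsize_le[of b] \<rho>_ge[of b] by simp
      then have "card (cube (bsize b)) \<le> Suc (\<rho> b) ^ N"
        unfolding card_cube N_def by (rule power_mono) simp
      then have "real (card (cube (bsize b))) \<le> real (Suc (\<rho> b)) ^ N"
        by (metis of_nat_le_iff of_nat_power)
      then have "real (card (cube (bsize b))) * (C / (8 * real (Suc (\<rho> b)) ^ N))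
          \<le> real (Suc (\<rho> b)) ^ N * (C / (8 * real (Suc (\<rho> b)) ^ N))"
        using C0 by (intro mult_right_mono) auto
      also have "\<dots> = C / 8" by (simp del: of_nat_Suc)
      finally show ?thesis .
    qed
    ultimately have u: "bd u (C / 8)" by (rule V.bd_mono)
    have "bd (sc (\<mu> (\<rho> b) - \<kappa>) (\<lambda>i. w (b, i))) (norm (\<mu> (\<rho> b) - \<kappa>) * C)"
      by (rule V.bd_sc[OF bdW_block[OF w]])
    moreover have "norm (\<mu> (\<rho> b) - \<kappa>) * C \<le> C / 8"
      using mult_right_mono[OF \<mu>\<kappa> C0] by simp
    ultimately have "bd (sc (\<mu> (\<rho> b) - \<kappa>) (\<lambda>i. w (b, i))) (C / 8)" by (rule V.bd_mono)
    with u have "bd (u + sc (\<mu> (\<rho> b) - \<kappa>) (\<lambda>i. w (b, i))) (C / 8 + C / 8)" by (rule V.bd_add)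
    moreover have "(\<lambda>i. (gather \<tau> (T (scatter \<tau> w)) - sc \<kappa> w) (b, i)) = u + sc (\<mu> (\<rho> b) - \<kappa>) (\<lambda>i. w (b, i))"
      using bdW_support[OF w] by (auto simp: fun_eq_iff u_def gather_def algebra_simps)
    ultimately show "bd (\<lambda>i. (gather \<tau> (T (scatter \<tau> w)) - sc \<kappa> w) (b, i)) (C / 4)" by simp
  qed (use bdW_support[OF w] in \<open>simp add: gather_def\<close>)
  then show ?thesis using that pl by blast
qed

text \<open>The compression factors through the range of \<open>P\<close>, so its right inverse
  makes \<open>W\<close> a retract of the range. The range is a retract of \<open>V\<close>, and
  \<open>V\<close> one of \<open>W\<close> by \<open>V_retract_W\<close>; the decomposition method
  therefore identifies \<open>W\<close> both with the range and with \<open>V\<close>.\<close>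

lemma range_iso:
  fixes P :: "('k::{real_normed_field, euclidean_space}) arr \<Rightarrow> 'k arr"
  assumes P: "blin bd bd P" and PP: "\<And>a. car bd a \<Longrightarrow> P (P a) = P a"
    and pl: "placement m \<tau>" and \<kappa>: "1 / 2 \<le> norm \<kappa>"
    and E: "\<And>w C. bdW w C \<Longrightarrow> bdW (gather \<tau> (P (scatter \<tau> w)) - sc \<kappa> w) (C / 4)"
  shows "norm_iso bd (\<lambda>a C. bd a C \<and> P a = a)"
proof -
  let ?Y = "\<lambda>a C. bd a C \<and> P a = a"
  have carY: "car ?Y a \<longleftrightarrow> car bd a \<and> P a = a" for a by (auto simp: car_def)
  have Y: "function_norm ?Y"
  proof
    fix a b C D c
    show "?Y (a + b) (C + D)" if "?Y a C" "?Y b D"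
      using that V.bd_add blin_add[OF P V.carI V.carI] by metis
    show "?Y (sc c a) (norm c * C)" if "?Y a C"
      using that V.bd_sc blin_sc[OF P V.carI] by metis
  qed (use V.bd_entry V.bd_zero V.bd_mono blin_zero[OF V.function_norm_axioms P] in auto)
  have incl: "blin ?Y bd (\<lambda>a. a)"
    by (rule blinI[where K = 1]) auto
  have P_Y: "blin bd ?Y P"
  proof -
    obtain K where "0 \<le> K" "\<And>a C. bd a C \<Longrightarrow> bd (P a) (K * C)" using blin_bound[OF P] by blast
    then show ?thesis
      by (intro blinI[where K = K]) (use blin_add[OF P] blin_sc[OF P] PP[OF V.carI] carY in auto)
  qed
  have "blin bdW bdW (\<lambda>w. gather \<tau> (P (scatter \<tau> w)))"
    by (rule blin_comp[OF blin_comp[OF blin_scatter[OF pl] P] blin_gather[OF pl]])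
  then obtain G where G: "blin bdW bdW G" "\<And>w. car bdW w \<Longrightarrow> gather \<tau> (P (scatter \<tau> (G w))) = w"
    using W.bounded_right_inverse[OF _ \<kappa> E] by blast
  have WY: "norm_retract (bdW :: _ \<Rightarrow> _ \<Rightarrow> bool) ?Y"
    unfolding norm_retract_def
    using blin_comp[OF G(1) blin_comp[OF blin_scatter[OF pl] P_Y]] blin_comp[OF incl blin_gather[OF pl]] G(2)
    by blast
  have YV: "norm_retract ?Y bd"
    unfolding norm_retract_def using incl P_Y carY by blast
  have WV: "norm_retract (bdW :: _ \<Rightarrow> _ \<Rightarrow> bool) (bd :: (_ \<Rightarrow> 'k) \<Rightarrow> _ \<Rightarrow> bool)"
    by (rule norm_retract_trans[OF WY YV])
  obtain f :: "nat \<times> nat \<times> (nat \<Rightarrow> nat) \<Rightarrow> nat \<times> (nat \<Rightarrow> nat)" where f: "bij f"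
    "\<And>w :: 'k blocks. \<And>C. bdW w C \<longleftrightarrow> (\<forall>n. bdW (\<lambda>x. w (f (n, x))) C)"
    using W_reindex by blast
  have "norm_iso (bdW :: (_ \<Rightarrow> 'k) \<Rightarrow> _ \<Rightarrow> bool) ?Y"
    by (rule pelczynski_decomposition[OF W.function_norm_axioms Y f norm_retract_trans[OF YV V_retract_W] WY])
  moreover have "norm_iso (bdW :: (_ \<Rightarrow> 'k) \<Rightarrow> _ \<Rightarrow> bool) bd"
    by (rule pelczynski_decomposition[OF W.function_norm_axioms V.function_norm_axioms f V_retract_W WV])
  ultimately show ?thesis using norm_iso_sym norm_iso_trans by blast
qed

text \<open>The compressions of \<open>P\<close> and of the complementary projection approximate
  \<kappa> and 1 - \<kappa>, and one of these has norm at least 1/2.\<close>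

lemma primary_forms:
  fixes P :: "('k::{real_normed_field, euclidean_space}) arr \<Rightarrow> 'k arr"
  assumes P: "blin bd bd P" and PP: "\<And>a. car bd a \<Longrightarrow> P (P a) = P a"
  shows "norm_iso bd (\<lambda>a C. bd a C \<and> P a = a) \<or> norm_iso bd (\<lambda>a C. bd a C \<and> P a = 0)"
proof -
  obtain m \<tau> \<kappa> where pl: "placement m \<tau>"
    and E: "\<And>w C. bdW w C \<Longrightarrow> bdW (gather \<tau> (P (scatter \<tau> w)) - sc \<kappa> w) (C / 4)"
    using compression[OF P] by blast
  show ?thesis
  proof (cases "1 / 2 \<le> norm \<kappa>")
    case True
    then show ?thesis using range_iso[OF P PP pl True E] by blast
  next
    case False
    have "norm (1 :: 'k) \<le> norm (1 - \<kappa>) + norm \<kappa>" using norm_triangle_ineq[of "1 - \<kappa>" \<kappa>] by simp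
    then have \<kappa>: "1 / 2 \<le> norm (1 - \<kappa>)" using False by simp
    let ?P = "\<lambda>a. a - P a"
    have "norm_iso bd (\<lambda>a C. bd a C \<and> ?P a = a)"
    proof (rule range_iso[OF _ _ pl \<kappa>])
      show "blin bd bd ?P" by (rule blin_minus[OF V.function_norm_axioms blin_id P])
      show "?P (?P a) = ?P a" if "car bd a" for a
        using blin_diff[OF V.function_norm_axioms P that blin_car[OF P that]] PP[OF that] by simp
      fix w :: "'k blocks" and C assume w: "bdW w C"
      have gP: "gather \<tau> (?P (scatter \<tau> w)) = gather \<tau> (scatter \<tau> w) - gather \<tau> (P (scatter \<tau> w))"
        by (auto simp: gather_def fun_eq_iff)
      \<comment> \<open>Since \<open>gather\<close> undoes \<open>scatter\<close>, the complementary
        projection has the same error with the opposite sign.\<close>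
      have eq: "gather \<tau> (?P (scatter \<tau> w)) - sc (1 - \<kappa>) w = - (gather \<tau> (P (scatter \<tau> w)) - sc \<kappa> w)"
        unfolding gP gather_scatter[OF pl W.carI[OF w]] by (simp add: fun_eq_iff algebra_simps)
      show "bdW (gather \<tau> (?P (scatter \<tau> w)) - sc (1 - \<kappa>) w) (C / 4)"
        unfolding eq by (rule W.bd_minus[OF E[OF w]])
    qed
    moreover have "(\<lambda>a C. bd a C \<and> ?P a = a) = (\<lambda>a C. bd a C \<and> P a = 0)"
    proof (intro ext)
      have "?P a = a \<longleftrightarrow> P a = 0" for a by (simp add: fun_eq_iff)
      then show "(bd a C \<and> ?P a = a) = (bd a C \<and> P a = 0)" for a C by (simp only:)
    qed
    ultimately show ?thesis by (simp only: simp_thms)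
  qed
qed

end

section \<open>Completions and their duals\<close>

text \<open>The norm need not be definite, because the completion divides out its kernel.\<close>

locale function_seminorm =
  fixes A :: "('k::{real_normed_field, euclidean_space}, 's \<Rightarrow> 'k) nspace" and S :: "'s set"
  assumes zero_eq: "vzero A = (\<lambda>s\<in>S. 0)"
    and add_eq: "\<And>u v. vadd A u v = (\<lambda>s\<in>S. u s + v s)"
    and scale_eq: "\<And>c u. vscale A c u = (\<lambda>s\<in>S. c * u s)"
    and carrier_ext: "\<And>u. u \<in> vcarrier A \<Longrightarrow> u \<in> extensional S"
    and zero_in: "vzero A \<in> vcarrier A"
    and add_in: "\<And>u v. u \<in> vcarrier A \<Longrightarrow> v \<in> vcarrier A \<Longrightarrow> vadd A u v \<in> vcarrier A"
    and scale_in: "\<And>c u. u \<in> vcarrier A \<Longrightarrow> vscale A c u \<in> vcarrier A"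
    and norm_zero: "vnorm A (vzero A) = 0"
    and norm_ge_0: "\<And>u. u \<in> vcarrier A \<Longrightarrow> 0 \<le> vnorm A u"
    and norm_scale_eq: "\<And>c u. u \<in> vcarrier A \<Longrightarrow> vnorm A (vscale A c u) = norm c * vnorm A u"
    and norm_add_le: "\<And>u v. u \<in> vcarrier A \<Longrightarrow> v \<in> vcarrier A \<Longrightarrow> vnorm A (vadd A u v) \<le> vnorm A u + vnorm A v"
begin

definition dis :: "('s \<Rightarrow> 'k) \<Rightarrow> ('s \<Rightarrow> 'k) \<Rightarrow> real" where
  "dis u v = vnorm A (vdiff A u v)"

lemma diff_eq: "vdiff A u v = (\<lambda>s\<in>S. u s - v s)"
  by (auto simp: vdiff_def add_eq scale_eq fun_eq_iff)

lemma diff_in: "u \<in> vcarrier A \<Longrightarrow> v \<in> vcarrier A \<Longrightarrow> vdiff A u v \<in> vcarrier A"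
  by (simp add: vdiff_def add_in scale_in)

lemma dis_nonneg: "u \<in> vcarrier A \<Longrightarrow> v \<in> vcarrier A \<Longrightarrow> 0 \<le> dis u v"
  by (simp add: dis_def norm_ge_0 diff_in)

lemma dis_self: "dis u u = 0"
proof -
  have "vdiff A u u = vzero A" by (auto simp: diff_eq zero_eq fun_eq_iff)
  then show ?thesis by (simp add: dis_def norm_zero)
qed

lemma dis_commute:
  assumes "u \<in> vcarrier A" "v \<in> vcarrier A"
  shows "dis u v = dis v u"
proof -
  have "vdiff A u v = vscale A (- 1) (vdiff A v u)" by (auto simp: diff_eq scale_eq fun_eq_iff)
  then show ?thesis by (simp add: dis_def norm_scale_eq diff_in assms)
qed

lemma dis_triangle:
  assumes "u \<in> vcarrier A" "v \<in> vcarrier A" "w \<in> vcarrier A"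
  shows "dis u w \<le> dis u v + dis v w"
proof -
  have "vdiff A u w = vadd A (vdiff A u v) (vdiff A v w)" by (auto simp: diff_eq add_eq fun_eq_iff)
  then show ?thesis using norm_add_le diff_in assms by (simp add: dis_def)
qed

lemma dis_add:
  assumes "u \<in> vcarrier A" "v \<in> vcarrier A" "u' \<in> vcarrier A" "v' \<in> vcarrier A"
  shows "dis (vadd A u v) (vadd A u' v') \<le> dis u u' + dis v v'"
proof -
  have "vdiff A (vadd A u v) (vadd A u' v') = vadd A (vdiff A u u') (vdiff A v v')"
    by (auto simp: diff_eq add_eq fun_eq_iff)
  then show ?thesis using norm_add_le diff_in assms by (simp add: dis_def)
qed

lemma dis_scale:
  assumes "u \<in> vcarrier A" "v \<in> vcarrier A"
  shows "dis (vscale A c u) (vscale A c v) = norm c * dis u v"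
proof -
  have "vdiff A (vscale A c u) (vscale A c v) = vscale A c (vdiff A u v)"
    by (auto simp: diff_eq scale_eq fun_eq_iff right_diff_distrib)
  then show ?thesis by (simp add: dis_def norm_scale_eq diff_in assms)
qed

lemma norm_diff_le_dis:
  assumes "u \<in> vcarrier A" "v \<in> vcarrier A"
  shows "\<bar>vnorm A u - vnorm A v\<bar> \<le> dis u v"
proof -
  have *: "vnorm A u \<le> vnorm A v + dis u v" if "u \<in> vcarrier A" "v \<in> vcarrier A" for u v
  proof -
    have "u = vadd A v (vdiff A u v)"
      using carrier_ext[OF that(1)] by (auto simp: diff_eq add_eq fun_eq_iff extensional_def)
    then have "vnorm A u = vnorm A (vadd A v (vdiff A u v))" by simp
    also have "\<dots> \<le> vnorm A v + dis u v"
      using norm_add_le[OF that(2) diff_in[OF that]] by (simp add: dis_def)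
    finally show ?thesis .
  qed
  show ?thesis using *[OF assms] *[OF assms(2,1)] dis_commute[OF assms] by simp
qed

abbreviation "CS \<equiv> cauchy_seqs A"
abbreviation "cnorm \<equiv> vnorm (completion A)"
abbreviation "dual \<equiv> dual_space (completion A)"

definition cls :: "(nat \<Rightarrow> 's \<Rightarrow> 'k) \<Rightarrow> (nat \<Rightarrow> 's \<Rightarrow> 'k) set" where
  "cls s = null_rel A `` {s}"

lemma CS_iff: "s \<in> CS \<longleftrightarrow> (\<forall>n. s n \<in> vcarrier A) \<and> (\<forall>e>0. \<exists>M. \<forall>m\<ge>M. \<forall>n\<ge>M. dis (s m) (s n) < e)"
  by (simp add: cauchy_seqs_def dis_def)

lemma CS_in: "s \<in> CS \<Longrightarrow> s n \<in> vcarrier A"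
  by (simp add: CS_iff)

lemma null_rel_iff: "(s, t) \<in> null_rel A \<longleftrightarrow> s \<in> CS \<and> t \<in> CS \<and> (\<lambda>n. dis (s n) (t n)) \<longlonglongrightarrow> 0"
  by (simp add: null_rel_def dis_def)

lemma dis_tendsto_0:
  assumes "\<And>n. 0 \<le> f n" "\<And>n. f n \<le> g n" "g \<longlonglongrightarrow> (0::real)"
  shows "f \<longlonglongrightarrow> 0"
  by (rule real_tendsto_sandwich[OF _ _ tendsto_const assms(3)]) (use assms in auto)

lemma equiv_null_rel: "equiv CS (null_rel A)"
proof (rule equivI)
  show "null_rel A \<subseteq> CS \<times> CS" by (auto simp: null_rel_def)
  show "refl_on CS (null_rel A)" by (auto simp: refl_on_def null_rel_iff dis_self)
  show "sym (null_rel A)"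
    by (rule symI) (auto simp: null_rel_iff dis_commute CS_in)
  show "trans (null_rel A)"
  proof (rule transI)
    fix s t u assume "(s, t) \<in> null_rel A" "(t, u) \<in> null_rel A"
    then have *: "s \<in> CS" "t \<in> CS" "u \<in> CS" "(\<lambda>n. dis (s n) (t n) + dis (t n) (u n)) \<longlonglongrightarrow> 0"
      by (auto simp: null_rel_iff intro: tendsto_add_zero)
    then have "(\<lambda>n. dis (s n) (u n)) \<longlonglongrightarrow> 0"
      by (intro dis_tendsto_0[OF _ _ *(4)]) (auto simp: dis_nonneg dis_triangle CS_in)
    then show "(s, u) \<in> null_rel A" using * by (simp add: null_rel_iff)
  qed
qed

lemma cls_eq_iff: "s \<in> CS \<Longrightarrow> t \<in> CS \<Longrightarrow> cls s = cls t \<longleftrightarrow> (\<lambda>n. dis (s n) (t n)) \<longlonglongrightarrow> 0"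
  unfolding cls_def using eq_equiv_class_iff[OF equiv_null_rel] by (simp add: null_rel_iff)

lemma mem_cls_iff: "s \<in> CS \<Longrightarrow> t \<in> cls s \<longleftrightarrow> t \<in> CS \<and> (\<lambda>n. dis (s n) (t n)) \<longlonglongrightarrow> 0"
  by (auto simp: cls_def null_rel_iff)

lemma self_in_cls: "s \<in> CS \<Longrightarrow> s \<in> cls s"
  by (simp add: mem_cls_iff dis_self)

lemma carrier_completion: "vcarrier (completion A) = cls ` CS"
  by (auto simp: completion_def quotient_def cls_def)

lemma CS_add: "s \<in> CS \<Longrightarrow> t \<in> CS \<Longrightarrow> (\<lambda>n. vadd A (s n) (t n)) \<in> CS"
  unfolding CS_iff
proof (intro conjI allI impI)
  fix e :: real assume s: "(\<forall>n. s n \<in> vcarrier A) \<and> (\<forall>e>0. \<exists>M. \<forall>m\<ge>M. \<forall>n\<ge>M. dis (s m) (s n) < e)"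
    and t: "(\<forall>n. t n \<in> vcarrier A) \<and> (\<forall>e>0. \<exists>M. \<forall>m\<ge>M. \<forall>n\<ge>M. dis (t m) (t n) < e)" and "0 < e"
  then obtain M1 M2 where "\<And>m n. m \<ge> M1 \<Longrightarrow> n \<ge> M1 \<Longrightarrow> dis (s m) (s n) < e / 2"
    "\<And>m n. m \<ge> M2 \<Longrightarrow> n \<ge> M2 \<Longrightarrow> dis (t m) (t n) < e / 2" by (meson half_gt_zero)
  then have le: "dis (s m) (s n) < e / 2" "dis (t m) (t n) < e / 2" if "m \<ge> max M1 M2" "n \<ge> max M1 M2" for m n
    using that by auto
  have "dis (vadd A (s m) (t m)) (vadd A (s n) (t n)) < e" if "m \<ge> max M1 M2" "n \<ge> max M1 M2" for m n
  proof -
    have "dis (vadd A (s m) (t m)) (vadd A (s n) (t n)) \<le> dis (s m) (s n) + dis (t m) (t n)"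
      using s t by (intro dis_add) auto
    then show ?thesis using le[OF that] by linarith
  qed
  then show "\<exists>M. \<forall>m\<ge>M. \<forall>n\<ge>M. dis (vadd A (s m) (t m)) (vadd A (s n) (t n)) < e" by blast
qed (auto intro: add_in)

lemma CS_scale: "s \<in> CS \<Longrightarrow> (\<lambda>n. vscale A c (s n)) \<in> CS"
  unfolding CS_iff
proof (intro conjI allI impI)
  fix e :: real assume s: "(\<forall>n. s n \<in> vcarrier A) \<and> (\<forall>e>0. \<exists>M. \<forall>m\<ge>M. \<forall>n\<ge>M. dis (s m) (s n) < e)" and "0 < e"
  then have "0 < e / (norm c + 1)" by (simp add: add_nonneg_pos)
  then obtain M where M: "\<And>m n. m \<ge> M \<Longrightarrow> n \<ge> M \<Longrightarrow> dis (s m) (s n) < e / (norm c + 1)" using s by meson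
  have "dis (vscale A c (s m)) (vscale A c (s n)) < e" if "m \<ge> M" "n \<ge> M" for m n
  proof -
    have "norm c * dis (s m) (s n) \<le> (norm c + 1) * dis (s m) (s n)"
      using s dis_nonneg by (intro mult_right_mono) auto
    also have "\<dots> < e"
      using M[OF that] by (simp add: add_nonneg_pos pos_less_divide_eq mult.commute)
    finally show ?thesis using s by (simp add: dis_scale)
  qed
  then show "\<exists>M. \<forall>m\<ge>M. \<forall>n\<ge>M. dis (vscale A c (s m)) (vscale A c (s n)) < e" by blast
qed (auto intro: scale_in)

lemma CS_const: "u \<in> vcarrier A \<Longrightarrow> (\<lambda>_. u) \<in> CS"
  by (auto simp: CS_iff dis_self)

lemma add_cls:
  assumes "s \<in> CS" "t \<in> CS"
  shows "vadd (completion A) (cls s) (cls t) = cls (\<lambda>n. vadd A (s n) (t n))"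
proof -
  have "cls (\<lambda>n. vadd A (s' n) (t' n)) = cls (\<lambda>n. vadd A (s n) (t n))" if "s' \<in> cls s" "t' \<in> cls t" for s' t'
  proof -
    have *: "s' \<in> CS" "t' \<in> CS" "(\<lambda>n. dis (s n) (s' n) + dis (t n) (t' n)) \<longlonglongrightarrow> 0"
      using that assms by (auto simp: mem_cls_iff intro: tendsto_add_zero)
    then have "(\<lambda>n. dis (vadd A (s n) (t n)) (vadd A (s' n) (t' n))) \<longlonglongrightarrow> 0"
      using assms by (intro dis_tendsto_0[OF _ _ *(3)]) (auto simp: dis_nonneg dis_add CS_in add_in)
    then show ?thesis using * assms cls_eq_iff CS_add by metis
  qed
  then have "vadd (completion A) (cls s) (cls t) = (\<Union>s'\<in>cls s. \<Union>t'\<in>cls t. cls (\<lambda>n. vadd A (s n) (t n)))"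
    unfolding completion_def by (simp flip: cls_def)
  also have "\<dots> = cls (\<lambda>n. vadd A (s n) (t n))"
    using self_in_cls[OF assms(1)] self_in_cls[OF assms(2)] by auto
  finally show ?thesis .
qed

lemma scale_cls:
  assumes "s \<in> CS"
  shows "vscale (completion A) c (cls s) = cls (\<lambda>n. vscale A c (s n))"
proof -
  have "cls (\<lambda>n. vscale A c (s' n)) = cls (\<lambda>n. vscale A c (s n))" if "s' \<in> cls s" for s'
  proof -
    have s': "s' \<in> CS" "(\<lambda>n. dis (s n) (s' n)) \<longlonglongrightarrow> 0"
      using that assms by (auto simp: mem_cls_iff)
    note * = s'(1) tendsto_mult_right_zero[OF s'(2), of "norm c"]
    then have "(\<lambda>n. dis (vscale A c (s n)) (vscale A c (s' n))) \<longlonglongrightarrow> 0"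
      using assms by (simp add: dis_scale CS_in)
    then show ?thesis using * assms cls_eq_iff CS_scale by metis
  qed
  then have "vscale (completion A) c (cls s) = (\<Union>s'\<in>cls s. cls (\<lambda>n. vscale A c (s n)))"
    unfolding completion_def by (simp flip: cls_def)
  also have "\<dots> = cls (\<lambda>n. vscale A c (s n))"
    using self_in_cls[OF assms(1)] by auto
  finally show ?thesis .
qed

text \<open>The norm of a class is defined through one chosen representative; any other
  representative differs from it by a null sequence.\<close>

lemma norm_cls:
  assumes "s \<in> CS"
  shows "(\<lambda>n. vnorm A (s n)) \<longlonglongrightarrow> cnorm (cls s)"
proof -
  define s' where "s' = (SOME t. t \<in> cls s)"
  have "s' \<in> cls s" unfolding s'_def by (rule someI[of "\<lambda>t. t \<in> cls s" s]) (rule self_in_cls[OF assms])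
  then have s': "s' \<in> CS" "(\<lambda>n. dis (s n) (s' n)) \<longlonglongrightarrow> 0" using assms by (auto simp: mem_cls_iff)
  have "Cauchy (\<lambda>n. vnorm A (s' n))"
    unfolding Cauchy_def dist_real_def
  proof (intro allI impI)
    fix e :: real assume "0 < e"
    then obtain M where M: "\<And>m n. m \<ge> M \<Longrightarrow> n \<ge> M \<Longrightarrow> dis (s' m) (s' n) < e" using s'(1) unfolding CS_iff by meson
    then show "\<exists>M. \<forall>m\<ge>M. \<forall>n\<ge>M. \<bar>vnorm A (s' m) - vnorm A (s' n)\<bar> < e"
      using norm_diff_le_dis CS_in[OF s'(1)] order_le_less_trans by blast
  qed
  then have lim: "(\<lambda>n. vnorm A (s' n)) \<longlonglongrightarrow> cnorm (cls s)"
    by (simp add: completion_def convergent_LIMSEQ_iff Cauchy_convergent_iff flip: s'_def)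
  have "(\<lambda>n. \<bar>vnorm A (s n) - vnorm A (s' n)\<bar>) \<longlonglongrightarrow> 0"
    by (rule dis_tendsto_0[OF _ _ s'(2)]) (auto intro: norm_diff_le_dis CS_in assms s'(1))
  then have "(\<lambda>n. vnorm A (s n) - vnorm A (s' n)) \<longlonglongrightarrow> 0" by (simp add: tendsto_rabs_zero_iff)
  from tendsto_add[OF this lim] show ?thesis by simp
qed

lemma norm_cls_const: "u \<in> vcarrier A \<Longrightarrow> cnorm (cls (\<lambda>_. u)) = vnorm A u"
  using norm_cls[OF CS_const] LIMSEQ_unique tendsto_const by blast

lemma norm_cls_nonneg: "s \<in> CS \<Longrightarrow> 0 \<le> cnorm (cls s)"
  by (rule LIMSEQ_le_const[OF norm_cls]) (auto intro: norm_ge_0 CS_in)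

lemma norm_cls_scale:
  assumes "s \<in> CS"
  shows "cnorm (vscale (completion A) c (cls s)) = norm c * cnorm (cls s)"
proof -
  have "(\<lambda>n. vnorm A (vscale A c (s n))) \<longlonglongrightarrow> norm c * cnorm (cls s)"
    using tendsto_mult_left[OF norm_cls[OF assms]] by (simp add: norm_scale_eq CS_in[OF assms])
  then show ?thesis
    unfolding scale_cls[OF assms] using norm_cls[OF CS_scale[OF assms]] LIMSEQ_unique by blast
qed

definition fun_bound :: "((nat \<Rightarrow> 's \<Rightarrow> 'k) set \<Rightarrow> 'k) \<Rightarrow> real \<Rightarrow> bool" where
  "fun_bound f C \<longleftrightarrow> (\<forall>x\<in>vcarrier (completion A). norm (f x) \<le> C * cnorm x)"

lemma dual_carrier_iff:
  "f \<in> vcarrier dual \<longleftrightarrow> f \<in> extensional (cls ` CS) \<and>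
    (\<forall>s\<in>CS. \<forall>t\<in>CS. f (cls (\<lambda>n. vadd A (s n) (t n))) = f (cls s) + f (cls t)) \<and>
    (\<forall>c. \<forall>s\<in>CS. f (cls (\<lambda>n. vscale A c (s n))) = c * f (cls s)) \<and> (\<exists>C. fun_bound f C)"
  by (simp add: dual_space_def linear_between_def scalar_space_def fun_bound_def carrier_completion
      add_cls scale_cls)

lemma dual_add:
  assumes "f \<in> vcarrier dual" "s \<in> CS" "t \<in> CS"
  shows "f (cls (\<lambda>n. vadd A (s n) (t n))) = f (cls s) + f (cls t)"
  using assms by (simp add: dual_carrier_iff)

lemma dual_scale:
  assumes "f \<in> vcarrier dual" "s \<in> CS"
  shows "f (cls (\<lambda>n. vscale A c (s n))) = c * f (cls s)"
  using assms by (simp add: dual_carrier_iff)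

definition ev :: "((nat \<Rightarrow> 's \<Rightarrow> 'k) set \<Rightarrow> 'k) \<Rightarrow> ('s \<Rightarrow> 'k) \<Rightarrow> 'k" where
  "ev f u = f (cls (\<lambda>_. u))"

lemma ev_add:
  assumes "f \<in> vcarrier dual" "u \<in> vcarrier A" "v \<in> vcarrier A"
  shows "ev f (vadd A u v) = ev f u + ev f v"
  unfolding ev_def using dual_add[OF assms(1) CS_const[OF assms(2)] CS_const[OF assms(3)]] .

lemma ev_scale:
  assumes "f \<in> vcarrier dual" "u \<in> vcarrier A"
  shows "ev f (vscale A c u) = c * ev f u"
  unfolding ev_def using dual_scale[OF assms(1) CS_const[OF assms(2)]] .

lemma ev_bound:
  assumes "fun_bound f C" "u \<in> vcarrier A"
  shows "norm (ev f u) \<le> C * vnorm A u"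
  using assms CS_const norm_cls_const[OF assms(2)] unfolding ev_def fun_bound_def carrier_completion by fastforce

text \<open>The constant sequences with values \<open>s n\<close> approximate the class of
  \<open>s\<close>, so a bounded functional is determined by its values on the dense image of
  \<open>A\<close>.\<close>

lemma ev_tendsto:
  assumes f: "f \<in> vcarrier dual" and s: "s \<in> CS"
  shows "(\<lambda>n. ev f (s n)) \<longlonglongrightarrow> f (cls s)"
proof -
  obtain C where C: "fun_bound f C" using f unfolding dual_carrier_iff by blast
  \<comment> \<open>A strictly positive bound, because it serves as a divisor below.\<close>
  define C' where "C' = max C 1"
  have C': "0 < C'" "fun_bound f C'"
  proof -
    show "fun_bound f C'"
      unfolding fun_bound_def carrier_completion
    proof
      fix x assume "x \<in> cls ` CS"
      then obtain t where t: "t \<in> CS" "x = cls t" by blast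
      have "norm (f x) \<le> C * cnorm x"
        using C t unfolding fun_bound_def carrier_completion by blast
      also have "\<dots> \<le> C' * cnorm x"
        using norm_cls_nonneg[OF t(1)] t(2) by (intro mult_right_mono) (auto simp: C'_def)
      finally show "norm (f x) \<le> C' * cnorm x" .
    qed
  qed (simp add: C'_def)
  show ?thesis
    unfolding LIMSEQ_iff
  proof (intro allI impI)
    fix e :: real assume e: "0 < e"
    then have "0 < e / (2 * C')" using C' by simp
    then obtain M where M: "\<And>m n. m \<ge> M \<Longrightarrow> n \<ge> M \<Longrightarrow> dis (s m) (s n) < e / (2 * C')"
      using s unfolding CS_iff by meson
    have "norm (ev f (s n) - f (cls s)) < e" if n: "n \<ge> M" for n
    proof -
      let ?d = "\<lambda>m. vadd A (s n) (vscale A (- 1) (s m))"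
      have sc: "(\<lambda>m. vscale A (- 1) (s m)) \<in> CS" by (rule CS_scale[OF s])
      have d: "?d \<in> CS" by (rule CS_add[OF CS_const[OF CS_in[OF s]] sc])
      have "f (cls ?d) = f (cls (\<lambda>_. s n)) + f (cls (\<lambda>m. vscale A (- 1) (s m)))"
        using dual_add[OF f CS_const[OF CS_in[OF s, of n]] sc] .
      also have "f (cls (\<lambda>m. vscale A (- 1) (s m))) = - 1 * f (cls s)"
        by (rule dual_scale[OF f s])
      finally have "ev f (s n) - f (cls s) = f (cls ?d)" by (simp add: ev_def)
      also have "norm \<dots> \<le> C' * cnorm (cls ?d)"
        using C' d unfolding fun_bound_def carrier_completion by blast
      also have "cnorm (cls ?d) \<le> e / (2 * C')"
      proof (rule LIMSEQ_le_const2[OF norm_cls[OF d]])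
        show "\<exists>N. \<forall>m\<ge>N. vnorm A (?d m) \<le> e / (2 * C')"
          using M[OF n] by (intro exI[of _ M]) (auto simp: dis_def vdiff_def less_imp_le)
      qed
      finally show ?thesis using C' e by (simp add: mult_left_mono)
    qed
    then show "\<exists>M. \<forall>n\<ge>M. norm (ev f (s n) - f (cls s)) < e" by blast
  qed
qed

text \<open>A bounded functional maps Cauchy sequences to Cauchy sequences and equivalent ones to
  sequences with the same limit; the bound passes to the limit unchanged.\<close>

lemma functional_extend:
  assumes add: "\<And>u v. u \<in> vcarrier A \<Longrightarrow> v \<in> vcarrier A \<Longrightarrow> g (vadd A u v) = g u + g v"
    and scale: "\<And>c u. u \<in> vcarrier A \<Longrightarrow> g (vscale A c u) = c * g u"
    and bound: "\<And>u. u \<in> vcarrier A \<Longrightarrow> norm (g u) \<le> C * vnorm A u" and C: "0 \<le> C"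
  obtains f where "f \<in> vcarrier dual" "fun_bound f C"
    "\<And>u. u \<in> vcarrier A \<Longrightarrow> ev f u = g u"
proof -
  have g_diff: "norm (g u - g v) \<le> C * dis u v" if "u \<in> vcarrier A" "v \<in> vcarrier A" for u v
  proof -
    have "g (vdiff A u v) = g u - g v"
      unfolding vdiff_def using that by (simp add: add scale scale_in)
    then show ?thesis using bound[OF diff_in[OF that]] by (simp add: dis_def)
  qed
  have conv: "convergent (\<lambda>n. g (s n))" if s: "s \<in> CS" for s
  proof (rule Cauchy_convergent)
    show "Cauchy (\<lambda>n. g (s n))"
      unfolding Cauchy_def dist_norm
    proof (intro allI impI)
      fix e :: real assume "0 < e"
      then have "0 < e / (C + 1)" using C by simp
      then obtain M where M: "\<And>m n. m \<ge> M \<Longrightarrow> n \<ge> M \<Longrightarrow> dis (s m) (s n) < e / (C + 1)"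
        using s unfolding CS_iff by meson
      have "norm (g (s m) - g (s n)) < e" if "m \<ge> M" "n \<ge> M" for m n
      proof -
        have "norm (g (s m) - g (s n)) \<le> C * dis (s m) (s n)"
          by (intro g_diff CS_in s)
        also have "\<dots> \<le> (C + 1) * dis (s m) (s n)"
          by (intro mult_right_mono dis_nonneg CS_in s) simp
        also have "\<dots> < e" using M[OF that] C by (simp add: pos_less_divide_eq mult.commute)
        finally show ?thesis .
      qed
      then show "\<exists>M. \<forall>m\<ge>M. \<forall>n\<ge>M. norm (g (s m) - g (s n)) < e" by blast
    qed
  qed
  define f where "f = (\<lambda>x\<in>cls ` CS. lim (\<lambda>n. g ((SOME s. s \<in> x) n)))"
  have f: "(\<lambda>n. g (s n)) \<longlonglongrightarrow> f (cls s)" if s: "s \<in> CS" for s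
  proof -
    define s' where "s' = (SOME t. t \<in> cls s)"
    have "s' \<in> cls s" unfolding s'_def by (rule someI[of "\<lambda>t. t \<in> cls s" s]) (rule self_in_cls[OF s])
    then have s': "s' \<in> CS" "(\<lambda>n. dis (s n) (s' n)) \<longlonglongrightarrow> 0" using s by (auto simp: mem_cls_iff)
    have lim: "(\<lambda>n. g (s' n)) \<longlonglongrightarrow> f (cls s)"
      unfolding f_def using s conv[OF s'(1)] by (simp add: convergent_LIMSEQ_iff flip: s'_def)
    have "(\<lambda>n. C * dis (s n) (s' n)) \<longlonglongrightarrow> 0" by (rule tendsto_mult_right_zero[OF s'(2)])
    then have "(\<lambda>n. norm (g (s n) - g (s' n))) \<longlonglongrightarrow> 0"
      by (rule dis_tendsto_0[rotated 2]) (auto intro: g_diff CS_in s s'(1))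
    then have "(\<lambda>n. g (s n) - g (s' n)) \<longlonglongrightarrow> 0" by (simp add: tendsto_norm_zero_iff)
    from tendsto_add[OF this lim] show ?thesis by simp
  qed
  have bd: "fun_bound f C"
    unfolding fun_bound_def carrier_completion
  proof
    fix x assume "x \<in> cls ` CS"
    then obtain s where s: "s \<in> CS" "x = cls s" by blast
    show "norm (f x) \<le> C * cnorm x"
      unfolding s(2)
      by (rule LIMSEQ_le[OF tendsto_norm[OF f[OF s(1)]] tendsto_mult_left[OF norm_cls[OF s(1)]]])
        (use bound CS_in[OF s(1)] in auto)
  qed
  have "f \<in> vcarrier dual"
    unfolding dual_carrier_iff
  proof (intro conjI ballI allI)
    show "f \<in> extensional (cls ` CS)" by (simp add: f_def)
    show "\<exists>C. fun_bound f C" using bd by blast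
    fix s assume s: "s \<in> CS"
    show "f (cls (\<lambda>n. vscale A c (s n))) = c * f (cls s)" for c
    proof -
      have "(\<lambda>n. c * g (s n)) \<longlonglongrightarrow> f (cls (\<lambda>n. vscale A c (s n)))"
        using f[OF CS_scale[OF s, of c]] by (simp add: scale CS_in[OF s])
      then show ?thesis using tendsto_mult_left[OF f[OF s]] LIMSEQ_unique by blast
    qed
    fix t assume t: "t \<in> CS"
    have "(\<lambda>n. g (s n) + g (t n)) \<longlonglongrightarrow> f (cls (\<lambda>n. vadd A (s n) (t n)))"
      using f[OF CS_add[OF s t]] by (simp add: add CS_in[OF s] CS_in[OF t])
    then show "f (cls (\<lambda>n. vadd A (s n) (t n))) = f (cls s) + f (cls t)"
      using tendsto_add[OF f[OF s] f[OF t]] LIMSEQ_unique by blast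
  qed
  moreover have "ev f u = g u" if "u \<in> vcarrier A" for u
    unfolding ev_def using f[OF CS_const[OF that]] LIMSEQ_unique tendsto_const by blast
  ultimately show ?thesis using that bd by blast
qed

lemma dual_eqI:
  assumes "f \<in> vcarrier dual" "f' \<in> vcarrier dual"
    and "\<And>u. u \<in> vcarrier A \<Longrightarrow> ev f u = ev f' u"
  shows "f = f'"
proof (rule extensionalityI)
  show "f \<in> extensional (cls ` CS)" "f' \<in> extensional (cls ` CS)" using assms unfolding dual_carrier_iff by auto
  fix x assume "x \<in> cls ` CS"
  then obtain s where s: "s \<in> CS" "x = cls s" by blast
  show "f x = f' x"
    unfolding s(2) using ev_tendsto[OF assms(1) s(1)] ev_tendsto[OF assms(2) s(1)] assms(3)[OF CS_in[OF s(1)]]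
    by (simp add: LIMSEQ_unique)
qed

text \<open>The supremum over the unit ball is the least bound. That it bounds the functional
  everywhere follows by scaling to norm one; a class of norm zero cannot be scaled, but any bound
  makes the functional vanish there.\<close>

lemma dual_norm_bound:
  assumes f: "f \<in> vcarrier dual"
  shows "fun_bound f (vnorm dual f)"
    and "0 \<le> vnorm dual f"
    and "fun_bound f C \<Longrightarrow> 0 \<le> C \<Longrightarrow> vnorm dual f \<le> C"
proof -
  let ?B = "{x \<in> vcarrier (completion A). cnorm x \<le> 1}"
  have norm_eq: "vnorm dual f = (SUP x\<in>?B. norm (f x))"
    by (simp add: dual_space_def)
  let ?z = "cls (\<lambda>_. vzero A)"
  have z: "?z \<in> ?B"
    using CS_const[OF zero_in] norm_cls_const[OF zero_in] by (simp add: carrier_completion norm_zero)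
  have le: "norm (f x) \<le> C" if "fun_bound f C" "0 \<le> C" "x \<in> ?B" for x C
  proof -
    have "norm (f x) \<le> C * cnorm x" using that unfolding fun_bound_def by blast
    also have "\<dots> \<le> C * 1" using that by (intro mult_left_mono) auto
    finally show ?thesis by simp
  qed
  show "vnorm dual f \<le> C" if "fun_bound f C" "0 \<le> C" for C
    unfolding norm_eq by (rule cSUP_least) (use z le[OF that] in auto)
  obtain C where "fun_bound f C" using f unfolding dual_carrier_iff by blast
  then have C: "fun_bound f \<bar>C\<bar>" "0 \<le> \<bar>C\<bar>"
    unfolding fun_bound_def carrier_completion
    using norm_cls_nonneg by (force intro: order_trans mult_right_mono)+
  have bdd: "bdd_above ((\<lambda>x. norm (f x)) ` ?B)" using le[OF C] by (auto intro!: bdd_aboveI)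
  have up: "norm (f x) \<le> vnorm dual f" if "x \<in> ?B" for x
    unfolding norm_eq using bdd that by (intro cSUP_upper)
  show nonneg: "0 \<le> vnorm dual f" using up[OF z] norm_ge_zero order_trans by blast
  show "fun_bound f (vnorm dual f)"
    unfolding fun_bound_def carrier_completion
  proof
    fix x assume "x \<in> cls ` CS"
    then obtain s where s: "s \<in> CS" "x = cls s" by blast
    define t where "t = cnorm x"
    have t0: "0 \<le> t" unfolding t_def s(2) by (rule norm_cls_nonneg[OF s(1)])
    have fx: "norm (f x) \<le> \<bar>C\<bar> * t" using C(1) s unfolding fun_bound_def carrier_completion t_def by blast
    show "norm (f x) \<le> vnorm dual f * cnorm x"
    proof (cases "t = 0")
      case True
      then show ?thesis using fx by (simp flip: t_def)
    next
      case False
      let ?y = "vscale (completion A) (of_real (1 / t)) x"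
      have "norm (of_real (1 / t) :: 'k) = 1 / t" unfolding norm_of_real using t0 by simp
      then have "cnorm ?y = 1"
        using norm_cls_scale[OF s(1), of "of_real (1 / t)"] False unfolding s(2)[symmetric] t_def[symmetric] by simp
      moreover have y: "?y = cls (\<lambda>n. vscale A (of_real (1 / t)) (s n))"
        unfolding s(2) by (rule scale_cls[OF s(1)])
      ultimately have "?y \<in> ?B" using CS_scale[OF s(1)] by (auto simp: carrier_completion)
      moreover have "f ?y = of_real (1 / t) * f x"
        unfolding y using dual_scale[OF f s(1)] s(2) by simp
      ultimately have "1 / t * norm (f x) \<le> vnorm dual f"
        using up[of ?y] \<open>norm (of_real (1 / t) :: 'k) = 1 / t\<close> by (simp add: norm_mult del: of_real_divide)
      then show ?thesis using t0 False by (simp add: field_simps flip: t_def)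
    qed
  qed
qed

lemma dual_ops:
  "vzero dual = (\<lambda>x\<in>cls ` CS. 0)"
  "vadd dual f g = (\<lambda>x\<in>cls ` CS. f x + g x)"
  "vscale dual c f = (\<lambda>x\<in>cls ` CS. c * f x)"
  by (simp_all add: dual_space_def carrier_completion)

lemma fun_bound_add:
  assumes "fun_bound f C" "fun_bound g C'"
  shows "fun_bound (\<lambda>x\<in>cls ` CS. f x + g x) (C + C')"
  unfolding fun_bound_def carrier_completion
proof
  fix x assume x: "x \<in> cls ` CS"
  then have "norm (f x) \<le> C * cnorm x" "norm (g x) \<le> C' * cnorm x"
    using assms unfolding fun_bound_def carrier_completion by blast+
  then show "norm ((\<lambda>x\<in>cls ` CS. f x + g x) x) \<le> (C + C') * cnorm x"
    using x norm_triangle_ineq[of "f x" "g x"] by (simp add: distrib_right)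
qed

lemma fun_bound_scale:
  assumes "fun_bound f C"
  shows "fun_bound (\<lambda>x\<in>cls ` CS. c * f x) (norm c * C)"
  unfolding fun_bound_def carrier_completion
proof
  fix x assume x: "x \<in> cls ` CS"
  then have "norm c * norm (f x) \<le> norm c * (C * cnorm x)"
    using assms unfolding fun_bound_def carrier_completion by (intro mult_left_mono) auto
  then show "norm ((\<lambda>x\<in>cls ` CS. c * f x) x) \<le> norm c * C * cnorm x"
    using x by (simp add: norm_mult mult.assoc)
qed

lemma dual_zero_in: "vzero dual \<in> vcarrier dual"
proof -
  have "fun_bound (\<lambda>x\<in>cls ` CS. 0) 0" by (simp add: fun_bound_def carrier_completion)
  then show ?thesis
    unfolding dual_ops dual_carrier_iff using CS_add CS_scale by fastforce
qed

lemma dual_add_in: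
  assumes f: "f \<in> vcarrier dual" and g: "g \<in> vcarrier dual"
  shows "vadd dual f g \<in> vcarrier dual"
proof -
  have "\<exists>C. fun_bound (\<lambda>x\<in>cls ` CS. f x + g x) C"
    using f g fun_bound_add unfolding dual_carrier_iff by blast
  then show ?thesis
    unfolding dual_ops dual_carrier_iff
    using CS_add CS_scale dual_add[OF f] dual_add[OF g] dual_scale[OF f] dual_scale[OF g]
    by (auto simp: distrib_left)
qed

lemma dual_scale_in:
  assumes f: "f \<in> vcarrier dual"
  shows "vscale dual c f \<in> vcarrier dual"
proof -
  have "\<exists>C. fun_bound (\<lambda>x\<in>cls ` CS. c * f x) C"
    using f fun_bound_scale unfolding dual_carrier_iff by blast
  then show ?thesis
    unfolding dual_ops dual_carrier_iff
    using CS_add CS_scale dual_add[OF f] dual_scale[OF f]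
    by (auto simp: distrib_left mult.left_commute)
qed

lemma ev_ops:
  assumes "u \<in> vcarrier A"
  shows "ev (vzero dual) u = 0"
    and "ev (vadd dual f g) u = ev f u + ev g u"
    and "ev (vscale dual c f) u = c * ev f u"
  using CS_const[OF assms] by (simp_all add: ev_def dual_ops)

end

section \<open>The algebraic tensor product\<close>

definition elem :: "'i set \<Rightarrow> ('i \<Rightarrow> ('k::real_normed_field, 'v) nspace) \<Rightarrow> ('i \<Rightarrow> 'v) \<Rightarrow> (('i \<Rightarrow> 'v) \<Rightarrow> 'k) \<Rightarrow> 'k" where
  "elem I X x = (\<lambda>A\<in>multilinear_forms I X. A x)"

lemma sum_lessThan_add:
  fixes h :: "nat \<Rightarrow> 'a::comm_monoid_add"
  shows "(\<Sum>j<n + m. h j) = (\<Sum>j<n. h j) + (\<Sum>j<m. h (n + j))"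
  by (induction m) (simp_all add: add.assoc)

text \<open>Nonnegative factor norms keep the values of \<open>cost\<close> above 0, so that the
  infimum defining the projective norm is meaningful.\<close>

locale tensor_family =
  fixes I :: "'i set" and X :: "'i \<Rightarrow> ('k::{real_normed_field, euclidean_space}, 'v) nspace"
  assumes finite_index: "finite I"
    and factor_norm_nonneg: "\<And>i x. i \<in> I \<Longrightarrow> x \<in> vcarrier (X i) \<Longrightarrow> 0 \<le> vnorm (X i) x"
begin

abbreviation "AT \<equiv> alg_tensor I X"
abbreviation "MF \<equiv> multilinear_forms I X"
abbreviation "vecs \<equiv> \<Pi>\<^sub>E i\<in>I. vcarrier (X i)"

definition cost :: "nat \<Rightarrow> (nat \<Rightarrow> 'k) \<Rightarrow> (nat \<Rightarrow> 'i \<Rightarrow> 'v) \<Rightarrow> real" where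
  "cost n c x = (\<Sum>j<n. norm (c j) * (\<Prod>i\<in>I. vnorm (X i) (x j i)))"

lemma AT_carrier: "u \<in> vcarrier AT \<longleftrightarrow> (\<exists>n c x. represents I X u n c x)"
  by (simp add: alg_tensor_def)

lemma AT_norm: "vnorm AT u = Inf {cost n c x | n c x. represents I X u n c x}"
  by (simp add: alg_tensor_def cost_def)

lemma cost_nonneg: "represents I X u n c x \<Longrightarrow> 0 \<le> cost n c x"
  unfolding cost_def represents_def
  by (intro sum_nonneg mult_nonneg_nonneg prod_nonneg) (auto intro: factor_norm_nonneg)

lemma AT_norm_le: "represents I X u n c x \<Longrightarrow> vnorm AT u \<le> cost n c x"
  unfolding AT_norm by (rule cInf_lower) (auto intro!: bdd_belowI cost_nonneg)

lemma AT_norm_greatest: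
  assumes "u \<in> vcarrier AT" "\<And>n c x. represents I X u n c x \<Longrightarrow> C \<le> cost n c x"
  shows "C \<le> vnorm AT u"
  unfolding AT_norm by (rule cInf_greatest) (use assms AT_carrier in auto)

lemma represents_zero: "represents I X (\<lambda>A\<in>MF. 0) 0 c x"
  by (simp add: represents_def tensor_sum_def)

lemma represents_add:
  assumes "represents I X u n c x" "represents I X v m d y"
  shows "represents I X (\<lambda>A\<in>MF. u A + v A) (n + m) (\<lambda>j. if j < n then c j else d (j - n))
    (\<lambda>j. if j < n then x j else y (j - n))"
proof -
  have "(\<Sum>j<n + m. (if j < n then c j else d (j - n)) * A (if j < n then x j else y (j - n)))
      = (\<Sum>j<n. c j * A (x j)) + (\<Sum>j<m. d j * A (y j))" for A
    by (simp add: sum_lessThan_add)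
  then show ?thesis using assms by (auto simp: represents_def tensor_sum_def fun_eq_iff)
qed

lemma cost_add:
  "cost (n + m) (\<lambda>j. if j < n then c j else d (j - n)) (\<lambda>j. if j < n then x j else y (j - n))
    = cost n c x + cost m d y"
  by (simp add: cost_def sum_lessThan_add)

lemma represents_scale:
  assumes "represents I X u n c x"
  shows "represents I X (\<lambda>A\<in>MF. r * u A) n (\<lambda>j. r * c j) x"
  using assms by (auto simp: represents_def tensor_sum_def fun_eq_iff sum_distrib_left mult.assoc)

lemma cost_scale: "cost n (\<lambda>j. r * c j) x = norm r * cost n c x"
  by (simp add: cost_def norm_mult sum_distrib_left mult.assoc)

lemma AT_ops:
  "vzero AT = (\<lambda>A\<in>MF. 0)" "vadd AT u v = (\<lambda>A\<in>MF. u A + v A)" "vscale AT r u = (\<lambda>A\<in>MF. r * u A)"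
  by (simp_all add: alg_tensor_def)

lemma AT_norm_zero: "vnorm AT (vzero AT) = 0"
proof (rule antisym)
  show "vnorm AT (vzero AT) \<le> 0"
    using AT_norm_le[OF represents_zero] by (simp add: AT_ops cost_def)
  show "0 \<le> vnorm AT (vzero AT)"
  proof (rule AT_norm_greatest)
    show "vzero AT \<in> vcarrier AT" using represents_zero unfolding AT_carrier AT_ops by blast
  qed (rule cost_nonneg)
qed

lemma AT_norm_scale_le:
  assumes "u \<in> vcarrier AT"
  shows "vnorm AT (vscale AT r u) \<le> norm r * vnorm AT u"
proof (cases "r = 0")
  case True
  have "vscale AT r u = vzero AT" using True by (simp add: AT_ops)
  then show ?thesis using AT_norm_zero True by simp
next
  case False
  have "vnorm AT (vscale AT r u) / norm r \<le> vnorm AT u"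
  proof (rule AT_norm_greatest[OF assms])
    fix n c x assume "represents I X u n c x"
    from AT_norm_le[OF represents_scale[OF this, of r]]
    show "vnorm AT (vscale AT r u) / norm r \<le> cost n c x"
      using False by (simp add: AT_ops cost_scale pos_divide_le_eq mult.commute)
  qed
  then show ?thesis using False by (simp add: pos_divide_le_eq mult.commute)
qed

sublocale T: function_seminorm AT MF
proof
  fix u v :: "(('i \<Rightarrow> 'v) \<Rightarrow> 'k) \<Rightarrow> 'k" and c :: 'k
  show "u \<in> extensional MF" if "u \<in> vcarrier AT"
    using that unfolding AT_carrier represents_def tensor_sum_def by auto
  show "vzero AT \<in> vcarrier AT" using represents_zero unfolding AT_carrier AT_ops by blast
  show "vadd AT u v \<in> vcarrier AT" if "u \<in> vcarrier AT" "v \<in> vcarrier AT"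
    using that represents_add unfolding AT_carrier AT_ops by meson
  show scale: "vscale AT c u \<in> vcarrier AT" if "u \<in> vcarrier AT" for c u
    using that represents_scale unfolding AT_carrier AT_ops by meson
  show "0 \<le> vnorm AT u" if "u \<in> vcarrier AT"
    by (rule AT_norm_greatest[OF that]) (rule cost_nonneg)
  show "vnorm AT (vscale AT c u) = norm c * vnorm AT u" if u: "u \<in> vcarrier AT"
  proof (cases "c = 0")
    case True
    have "vscale AT c u = vzero AT" using True by (simp add: AT_ops)
    then show ?thesis using AT_norm_zero True by simp
  next
    case False
    have "u \<in> extensional MF" using u unfolding AT_carrier represents_def tensor_sum_def by auto
    \<comment> \<open>The reverse inequality is \<open>AT_norm_scale_le\<close> for the inverse
      scalar.\<close>
    then have "u = vscale AT (1 / c) (vscale AT c u)"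
      using False by (auto simp: AT_ops fun_eq_iff extensional_def)
    then have "vnorm AT u \<le> norm (1 / c) * vnorm AT (vscale AT c u)"
      using AT_norm_scale_le[OF scale[OF u, of c], of "1 / c"] by simp
    then have "norm c * vnorm AT u \<le> vnorm AT (vscale AT c u)"
      using False by (simp add: norm_divide pos_le_divide_eq mult.commute)
    then show ?thesis using AT_norm_scale_le[OF u, of c] by simp
  qed
  show "vnorm AT (vadd AT u v) \<le> vnorm AT u + vnorm AT v" if uv: "u \<in> vcarrier AT" "v \<in> vcarrier AT"
  proof -
    \<comment> \<open>The two infima are taken one after the other, first for \<open>u\<close> with
      a representation of \<open>v\<close> held fixed.\<close>
    have "vnorm AT (vadd AT u v) - cost m d y \<le> vnorm AT u" if "represents I X v m d y" for m d y
    proof (rule AT_norm_greatest[OF uv(1)])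
      fix n c x assume "represents I X u n c x"
      from AT_norm_le[OF represents_add[OF this that]]
      show "vnorm AT (vadd AT u v) - cost m d y \<le> cost n c x" unfolding AT_ops cost_add by simp
    qed
    then have "vnorm AT (vadd AT u v) - vnorm AT u \<le> vnorm AT v"
      by (intro AT_norm_greatest[OF uv(2)]) (simp add: algebra_simps)
    then show ?thesis by simp
  qed
qed (auto simp: AT_ops AT_norm_zero[unfolded AT_ops])

lemma represents_elem: "x \<in> vecs \<Longrightarrow> represents I X (elem I X x) 1 (\<lambda>_. 1) (\<lambda>_. x)"
  by (simp add: represents_def tensor_sum_def elem_def)

lemma elem_in: "x \<in> vecs \<Longrightarrow> elem I X x \<in> vcarrier AT"
  using represents_elem unfolding AT_carrier by blast

lemma norm_elem_le: "x \<in> vecs \<Longrightarrow> vnorm AT (elem I X x) \<le> (\<Prod>i\<in>I. vnorm (X i) (x i))"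
  using AT_norm_le[OF represents_elem] by (simp add: cost_def)

lemma elem_add:
  assumes "x \<in> vecs" "i \<in> I" "v \<in> vcarrier (X i)" "w \<in> vcarrier (X i)"
  shows "elem I X (x(i := vadd (X i) v w)) = vadd AT (elem I X (x(i := v))) (elem I X (x(i := w)))"
  using assms by (auto simp: elem_def AT_ops fun_eq_iff multilinear_forms_def linear_between_def scalar_space_def)

lemma elem_scale:
  assumes "x \<in> vecs" "i \<in> I" "v \<in> vcarrier (X i)"
  shows "elem I X (x(i := vscale (X i) c v)) = vscale AT c (elem I X (x(i := v)))"
  using assms by (auto simp: elem_def AT_ops fun_eq_iff multilinear_forms_def linear_between_def scalar_space_def)

lemma AT_functional_eq:
  assumes g: "\<And>u v. u \<in> vcarrier AT \<Longrightarrow> v \<in> vcarrier AT \<Longrightarrow> g (vadd AT u v) = g u + (g v :: 'k)"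
      "\<And>c u. u \<in> vcarrier AT \<Longrightarrow> g (vscale AT c u) = c * g u"
    and h: "\<And>u v. u \<in> vcarrier AT \<Longrightarrow> v \<in> vcarrier AT \<Longrightarrow> h (vadd AT u v) = h u + (h v :: 'k)"
      "\<And>c u. u \<in> vcarrier AT \<Longrightarrow> h (vscale AT c u) = c * h u"
    and eq: "\<And>x. x \<in> vecs \<Longrightarrow> g (elem I X x) = h (elem I X x)"
    and u: "u \<in> vcarrier AT"
  shows "g u = h u"
proof -
  obtain n c x where "represents I X u n c x" using u AT_carrier by blast
  then show ?thesis
  proof (induction n arbitrary: u)
    case 0
    then have "u = vscale AT 0 (vzero AT)" by (simp add: represents_def tensor_sum_def AT_ops)
    then show ?case using g(2)[OF T.zero_in, of 0] h(2)[OF T.zero_in, of 0] by simp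
  next
    case (Suc n)
    define v where "v = tensor_sum I X n c x"
    have v: "represents I X v n c x" using Suc.prems by (simp add: represents_def v_def)
    have xn: "x n \<in> vecs" using Suc.prems by (simp add: represents_def)
    have "u = vadd AT v (vscale AT (c n) (elem I X (x n)))"
      using Suc.prems by (auto simp: represents_def tensor_sum_def v_def AT_ops elem_def fun_eq_iff)
    moreover have "v \<in> vcarrier AT" using v AT_carrier by blast
    ultimately show ?case
      using Suc.IH[OF v] xn by (simp add: g h eq elem_in T.scale_in)
  qed
qed

text \<open>Evaluation at \<open>A\<close> is the functional that the form \<open>A\<close> induces
  on the tensor product; its bound holds for the cost of every representation and hence for the
  infimum.\<close>

lemma AT_eval_bound:
  assumes A: "A \<in> MF" and C: "0 \<le> C"
    and bound: "\<And>x. x \<in> vecs \<Longrightarrow> norm (A x) \<le> C * (\<Prod>i\<in>I. vnorm (X i) (x i))"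
    and u: "u \<in> vcarrier AT"
  shows "norm (u A) \<le> C * vnorm AT u"
proof -
  have rep: "norm (u A) \<le> C * cost n c x" if r: "represents I X u n c x" for n c x
  proof -
    have "u A = (\<Sum>j<n. c j * A (x j))" using r A by (simp add: represents_def tensor_sum_def)
    also have "norm \<dots> \<le> (\<Sum>j<n. C * (norm (c j) * (\<Prod>i\<in>I. vnorm (X i) (x j i))))"
    proof (rule sum_norm_le)
      fix j assume "j \<in> {..<n}"
      then have "x j \<in> vecs" using r by (simp add: represents_def)
      then have "norm (c j) * norm (A (x j)) \<le> norm (c j) * (C * (\<Prod>i\<in>I. vnorm (X i) (x j i)))"
        using bound by (intro mult_left_mono) auto
      then show "norm (c j * A (x j)) \<le> C * (norm (c j) * (\<Prod>i\<in>I. vnorm (X i) (x j i)))"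
        by (simp add: norm_mult mult.left_commute)
    qed
    finally show ?thesis by (simp add: cost_def sum_distrib_left)
  qed
  show ?thesis
  proof (cases "C = 0")
    case True
    obtain n c x where "represents I X u n c x" using u AT_carrier by blast
    from rep[OF this] True show ?thesis by simp
  next
    case False
    then have "0 < C" using C by simp
    have "norm (u A) / C \<le> vnorm AT u"
      by (rule AT_norm_greatest[OF u]) (use rep \<open>0 < C\<close> in \<open>simp add: pos_divide_le_eq mult.commute\<close>)
    then show ?thesis using \<open>0 < C\<close> by (simp add: pos_divide_le_eq mult.commute)
  qed
qed

end

section \<open>Functionals on the sequence spaces\<close>

definition delta :: "nat \<Rightarrow> nat \<Rightarrow> 'k::{real_normed_field, euclidean_space}" where
  "delta s = (\<lambda>t. if t = s then 1 else 0)"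

lemma lp_ops:
  "vzero (lp_space q) = (\<lambda>_. 0)" "vadd (lp_space q) x y = (\<lambda>n. x n + y n)" "vscale (lp_space q) c x = (\<lambda>n. c * x n)"
  "x \<in> vcarrier (lp_space q) \<longleftrightarrow> summable (\<lambda>n. norm (x n) powr q)"
  "vnorm (lp_space q) x = (\<Sum>n. norm (x n) powr q) powr (1 / q)"
  by (simp_all add: lp_space_def)

lemma lp_norm_nonneg: "0 \<le> vnorm (lp_space q) x"
  by (simp add: lp_ops)

lemma lp_add_in:
  assumes "0 < q" "x \<in> vcarrier (lp_space q)" "y \<in> vcarrier (lp_space q)"
  shows "vadd (lp_space q) x y \<in> vcarrier (lp_space q)"
proof -
  have "summable (\<lambda>n. 2 powr q * (norm (x n) powr q + norm (y n) powr q))"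
    using assms by (intro summable_mult summable_add) (simp_all add: lp_ops)
  then show ?thesis
    unfolding lp_ops
  proof (rule summable_comparison_test')
    fix n :: nat
    have "norm (x n + y n) \<le> 2 * max (norm (x n)) (norm (y n))"
      using norm_triangle_ineq[of "x n" "y n"] by linarith
    then have "norm (x n + y n) powr q \<le> (2 * max (norm (x n)) (norm (y n))) powr q"
      using assms(1) by (intro powr_mono2) auto
    also have "\<dots> = 2 powr q * max (norm (x n)) (norm (y n)) powr q"
      by (simp add: powr_mult)
    also have "\<dots> \<le> 2 powr q * (norm (x n) powr q + norm (y n) powr q)"
      by (intro mult_left_mono) (auto simp: max_def)
    finally show "norm (norm (x n + y n) powr q) \<le> 2 powr q * (norm (x n) powr q + norm (y n) powr q)" by simp
  qed
qed

lemma lp_scale_in: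
  "x \<in> vcarrier (lp_space q) \<Longrightarrow> vscale (lp_space q) c x \<in> vcarrier (lp_space q)"
  by (simp add: lp_ops norm_mult powr_mult summable_mult)

lemma lp_finite_in: "(\<And>t. t \<notin> A \<Longrightarrow> x t = 0) \<Longrightarrow> finite A \<Longrightarrow> x \<in> vcarrier (lp_space q)"
  unfolding lp_ops by (rule summable_finite[of A]) auto

lemma lp_finite_norm:
  "(\<And>t. t \<notin> A \<Longrightarrow> x t = 0) \<Longrightarrow> finite A \<Longrightarrow> vnorm (lp_space q) x = (\<Sum>t\<in>A. norm (x t) powr q) powr (1 / q)"
  unfolding lp_ops by (subst suminf_finite[of A]) auto

lemma delta_in: "delta s \<in> vcarrier (lp_space q)"
  by (rule lp_finite_in[of "{s}"]) (auto simp: delta_def)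

lemma lp_partial_norm_le:
  assumes "0 < q" "x \<in> vcarrier (lp_space q)"
  shows "(\<Sum>s<n. norm (x s) powr q) powr (1 / q) \<le> vnorm (lp_space q) x"
  unfolding lp_ops using assms by (intro powr_mono2 sum_le_suminf sum_nonneg) (auto simp: lp_ops)

lemma linear_scalar_add:
  "linear_between Y scalar_space L \<Longrightarrow> x \<in> vcarrier Y \<Longrightarrow> y \<in> vcarrier Y \<Longrightarrow> L (vadd Y x y) = L x + L y"
  by (simp add: linear_between_def scalar_space_def)

lemma linear_scalar_scale:
  "linear_between Y scalar_space L \<Longrightarrow> x \<in> vcarrier Y \<Longrightarrow> L (vscale Y c x) = c * L x"
  by (simp add: linear_between_def scalar_space_def)

lemma linear_scalarI:
  assumes "\<And>x y. x \<in> vcarrier Y \<Longrightarrow> y \<in> vcarrier Y \<Longrightarrow> L (vadd Y x y) = L x + L y"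
    and "\<And>c x. x \<in> vcarrier Y \<Longrightarrow> L (vscale Y c x) = c * L x"
  shows "linear_between Y scalar_space L"
  using assms by (simp add: linear_between_def scalar_space_def)

lemma functional_finite_support:
  assumes L: "linear_between (lp_space q) scalar_space L"
    and "finite A" "\<And>t. t \<notin> A \<Longrightarrow> v t = 0" "\<And>s. s \<in> A \<Longrightarrow> L (delta s) = 0"
  shows "L v = 0"
  using assms(2-4)
proof (induction A arbitrary: v rule: finite_induct)
  case empty
  then have "v = vscale (lp_space q) 0 (delta 0)" by (auto simp: lp_ops)
  then show ?case using linear_scalar_scale[OF L delta_in, of 0 0] by simp
next
  case (insert s A)
  define w where "w = v(s := 0)"
  have w: "L w = 0"
  proof (rule insert.IH)
    show "w t = 0" if "t \<notin> A" for t using insert.prems(1)[of t] that by (cases "t = s") (simp_all add: w_def)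
    show "L (delta t) = 0" if "t \<in> A" for t using insert.prems(2)[of t] that by simp
  qed
  have win: "w \<in> vcarrier (lp_space q)"
  proof (rule lp_finite_in)
    show "w t = 0" if "t \<notin> A" for t using insert.prems(1)[of t] that by (cases "t = s") (simp_all add: w_def)
  qed (rule insert.hyps(1))
  have "v = vadd (lp_space q) w (vscale (lp_space q) (v s) (delta s))"
    by (auto simp: lp_ops w_def delta_def fun_eq_iff)
  then have "L v = L w + v s * L (delta s)"
    using linear_scalar_add[OF L win lp_scale_in[OF delta_in], of "v s" s] linear_scalar_scale[OF L delta_in, of "v s" s]
    by simp
  then show ?case using w insert.prems(2) by simp
qed

lemma lp_tail_norm:
  assumes "0 < q" "v \<in> vcarrier (lp_space q)"
  shows "(\<lambda>n. vnorm (lp_space q) (\<lambda>t. if t < n then 0 else v t)) \<longlonglongrightarrow> 0"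
proof -
  have s: "summable (\<lambda>t. norm (v t) powr q)" using assms by (simp add: lp_ops)
  have eq: "(\<Sum>t. norm (if t < n then 0 else v t) powr q) = (\<Sum>t. norm (v t) powr q) - (\<Sum>t<n. norm (v t) powr q)" for n
  proof -
    have "(\<Sum>t. norm (if t < n then 0 else v t) powr q) = (\<Sum>t. norm (v t) powr q - (if t \<in> {..<n} then norm (v t) powr q else 0))"
      by (rule suminf_cong) auto
    also have "\<dots> = (\<Sum>t. norm (v t) powr q) - (\<Sum>t. if t \<in> {..<n} then norm (v t) powr q else 0)"
      by (intro suminf_diff[symmetric] s) (auto intro: summable_finite[of "{..<n}"])
    also have "(\<Sum>t. if t \<in> {..<n} then norm (v t) powr q else 0) = (\<Sum>t<n. norm (v t) powr q)"
      by (subst suminf_finite[of "{..<n}"]) auto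
    finally show ?thesis .
  qed
  have "(\<lambda>n. (\<Sum>t. norm (v t) powr q) - (\<Sum>t<n. norm (v t) powr q)) \<longlonglongrightarrow> 0"
    using tendsto_diff[OF tendsto_const[of "\<Sum>t. norm (v t) powr q"] summable_LIMSEQ[OF s]] by simp
  then have "(\<lambda>n. ((\<Sum>t. norm (v t) powr q) - (\<Sum>t<n. norm (v t) powr q)) powr (1 / q)) \<longlonglongrightarrow> 0 powr (1 / q)"
  proof (rule tendsto_powr2[OF _ tendsto_const])
    show "\<forall>\<^sub>F n in sequentially. 0 \<le> (\<Sum>t. norm (v t) powr q) - (\<Sum>t<n. norm (v t) powr q)"
      using sum_le_suminf[OF s] by (simp add: eventually_sequentially)
  qed (use assms in simp)
  then show ?thesis by (simp add: lp_ops eq)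
qed

text \<open>The tails of a vector tend to zero in norm, so the unit vectors span a dense
  subspace.\<close>

lemma functional_bounded_0:
  assumes q: "0 < q" and L: "linear_between (lp_space q) scalar_space L"
    and K: "\<And>v. v \<in> vcarrier (lp_space q) \<Longrightarrow> norm (L v) \<le> K * vnorm (lp_space q) v"
    and "\<And>s. L (delta s) = 0" and v: "v \<in> vcarrier (lp_space q)"
  shows "L v = 0"
proof -
  have "norm (L v) \<le> K * vnorm (lp_space q) (\<lambda>t. if t < n then 0 else v t)" for n
  proof -
    let ?w = "\<lambda>t. if t < n then v t else 0" and ?r = "\<lambda>t. if t < n then 0 else v t"
    have w: "?w \<in> vcarrier (lp_space q)" by (rule lp_finite_in[of "{..<n}"]) auto
    have r: "?r \<in> vcarrier (lp_space q)"
      using v unfolding lp_ops by (rule summable_comparison_test'[of _ 0]) (auto simp: lp_ops)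
    have "v = vadd (lp_space q) ?w ?r" by (auto simp: lp_ops)
    then have "L v = L ?w + L ?r" using linear_scalar_add[OF L w r] by metis
    also have "L ?w = 0" by (rule functional_finite_support[OF L, of "{..<n}"]) (use assms in auto)
    finally show ?thesis using K[OF r] by simp
  qed
  moreover have "(\<lambda>n. K * vnorm (lp_space q) (\<lambda>t. if t < n then 0 else v t)) \<longlonglongrightarrow> K * 0"
    by (intro tendsto_mult_left lp_tail_norm q v)
  ultimately have "norm (L v) \<le> K * 0" by (intro LIMSEQ_le_const) blast+
  then show ?thesis by simp
qed

section \<open>The dual of the projective tensor product\<close>

context exponents
begin

sublocale T: tensor_family I "\<lambda>l. lp_space (p l)"
  by standard (auto simp: finite_I lp_norm_nonneg)

abbreviation "lp l \<equiv> lp_space (p l)"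
abbreviation "elt \<equiv> elem I (\<lambda>l. lp_space (p l))"

definition basis :: "(nat \<Rightarrow> nat) \<Rightarrow> nat \<Rightarrow> nat \<Rightarrow> 'k::{real_normed_field, euclidean_space}" where
  "basis i = (\<lambda>l\<in>I. delta (i l))"

lemma basis_in: "basis i \<in> T.vecs"
  by (auto simp: basis_def delta_in)

text \<open>
  The vectors of \<open>\<V> l\<close> are those on which a functional is determined by its values on the unit vectors
  in \<open>A l\<close>; coordinates are then replaced by unit vectors one at a time.
\<close>

lemma multilinear_vanishes:
  assumes basis: "\<And>i. i \<in> Pi\<^sub>E I A \<Longrightarrow> B (basis i) = (0 :: 'k::{real_normed_field, euclidean_space})"
    and delta: "\<And>l s. l \<in> I \<Longrightarrow> s \<in> A l \<Longrightarrow> delta s \<in> \<V> l"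
    and step: "\<And>x l v. x \<in> Pi\<^sub>E I \<V> \<Longrightarrow> l \<in> I \<Longrightarrow> v \<in> \<V> l \<Longrightarrow>
        (\<And>s. s \<in> A l \<Longrightarrow> B (x(l := delta s)) = 0) \<Longrightarrow> B (x(l := v)) = 0"
    and x: "x \<in> Pi\<^sub>E I \<V>"
  shows "B x = 0"
proof -
  \<comment> \<open>Induction on a set \<open>J\<close> outside which all coordinates are already
    unit vectors.\<close>
  have "B x = 0" if "finite J" "J \<subseteq> I" "x \<in> Pi\<^sub>E I \<V>" "\<And>l. l \<in> I - J \<Longrightarrow> \<exists>s\<in>A l. x l = delta s" for J x
    using that
  proof (induction J arbitrary: x rule: finite_induct)
    case empty
    then have "\<forall>l\<in>I. \<exists>s. s \<in> A l \<and> x l = delta s" by blast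
    then obtain i where i: "\<And>l. l \<in> I \<Longrightarrow> i l \<in> A l \<and> x l = delta (i l)" using bchoice by meson
    have "x = basis (restrict i I)"
      using empty.prems(2) i by (auto simp: basis_def fun_eq_iff PiE_iff extensional_def)
    moreover have "restrict i I \<in> Pi\<^sub>E I A" using i by auto
    ultimately show ?case using basis by blast
  next
    case (insert l J)
    have l: "l \<in> I" using insert.prems by auto
    have "B (x(l := x l)) = 0"
    proof (rule step[OF insert.prems(2) l])
      show "x l \<in> \<V> l" using insert.prems(2) l by auto
      fix s assume s: "s \<in> A l"
      show "B (x(l := delta s)) = 0"
      proof (rule insert.IH)
        show "J \<subseteq> I" using insert.prems by auto
        show "x(l := delta s) \<in> Pi\<^sub>E I \<V>"
          using insert.prems(2) l delta[OF l s] by (auto simp: PiE_iff extensional_def)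
        fix k assume "k \<in> I - J"
        then show "\<exists>t\<in>A k. (x(l := delta s)) k = delta t"
          using s insert.prems(3)[of k] by (cases "k = l") auto
      qed
    qed
    then show ?case by simp
  qed
  from this[OF finite_I _ x] show ?thesis by auto
qed

lemma vecs_upd: "x \<in> T.vecs \<Longrightarrow> l \<in> I \<Longrightarrow> v \<in> vcarrier (lp l) \<Longrightarrow> x(l := v) \<in> T.vecs"
  by (auto simp: PiE_iff extensional_def)

lemma prod_upd:
  assumes "l \<in> I"
  shows "(\<Prod>k\<in>I. h k ((x(l := u)) k)) = h l u * (\<Prod>k\<in>I - {l}. h k (x k))"
proof -
  have "(\<Prod>k\<in>I - {l}. h k ((x(l := u)) k)) = (\<Prod>k\<in>I - {l}. h k (x k))"
    by (rule prod.cong) auto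
  then show ?thesis by (simp add: prod.remove[OF finite_I assms])
qed

lemma form_upd_add:
  assumes "l \<in> I"
  shows "form a A (x(l := (\<lambda>n. v n + w n))) = form a A (x(l := v)) + form a A (x(l := w))"
  unfolding form_def prod_upd[OF assms, where h = "\<lambda>k u. u (_ k)"]
  by (simp add: sum.distrib algebra_simps)

lemma form_upd_scale:
  assumes "l \<in> I"
  shows "form a A (x(l := (\<lambda>n. c * v n))) = c * form a A (x(l := v))"
  unfolding form_def prod_upd[OF assms, where h = "\<lambda>k u. u (_ k)"]
  by (simp add: sum_distrib_left mult_ac)

lemma form_basis:
  assumes "\<And>l. l \<in> I \<Longrightarrow> finite (A l)" "i \<in> idx"
  shows "form a A (basis i) = (if i \<in> Pi\<^sub>E I A then a i else 0)"
proof -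
  have fin: "finite (Pi\<^sub>E I A)" using assms finite_I by (intro finite_PiE)
  have "(\<Prod>l\<in>I. basis i l (k l)) = (if k = i then 1 else 0 :: 'a)" if "k \<in> Pi\<^sub>E I A" for k
  proof (cases "k = i")
    case False
    have "k \<in> idx" using that by (auto simp: idx_def PiE_iff)
    then have "\<exists>l\<in>I. k l \<noteq> i l" using False assms(2) PiE_ext unfolding idx_def by blast
    then obtain l where l: "l \<in> I" "k l \<noteq> i l" by blast
    then show ?thesis using False finite_I by (auto simp: basis_def delta_def intro!: prod_zero bexI[of _ l])
  qed (simp add: basis_def delta_def)
  then have "form a A (basis i) = (\<Sum>k\<in>Pi\<^sub>E I A. if k = i then a i else 0)"
    unfolding form_def by (intro sum.cong) auto
  then show ?thesis using fin by simp
qed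

lemma form_partial_le:
  assumes a: "bd a C" and x: "x \<in> T.vecs"
  shows "norm (form a (\<lambda>_. {..<n}) x) \<le> C * (\<Prod>l\<in>I. vnorm (lp l) (x l))"
proof -
  have "norm (form a (\<lambda>_. {..<n}) x) \<le> C * (\<Prod>l\<in>I. pnorm l {..<n} (x l))"
    by (rule form_le_pnorm[OF a]) simp
  also have "\<dots> \<le> C * (\<Prod>l\<in>I. vnorm (lp l) (x l))"
  proof (intro mult_left_mono prod_mono V.bd_nonneg[OF a] conjI pnorm_nonneg)
    fix l assume l: "l \<in> I"
    show "pnorm l {..<n} (x l) \<le> vnorm (lp l) (x l)"
      unfolding pnorm_def using x l p_pos[OF l] by (intro lp_partial_norm_le) auto
  qed
  finally show ?thesis .
qed

text \<open>The extension of the array to arbitrary vectors. The partial sums over cubes are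
  uniformly bounded by \<open>form_partial_le\<close>, so their ultralimit is available at once and
  inherits multilinearity.\<close>

definition lim_form :: "('k::{real_normed_field, euclidean_space}) arr \<Rightarrow> (nat \<Rightarrow> nat \<Rightarrow> 'k) \<Rightarrow> 'k" where
  "lim_form a = (\<lambda>x\<in>T.vecs. ulim (\<lambda>n. form a (\<lambda>_. {..<n}) x))"

lemma lim_form_tendsto:
  assumes "bd a C" "x \<in> T.vecs"
  shows "((\<lambda>n. form a (\<lambda>_. {..<n}) x) \<longlongrightarrow> lim_form a x) free_ultra"
  using tendsto_ulim[OF form_partial_le[OF assms]] assms(2) by (simp add: lim_form_def)

lemma lim_form_eqI:
  assumes "x \<in> T.vecs" "((\<lambda>n. form a (\<lambda>_. {..<n}) x) \<longlongrightarrow> c) free_ultra"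
  shows "lim_form a x = c"
  using ulim_eqI[OF assms(2)] assms(1) by (simp add: lim_form_def)

lemma lim_form_bound:
  assumes "bd a C" "x \<in> T.vecs"
  shows "norm (lim_form a x) \<le> C * (\<Prod>l\<in>I. vnorm (lp l) (x l))"
  by (rule tendsto_upperbound[OF tendsto_norm[OF lim_form_tendsto[OF assms]]])
    (use form_partial_le[OF assms] free_ultra_neq_bot in auto)

lemma lim_form_multilinear:
  assumes a: "bd a C"
  shows "lim_form a \<in> T.MF"
  unfolding multilinear_forms_def
proof (intro CollectI conjI ballI)
  show "lim_form a \<in> extensional T.vecs" by (simp add: lim_form_def)
  fix x :: "nat \<Rightarrow> nat \<Rightarrow> 'a" and l assume x: "x \<in> T.vecs" and l: "l \<in> I"
  show "linear_between (lp l) scalar_space (\<lambda>v. lim_form a (x(l := v)))"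
  proof (rule linear_scalarI)
    fix v w :: "nat \<Rightarrow> 'a" assume v: "v \<in> vcarrier (lp l)" and w: "w \<in> vcarrier (lp l)"
    show "lim_form a (x(l := vadd (lp l) v w)) = lim_form a (x(l := v)) + lim_form a (x(l := w))"
    proof (rule lim_form_eqI)
      show "x(l := vadd (lp l) v w) \<in> T.vecs"
        by (intro vecs_upd x l lp_add_in p_pos v w)
      have "((\<lambda>n. form a (\<lambda>_. {..<n}) (x(l := v)) + form a (\<lambda>_. {..<n}) (x(l := w))) \<longlongrightarrow>
          lim_form a (x(l := v)) + lim_form a (x(l := w))) free_ultra"
        by (intro tendsto_add lim_form_tendsto[OF a] vecs_upd x l v w)
      then show "((\<lambda>n. form a (\<lambda>_. {..<n}) (x(l := vadd (lp l) v w))) \<longlongrightarrow>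
          lim_form a (x(l := v)) + lim_form a (x(l := w))) free_ultra"
        unfolding lp_ops form_upd_add[OF l] .
    qed
  next
    fix c :: 'a and v :: "nat \<Rightarrow> 'a" assume v: "v \<in> vcarrier (lp l)"
    show "lim_form a (x(l := vscale (lp l) c v)) = c * lim_form a (x(l := v))"
    proof (rule lim_form_eqI)
      show "x(l := vscale (lp l) c v) \<in> T.vecs"
        by (intro vecs_upd x l lp_scale_in v)
      have "((\<lambda>n. c * form a (\<lambda>_. {..<n}) (x(l := v))) \<longlongrightarrow> c * lim_form a (x(l := v))) free_ultra"
        by (intro tendsto_mult tendsto_const lim_form_tendsto[OF a] vecs_upd x l v)
      then show "((\<lambda>n. form a (\<lambda>_. {..<n}) (x(l := vscale (lp l) c v))) \<longlongrightarrow>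
          c * lim_form a (x(l := v))) free_ultra"
        unfolding lp_ops form_upd_scale[OF l] .
    qed
  qed
qed

lemma lim_form_basis:
  assumes i: "i \<in> idx"
  shows "lim_form a (basis i) = a i"
proof (rule lim_form_eqI[OF basis_in])
  have "eventually (\<lambda>n. form a (\<lambda>_. {..<n}) (basis i) = a i) sequentially"
    using eventually_in_cube[OF i] by eventually_elim (simp add: form_basis[OF _ i] cube_def)
  then have "eventually (\<lambda>n. form a (\<lambda>_. {..<n}) (basis i) = a i) free_ultra"
    using free_ultra_le by (rule filter_leD[rotated])
  then show "((\<lambda>n. form a (\<lambda>_. {..<n}) (basis i)) \<longlongrightarrow> a i) free_ultra"
    by (rule tendsto_eventually)
qed

section \<open>The dual as the space of bounded arrays\<close>

abbreviation "D \<equiv> dual_space (completion T.AT)"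

definition entries :: "_ \<Rightarrow> ('k::{real_normed_field, euclidean_space}) arr" where
  "entries f = (\<lambda>i. if i \<in> idx then T.T.ev f (elt (basis i)) else 0)"

lemma ev_elem_linear:
  assumes f: "f \<in> vcarrier D" and x: "x \<in> T.vecs" and l: "l \<in> I"
  shows "linear_between (lp l) scalar_space (\<lambda>v. T.T.ev f (elt (x(l := v))))"
proof (rule linear_scalarI)
  fix v w :: "nat \<Rightarrow> 'a" assume vw: "v \<in> vcarrier (lp l)" "w \<in> vcarrier (lp l)"
  show "T.T.ev f (elt (x(l := vadd (lp l) v w))) =
      T.T.ev f (elt (x(l := v))) + T.T.ev f (elt (x(l := w)))"
    unfolding T.elem_add[OF x l vw] by (intro T.T.ev_add[OF f] T.elem_in vecs_upd x l vw)
next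
  fix c :: 'a and v :: "nat \<Rightarrow> 'a" assume v: "v \<in> vcarrier (lp l)"
  show "T.T.ev f (elt (x(l := vscale (lp l) c v))) =
      c * T.T.ev f (elt (x(l := v)))"
    unfolding T.elem_scale[OF x l v] by (intro T.T.ev_scale[OF f] T.elem_in vecs_upd x l v)
qed

lemma ev_elem_bound:
  assumes "T.T.fun_bound f C" "x \<in> T.vecs" "0 \<le> C"
  shows "norm (T.T.ev f (elt x)) \<le> C * (\<Prod>l\<in>I. vnorm (lp l) (x l))"
  using T.T.ev_bound[OF assms(1) T.elem_in[OF assms(2)]] T.norm_elem_le[OF assms(2)] assms(3)
  by (meson mult_left_mono order_trans)

text \<open>On vectors supported in the finite sets \<open>A l\<close>, the functional on elementary
  tensors and \<open>form (entries f) A\<close> are both multilinear and agree on unit vectors, so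
  they coincide, and the bound of the functional bounds the form.\<close>

lemma bd_entries:
  assumes f: "f \<in> vcarrier D" and C: "T.T.fun_bound f C" "0 \<le> C"
  shows "bd (entries f) C"
  unfolding bd_def
proof (intro conjI allI impI)
  show "entries f i = 0" if "i \<notin> idx" for i using that by (simp add: entries_def)
  fix A and x :: "nat \<Rightarrow> nat \<Rightarrow> 'a" assume t: "unit_test A x"
  have fin: "finite (A l)" if "l \<in> I" for l using t that by (simp add: unit_test_def)
  \<comment> \<open>The form sees only the coordinates in \<open>A l\<close>; cutting off the others
    puts the test vectors into the unit balls of the factors.\<close>
  define y where "y = (\<lambda>l\<in>I. \<lambda>s. if s \<in> A l then x l s else 0)"
  define \<V> where "\<V> l = {v :: nat \<Rightarrow> 'a. \<forall>s. s \<notin> A l \<longrightarrow> v s = 0}" for l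
  have \<V>: "v \<in> vcarrier (lp l)" if "v \<in> \<V> l" "l \<in> I" for v l
    using that fin lp_finite_in[of "A l" v] by (auto simp: \<V>_def)
  then have \<V>_vecs: "Pi\<^sub>E I \<V> \<subseteq> T.vecs" by (intro PiE_mono) auto
  have y\<V>: "y \<in> Pi\<^sub>E I \<V>" by (auto simp: y_def \<V>_def)
  define B where "B z = T.T.ev f (elt z) - form (entries f) A z" for z
  have "B y = 0"
  proof (rule multilinear_vanishes[where B = B and \<V> = \<V> and A = A])
    show "B (basis i) = 0" if i: "i \<in> Pi\<^sub>E I A" for i
    proof -
      have "i \<in> idx" using i by (auto simp: idx_def PiE_iff)
      then show ?thesis using i fin by (simp add: B_def form_basis) (simp add: entries_def)
    qed
    show "delta s \<in> \<V> l" if "l \<in> I" "s \<in> A l" for l s using that by (auto simp: \<V>_def delta_def)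
    show "y \<in> Pi\<^sub>E I \<V>" by fact
    fix z l v assume z: "z \<in> Pi\<^sub>E I \<V>" and l: "l \<in> I" and v: "v \<in> \<V> l"
      and 0: "\<And>s. s \<in> A l \<Longrightarrow> B (z(l := delta s)) = 0"
    have zv: "z \<in> T.vecs" using z \<V>_vecs by blast
    have "linear_between (lp l) scalar_space (\<lambda>v. B (z(l := v)))"
    proof (rule linear_scalarI)
      note L = ev_elem_linear[OF f zv l]
      show "B (z(l := vadd (lp l) v w)) = B (z(l := v)) + B (z(l := w))"
        if "v \<in> vcarrier (lp l)" "w \<in> vcarrier (lp l)" for v w
        using linear_scalar_add[OF L that] form_upd_add[OF l, of _ A z v w] unfolding B_def by (simp add: lp_ops)
      show "B (z(l := vscale (lp l) c v)) = c * B (z(l := v))"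
        if "v \<in> vcarrier (lp l)" for c v
        using linear_scalar_scale[OF L that] form_upd_scale[OF l, of _ A z c v] unfolding B_def
        by (simp add: lp_ops right_diff_distrib)
    qed
    then show "B (z(l := v)) = 0"
      by (rule functional_finite_support[where A = "A l" and L = "\<lambda>v. B (z(l := v))"])
        (use fin[OF l] v 0 in \<open>auto simp: \<V>_def\<close>)
  qed
  moreover have "form (entries f) A y = form (entries f) A x"
    unfolding form_def by (intro sum.cong arg_cong2[where f = "(*)"] prod.cong refl) (auto simp: y_def PiE_iff)
  ultimately have "norm (form (entries f) A x) \<le> C * (\<Prod>l\<in>I. vnorm (lp l) (y l))"
    using ev_elem_bound[OF C(1) _ C(2), of y] y\<V> \<V>_vecs unfolding B_def by auto
  also have "\<dots> \<le> C * 1"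
  proof (intro mult_left_mono C prod_le_1 conjI lp_norm_nonneg)
    fix l assume l: "l \<in> I"
    have "vnorm (lp l) (y l) = (\<Sum>s\<in>A l. norm (y l s) powr p l) powr (1 / p l)"
      by (rule lp_finite_norm) (use l fin in \<open>auto simp: y_def\<close>)
    also have "(\<Sum>s\<in>A l. norm (y l s) powr p l) = (\<Sum>s\<in>A l. norm (x l s) powr p l)"
      using l by (intro sum.cong) (auto simp: y_def)
    also have "\<dots> powr (1 / p l) \<le> 1 powr (1 / p l)"
      using t l p_pos[OF l] by (intro powr_mono2) (auto simp: unit_test_def sum_nonneg)
    finally show "vnorm (lp l) (y l) \<le> 1" by simp
  qed
  finally show "norm (form (entries f) A x) \<le> C" by simp
qed

text \<open>A functional is determined by its values on elementary tensors, and these by the values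
  on unit vectors, through \<open>functional_bounded_0\<close> in each factor.\<close>

lemma entries_inj:
  assumes f: "f \<in> vcarrier D" and f': "f' \<in> vcarrier D" and eq: "entries f = entries f'"
  shows "f = f'"
proof (rule T.T.dual_eqI[OF f f'])
  fix u :: "((nat \<Rightarrow> nat \<Rightarrow> 'a) \<Rightarrow> 'a) \<Rightarrow> 'a" assume u: "u \<in> vcarrier T.AT"
  show "T.T.ev f u = T.T.ev f' u"
  proof (rule T.AT_functional_eq[OF T.T.ev_add[OF f] T.T.ev_scale[OF f] T.T.ev_add[OF f'] T.T.ev_scale[OF f'] _ u])
    fix x :: "nat \<Rightarrow> nat \<Rightarrow> 'a" assume x: "x \<in> T.vecs"
    define B where "B z = T.T.ev f (elt z) - T.T.ev f' (elt z)" for z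
    define C where "C = vnorm D f + vnorm D f'"
    have B: "norm (B z) \<le> C * (\<Prod>l\<in>I. vnorm (lp l) (z l))" if "z \<in> T.vecs" for z
      using ev_elem_bound[OF T.T.dual_norm_bound(1)[OF f] that T.T.dual_norm_bound(2)[OF f]]
        ev_elem_bound[OF T.T.dual_norm_bound(1)[OF f'] that T.T.dual_norm_bound(2)[OF f']]
      unfolding B_def C_def by (simp add: distrib_right norm_triangle_le_diff)
    have "B x = 0"
    proof (rule multilinear_vanishes[where B = B and A = "\<lambda>_. UNIV" and \<V> = "\<lambda>l. vcarrier (lp l)"])
      show "B (basis i) = 0" if "i \<in> (\<Pi>\<^sub>E l\<in>I. UNIV)" for i
        using fun_cong[OF eq, of i] that by (simp add: entries_def B_def idx_def)
      show "delta s \<in> vcarrier (lp l)" for l s by (rule delta_in)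
      show "x \<in> T.vecs" by fact
      fix z l and v :: "nat \<Rightarrow> 'a" assume z: "z \<in> T.vecs" and l: "l \<in> I" and v: "v \<in> vcarrier (lp l)"
        and 0: "\<And>s. s \<in> UNIV \<Longrightarrow> B (z(l := delta s)) = 0"
      show "B (z(l := v)) = 0"
      proof (rule functional_bounded_0[where L = "\<lambda>v. B (z(l := v))", OF p_pos[OF l] _ _ _ v])
        show "linear_between (lp l) scalar_space (\<lambda>v. B (z(l := v)))"
        proof (rule linear_scalarI)
          note L = ev_elem_linear[OF f z l] ev_elem_linear[OF f' z l]
          show "B (z(l := vadd (lp l) v w)) = B (z(l := v)) + B (z(l := w))"
            if "v \<in> vcarrier (lp l)" "w \<in> vcarrier (lp l)" for v w
            using linear_scalar_add[OF L(1) that] linear_scalar_add[OF L(2) that] unfolding B_def by simp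
          show "B (z(l := vscale (lp l) c v)) = c * B (z(l := v))"
            if "v \<in> vcarrier (lp l)" for c v
            using linear_scalar_scale[OF L(1) that] linear_scalar_scale[OF L(2) that] unfolding B_def
            by (simp add: right_diff_distrib)
        qed
        fix w :: "nat \<Rightarrow> 'a" assume w: "w \<in> vcarrier (lp l)"
        have "(\<Prod>k\<in>I. vnorm (lp k) ((z(l := w)) k)) =
            vnorm (lp l) w * (\<Prod>k\<in>I - {l}. vnorm (lp k) (z k))"
          by (rule prod_upd[OF l, where h = "\<lambda>k. vnorm (lp k)"])
        then show "norm (B (z(l := w))) \<le> (C * (\<Prod>k\<in>I - {l}. vnorm (lp k) (z k))) * vnorm (lp l) w"
          using B[OF vecs_upd[OF z l w]] by (simp add: mult_ac)
      qed (use 0 in auto)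
    qed
    then show "T.T.ev f (elt x) = T.T.ev f' (elt x)"
      by (simp add: B_def)
  qed
qed

text \<open>The functional is evaluation at the multilinear extension \<open>lim_form a\<close>,
  which keeps the bound \<open>C\<close>.\<close>

lemma entries_surj:
  assumes a: "bd a C"
  obtains f where "f \<in> vcarrier D" "T.T.fun_bound f C" "entries f = a"
proof -
  have C: "0 \<le> C" using a by (rule V.bd_nonneg)
  have MF: "lim_form a \<in> T.MF" using a by (rule lim_form_multilinear)
  obtain f where f: "f \<in> vcarrier D" "T.T.fun_bound f C" "\<And>u. u \<in> vcarrier T.AT \<Longrightarrow> T.T.ev f u = u (lim_form a)"
  proof (rule T.T.functional_extend[of "\<lambda>u. u (lim_form a)" C])
    show "norm (u (lim_form a)) \<le> C * vnorm T.AT u" if "u \<in> vcarrier T.AT" for u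
      by (rule T.AT_eval_bound[OF MF C lim_form_bound[OF a] that])
  qed (use MF C in \<open>auto simp: T.AT_ops\<close>)
  have "entries f = a"
  proof
    fix i show "entries f i = a i"
    proof (cases "i \<in> idx")
      case True
      then show ?thesis
        using f(3)[OF T.elem_in[OF basis_in, of i]] MF lim_form_basis[OF True, of a] by (simp add: entries_def elem_def)
    next
      case False
      then show ?thesis using bd_support[OF a] by (simp add: entries_def)
    qed
  qed
  then show ?thesis using that f by blast
qed

text \<open>\<open>entries_surj\<close> produces a functional with bound \<open>C\<close> and the
  same array, and by \<open>entries_inj\<close> it is \<open>f\<close> itself. Through this isometry
  the dual norm inherits its properties from \<open>bd\<close>.\<close>

lemma bd_entries_iff:
  assumes f: "f \<in> vcarrier D"
  shows "bd (entries f) C \<longleftrightarrow> vnorm D f \<le> C"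
proof
  assume "bd (entries f) C"
  then obtain f' where f': "f' \<in> vcarrier D" "T.T.fun_bound f' C" "entries f' = entries f" using entries_surj by blast
  then have "f' = f" using entries_inj f by blast
  then show "vnorm D f \<le> C"
    using T.T.dual_norm_bound(3)[OF f] f'(2) V.bd_nonneg[OF \<open>bd (entries f) C\<close>] by blast
next
  assume "vnorm D f \<le> C"
  then show "bd (entries f) C"
    using bd_entries[OF f T.T.dual_norm_bound(1,2)[OF f]] V.bd_mono by blast
qed

lemma entries_ops:
  "entries (vzero D) = 0" "entries (vadd D f g) = entries f + entries g" "entries (vscale D c f) = sc c (entries f)"
  using T.T.ev_ops[OF T.elem_in[OF basis_in]] by (auto simp: entries_def fun_eq_iff)

lemma entries_vdiff: "entries (vdiff D f g) = entries f - entries g"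
  unfolding vdiff_def entries_ops by (simp add: fun_eq_iff)

lemma dual_norm_nonneg: "f \<in> vcarrier D \<Longrightarrow> 0 \<le> vnorm D f"
  by (rule T.T.dual_norm_bound(2))

lemma bd_entries_norm: "f \<in> vcarrier D \<Longrightarrow> bd (entries f) (vnorm D f)"
  by (simp add: bd_entries_iff)

lemma dual_norm_scale_le:
  assumes "f \<in> vcarrier D"
  shows "vnorm D (vscale D c f) \<le> norm c * vnorm D f"
  using V.bd_sc[OF bd_entries_norm[OF assms], of c] bd_entries_iff[OF T.T.dual_scale_in[OF assms]]
  by (simp only: entries_ops)

lemma normed_vspace_dual: "normed_vspace (D :: ('k::{real_normed_field, euclidean_space}, _) nspace)"
proof
  fix f g h :: "(nat \<Rightarrow> ((nat \<Rightarrow> nat \<Rightarrow> 'k) \<Rightarrow> 'k) \<Rightarrow> 'k) set \<Rightarrow> 'k" and c d :: 'k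
  have ext: "f x = undefined" if "f \<in> vcarrier D" "x \<notin> T.T.cls ` T.T.CS"
    for f :: "(nat \<Rightarrow> ((nat \<Rightarrow> nat \<Rightarrow> 'k) \<Rightarrow> 'k) \<Rightarrow> 'k) set \<Rightarrow> 'k" and x
    using that unfolding T.T.dual_carrier_iff extensional_def by blast
  show "vzero D \<in> vcarrier D" by (rule T.T.dual_zero_in)
  show "vadd D f g \<in> vcarrier D" if "f \<in> vcarrier D" "g \<in> vcarrier D" using that by (rule T.T.dual_add_in)
  show "vscale D c f \<in> vcarrier D" if "f \<in> vcarrier D" using that by (rule T.T.dual_scale_in)
  show "vadd D (vadd D f g) h = vadd D f (vadd D g h)" by (auto simp: T.T.dual_ops fun_eq_iff)
  show "vadd D f g = vadd D g f" by (auto simp: T.T.dual_ops fun_eq_iff)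
  show "vadd D f (vzero D) = f" if "f \<in> vcarrier D" using ext[OF that] by (auto simp: T.T.dual_ops fun_eq_iff)
  show "vdiff D f f = vzero D" by (auto simp: vdiff_def T.T.dual_ops fun_eq_iff)
  show "vscale D c (vadd D f g) = vadd D (vscale D c f) (vscale D c g)"
    by (auto simp: T.T.dual_ops fun_eq_iff distrib_left)
  show "vscale D (c + d) f = vadd D (vscale D c f) (vscale D d f)"
    by (auto simp: T.T.dual_ops fun_eq_iff distrib_right)
  show "vscale D c (vscale D d f) = vscale D (c * d) f" by (auto simp: T.T.dual_ops fun_eq_iff)
  show "vscale D 1 f = f" if "f \<in> vcarrier D" using ext[OF that] by (auto simp: T.T.dual_ops fun_eq_iff)
  show "0 \<le> vnorm D f" if "f \<in> vcarrier D" using that by (rule dual_norm_nonneg)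
  have zero: "vnorm D (vzero D :: _ \<Rightarrow> 'k) = 0"
  proof (rule antisym)
    have "bd (entries (vzero D :: _ \<Rightarrow> 'k)) 0" unfolding entries_ops by (rule V.bd_zero)
    then show "vnorm D (vzero D :: _ \<Rightarrow> 'k) \<le> 0" using bd_entries_iff[OF T.T.dual_zero_in] by blast
    show "0 \<le> vnorm D (vzero D :: _ \<Rightarrow> 'k)" by (rule dual_norm_nonneg[OF T.T.dual_zero_in])
  qed
  show "vnorm D f = 0 \<longleftrightarrow> f = vzero D" if f: "f \<in> vcarrier D"
  proof
    assume "vnorm D f = 0"
    then have "bd (entries f) 0" using bd_entries_norm[OF f] by simp
    then have "entries f = entries (vzero D)" unfolding entries_ops by (rule V.bd_eq_0)
    then show "f = vzero D" by (rule entries_inj[OF f T.T.dual_zero_in])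
  qed (use zero in simp)
  show "vnorm D (vscale D c f) = norm c * vnorm D f" if f: "f \<in> vcarrier D"
  proof (cases "c = 0")
    case True
    then show ?thesis
      using dual_norm_scale_le[OF f, of c] dual_norm_nonneg[OF T.T.dual_scale_in[OF f, of c]] by simp
  next
    case False
    have "f = vscale D (1 / c) (vscale D c f)"
      using ext[OF f] False by (auto simp: T.T.dual_ops fun_eq_iff)
    then have "vnorm D f \<le> norm (1 / c) * vnorm D (vscale D c f)"
      using dual_norm_scale_le[OF T.T.dual_scale_in[OF f, of c], of "1 / c"] by simp
    then have "norm c * vnorm D f \<le> vnorm D (vscale D c f)"
      using False by (simp add: norm_divide pos_le_divide_eq mult.commute)
    then show ?thesis using dual_norm_scale_le[OF f, of c] by simp
  qed
  show "vnorm D (vadd D f g) \<le> vnorm D f + vnorm D g" if f: "f \<in> vcarrier D" and g: "g \<in> vcarrier D"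
    using V.bd_add[OF bd_entries_norm[OF f] bd_entries_norm[OF g]] bd_entries_iff[OF T.T.dual_add_in[OF f g]]
    by (simp only: entries_ops)
qed

lemma vdiff_in: "f \<in> vcarrier D \<Longrightarrow> g \<in> vcarrier D \<Longrightarrow> vdiff D f g \<in> vcarrier D"
  unfolding vdiff_def by (intro T.T.dual_add_in T.T.dual_scale_in)

text \<open>The entries of a Cauchy sequence converge, and since balls are closed under pointwise
  limits, the Cauchy estimates pass to the limit array.\<close>

lemma banach_dual: "banach_space (D :: ('k::{real_normed_field, euclidean_space}, _) nspace)"
  unfolding banach_space_def
proof (intro conjI ballI normed_vspace_dual)
  fix s :: "nat \<Rightarrow> (nat \<Rightarrow> ((nat \<Rightarrow> nat \<Rightarrow> 'k) \<Rightarrow> 'k) \<Rightarrow> 'k) set \<Rightarrow> 'k"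
  assume s: "s \<in> cauchy_seqs D"
  then have s_in: "s n \<in> vcarrier D" for n by (simp add: cauchy_seqs_def)
  have bd_diff: "bd (entries (s m) - entries (s n)) C \<longleftrightarrow> vnorm D (vdiff D (s m) (s n)) \<le> C" for m n C
    using bd_entries_iff[OF vdiff_in[OF s_in s_in]] by (simp only: entries_vdiff)
  have small: "\<exists>M. \<forall>m\<ge>M. \<forall>n\<ge>M. bd (entries (s m) - entries (s n)) e" if "0 < e" for e
  proof -
    have "\<exists>M. \<forall>m\<ge>M. \<forall>n\<ge>M. vnorm D (vdiff D (s m) (s n)) < e"
      using s that by (simp add: cauchy_seqs_def)
    then show ?thesis unfolding bd_diff using less_imp_le by blast
  qed
  have "Cauchy (\<lambda>n. entries (s n) i)" for i
    unfolding Cauchy_def dist_norm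
  proof (intro allI impI)
    fix e :: real assume e: "0 < e"
    obtain M where "\<And>m n. m \<ge> M \<Longrightarrow> n \<ge> M \<Longrightarrow> bd (entries (s m) - entries (s n)) (e / 2)"
      using small[of "e / 2"] e by auto
    then have "norm (entries (s m) i - entries (s n) i) \<le> e / 2" if "m \<ge> M" "n \<ge> M" for m n
      using V.bd_entry[of "entries (s m) - entries (s n)" "e / 2" i] that by simp
    then show "\<exists>M. \<forall>m\<ge>M. \<forall>n\<ge>M. norm (entries (s m) i - entries (s n) i) < e"
      using e by (intro exI[of _ M]) fastforce
  qed
  then have "\<exists>l. (\<lambda>n. entries (s n) i) \<longlonglongrightarrow> l" for i
    using Cauchy_convergent convergent_def by blast
  then obtain a where a: "\<And>i. (\<lambda>n. entries (s n) i) \<longlonglongrightarrow> a i" by metis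
  have close: "bd (entries (s m) - a) e" if M: "\<forall>m\<ge>M. \<forall>n\<ge>M. bd (entries (s m) - entries (s n)) e" and "m \<ge> M" for m M e
  proof (rule V.bd_lim[where f = "\<lambda>n. entries (s m) - entries (s (n + M))"])
    show "bd (entries (s m) - entries (s (n + M))) e" for n using that by simp
    show "(\<lambda>n. (entries (s m) - entries (s (n + M))) x) \<longlonglongrightarrow> (entries (s m) - a) x" for x
      using tendsto_diff[OF tendsto_const[of "entries (s m) x"] LIMSEQ_ignore_initial_segment[OF a, of M x]] by simp
  qed
  obtain M where M: "\<forall>m\<ge>M. \<forall>n\<ge>M. bd (entries (s m) - entries (s n)) 1" using small[of 1] by auto
  have "bd (entries (s M) - (entries (s M) - a)) (vnorm D (s M) + 1)"
    by (rule V.bd_diff[OF bd_entries_norm[OF s_in] close[OF M]]) simp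
  then have "bd a (vnorm D (s M) + 1)" by simp
  then obtain f where f: "f \<in> vcarrier D" "entries f = a" using entries_surj by blast
  have "converges_to D s f"
    unfolding converges_to_def LIMSEQ_iff
  proof (intro allI impI)
    fix e :: real assume e: "0 < e"
    obtain M where M: "\<forall>m\<ge>M. \<forall>n\<ge>M. bd (entries (s m) - entries (s n)) (e / 2)" using small[of "e / 2"] e by auto
    have "norm (vnorm D (vdiff D (s n) f) - 0) < e" if "n \<ge> M" for n
    proof -
      have "vnorm D (vdiff D (s n) f) \<le> e / 2"
        using close[OF M that] bd_entries_iff[OF vdiff_in[OF s_in f(1)]] unfolding entries_vdiff f(2) by blast
      then show ?thesis using dual_norm_nonneg[OF vdiff_in[OF s_in f(1)], of n] e by simp
    qed
    then show "\<exists>M. \<forall>n\<ge>M. norm (vnorm D (vdiff D (s n) f) - 0) < e" by blast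
  qed
  then show "\<exists>f\<in>vcarrier D. converges_to D s f" using f by blast
qed

section \<open>Transport of primariness to the dual\<close>

lemma isomorphic_subspace:
  fixes Y :: "((nat \<Rightarrow> ((nat \<Rightarrow> nat \<Rightarrow> 'k::{real_normed_field, euclidean_space}) \<Rightarrow> 'k) \<Rightarrow> 'k) set \<Rightarrow> 'k) set"
  assumes Y: "Y \<subseteq> vcarrier D" "\<And>f. f \<in> vcarrier D \<Longrightarrow> f \<in> Y \<longleftrightarrow> R (entries f)"
    and iso: "norm_iso bd (\<lambda>a C. bd a C \<and> R a)"
  shows "isomorphic_spaces D (D\<lparr>vcarrier := Y\<rparr>)"
proof -
  let ?Y = "\<lambda>a C. bd a C \<and> R a"
  obtain \<Phi> \<Psi> where \<Phi>: "blin bd ?Y \<Phi>" and \<Psi>: "blin ?Y bd \<Psi>"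
    and inv: "\<And>a. car bd a \<Longrightarrow> \<Psi> (\<Phi> a) = a" "\<And>b. car ?Y b \<Longrightarrow> \<Phi> (\<Psi> b) = b"
    using iso unfolding norm_iso_def by blast
  have carY: "car ?Y a \<longleftrightarrow> car bd a \<and> R a" for a by (auto simp: car_def)
  have car: "car bd (entries f)" if "f \<in> vcarrier D" for f :: "_ \<Rightarrow> 'k"
    using V.carI[OF bd_entries_norm[OF that]] .
  have "\<exists>f. f \<in> vcarrier D \<and> entries f = a" if "car bd a" for a :: "_ \<Rightarrow> 'k"
    using that entries_surj unfolding car_def by metis
  then obtain dec :: "_ \<Rightarrow> _ \<Rightarrow> 'k" where dec: "\<And>a. car bd a \<Longrightarrow> dec a \<in> vcarrier D" "\<And>a. car bd a \<Longrightarrow> entries (dec a) = a"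
    by metis
  have dec_entries: "dec (entries f) = f" if "f \<in> vcarrier D" for f
    using entries_inj[OF dec(1)[OF car[OF that]] that dec(2)[OF car[OF that]]] .
  have \<Phi>car: "car bd (\<Phi> (entries f))" "R (\<Phi> (entries f))" if "f \<in> vcarrier D" for f
    using blin_car[OF \<Phi> car[OF that]] by (simp_all add: carY)
  define F where "F f = dec (\<Phi> (entries f))" for f
  define G where "G f = dec (\<Psi> (entries f))" for f
  have F_D: "F f \<in> vcarrier D" and F_entries: "entries (F f) = \<Phi> (entries f)" if "f \<in> vcarrier D" for f
    unfolding F_def using dec \<Phi>car[OF that] by auto
  have F_Y: "F f \<in> Y" if "f \<in> vcarrier D" for f
    using Y(2)[OF F_D[OF that]] F_entries[OF that] \<Phi>car[OF that] by simp
  have Y_car: "car ?Y (entries f)" if "f \<in> Y" for f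
    using Y that car carY by blast
  have G_D: "G f \<in> vcarrier D" and G_entries: "entries (G f) = \<Psi> (entries f)" if "f \<in> Y" for f
    unfolding G_def using dec blin_car[OF \<Psi> Y_car[OF that]] by auto
  have GF: "G (F f) = f" if "f \<in> vcarrier D" for f
    unfolding G_def F_entries[OF that] using inv(1)[OF car[OF that]] dec_entries[OF that] by simp
  have FG: "F (G f) = f" if "f \<in> Y" for f
    unfolding F_def G_entries[OF that] using inv(2)[OF Y_car[OF that]] dec_entries Y(1) that by auto
  have "linear_between D (D\<lparr>vcarrier := Y\<rparr>) F"
    unfolding linear_between_def
  proof (intro conjI ballI allI)
    fix f :: "_ \<Rightarrow> 'k" assume f: "f \<in> vcarrier D"
    show "F f \<in> vcarrier (D\<lparr>vcarrier := Y\<rparr>)" using F_Y[OF f] by simp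
    show "F (vscale D c f) = vscale (D\<lparr>vcarrier := Y\<rparr>) c (F f)" for c
    proof -
      have "entries (F (vscale D c f)) = entries (vscale D c (F f))"
        unfolding F_entries[OF T.T.dual_scale_in[OF f]] entries_ops F_entries[OF f]
        by (rule blin_sc[OF \<Phi> car[OF f]])
      then show ?thesis
        using entries_inj[OF F_D[OF T.T.dual_scale_in[OF f]] T.T.dual_scale_in[OF F_D[OF f]]] by simp
    qed
    fix g :: "_ \<Rightarrow> 'k" assume g: "g \<in> vcarrier D"
    have "entries (F (vadd D f g)) = entries (vadd D (F f) (F g))"
      unfolding F_entries[OF T.T.dual_add_in[OF f g]] entries_ops F_entries[OF f] F_entries[OF g]
      by (rule blin_add[OF \<Phi> car[OF f] car[OF g]])
    then show "F (vadd D f g) = vadd (D\<lparr>vcarrier := Y\<rparr>) (F f) (F g)"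
      using entries_inj[OF F_D[OF T.T.dual_add_in[OF f g]] T.T.dual_add_in[OF F_D[OF f] F_D[OF g]]] by simp
  qed
  moreover have "bij_betw F (vcarrier D) (vcarrier (D\<lparr>vcarrier := Y\<rparr>))"
    by (rule bij_betw_byWitness[where f' = G]) (use GF FG F_Y G_D in auto)
  moreover have "\<exists>C. \<forall>f\<in>vcarrier D. vnorm (D\<lparr>vcarrier := Y\<rparr>) (F f) \<le> C * vnorm D f"
  proof -
    obtain K where K: "\<And>a C. bd a C \<Longrightarrow> bd (\<Phi> a) (K * C)" using blin_bound[OF \<Phi>] by blast
    have "vnorm D (F f) \<le> K * vnorm D f" if "f \<in> vcarrier D" for f
      using K[OF bd_entries_norm[OF that]] bd_entries_iff[OF F_D[OF that]] F_entries[OF that] by metis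
    then show ?thesis by auto
  qed
  moreover have "\<exists>C. \<forall>f\<in>vcarrier D. vnorm D f \<le> C * vnorm (D\<lparr>vcarrier := Y\<rparr>) (F f)"
  proof -
    obtain K where K: "\<And>a C. ?Y a C \<Longrightarrow> bd (\<Psi> a) (K * C)" using blin_bound[OF \<Psi>] by blast
    have "vnorm D f \<le> K * vnorm D (F f)" if f: "f \<in> vcarrier D" for f
    proof -
      have "bd (\<Psi> (entries (F f))) (K * vnorm D (F f))"
        using bd_entries_norm[OF F_D[OF f]] F_entries[OF f] \<Phi>car[OF f] by (intro K) simp
      then have "bd (entries f) (K * vnorm D (F f))" unfolding F_entries[OF f] inv(1)[OF car[OF f]] .
      then show ?thesis using bd_entries_iff[OF f] by blast
    qed
    then show ?thesis by auto
  qed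
  ultimately show ?thesis unfolding isomorphic_spaces_def by blast
qed

text \<open>The projection onto \<open>Y\<close> along \<open>Z\<close> is carried over to arrays,
  where \<open>primary_forms\<close> applies; its boundedness comes from the last conjunct of
  \<open>topological_direct_sum\<close>.\<close>

lemma primary_dual: "primary (D :: ('k::{real_normed_field, euclidean_space}, _) nspace)"
  unfolding primary_def
proof (intro conjI allI impI banach_dual)
  fix Y Z :: "((nat \<Rightarrow> ((nat \<Rightarrow> nat \<Rightarrow> 'k) \<Rightarrow> 'k) \<Rightarrow> 'k) set \<Rightarrow> 'k) set"
  assume sum: "topological_direct_sum D Y Z"
  have YD: "Y \<subseteq> vcarrier D" and ZD: "Z \<subseteq> vcarrier D" and Y0: "vzero D \<in> Y" and Z0: "vzero D \<in> Z"
    and YZ0: "Y \<inter> Z = {vzero D}"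
    and Yadd: "\<And>f g. f \<in> Y \<Longrightarrow> g \<in> Y \<Longrightarrow> vadd D f g \<in> Y" and Ysc: "\<And>c f. f \<in> Y \<Longrightarrow> vscale D c f \<in> Y"
    and Zadd: "\<And>f g. f \<in> Z \<Longrightarrow> g \<in> Z \<Longrightarrow> vadd D f g \<in> Z" and Zsc: "\<And>c f. f \<in> Z \<Longrightarrow> vscale D c f \<in> Z"
    and YZ: "\<And>f. f \<in> vcarrier D \<Longrightarrow> \<exists>y\<in>Y. \<exists>z\<in>Z. f = vadd D y z"
    using sum unfolding topological_direct_sum_def closed_subspace_def by blast+
  obtain K0 where K0: "\<And>y z. y \<in> Y \<Longrightarrow> z \<in> Z \<Longrightarrow> vnorm D y + vnorm D z \<le> K0 * vnorm D (vadd D y z)"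
    using sum unfolding topological_direct_sum_def by blast
  have Y_add: "a + b \<in> entries ` Y" if "a \<in> entries ` Y" "b \<in> entries ` Y" for a b
    using that Yadd by (auto simp flip: entries_ops)
  have Z_add: "a + b \<in> entries ` Z" if "a \<in> entries ` Z" "b \<in> entries ` Z" for a b
    using that Zadd by (auto simp flip: entries_ops)
  have Y_sc: "sc c a \<in> entries ` Y" if "a \<in> entries ` Y" for a c
    using that Ysc by (auto simp flip: entries_ops)
  have Z_sc: "sc c a \<in> entries ` Z" if "a \<in> entries ` Z" for a c
    using that Zsc by (auto simp flip: entries_ops)
  have Y_0: "0 \<in> entries ` Y" and Z_0: "0 \<in> entries ` Z"
    using Y0 Z0 entries_ops(1) by (metis image_eqI)+
  have disj: "a = 0" if a: "a \<in> entries ` Y" "a \<in> entries ` Z" for a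
  proof -
    obtain y z where yz: "y \<in> Y" "a = entries y" "z \<in> Z" "a = entries z" using a by blast
    then have "y = z" using entries_inj[of y z] YD ZD by auto
    then have "y = vzero D" using yz YZ0 by blast
    then show ?thesis using yz entries_ops(1) by simp
  qed
  \<comment> \<open>The \<open>Y\<close>-component of \<open>a\<close>; its uniqueness, proved in
    \<open>P_eq\<close>, is what makes the choice linear.\<close>
  define P where "P a = (SOME y. y \<in> entries ` Y \<and> a - y \<in> entries ` Z)" for a
  have P_eq: "P a = y" if y: "y \<in> entries ` Y" "a - y \<in> entries ` Z" for a y
    unfolding P_def
  proof (rule some_equality)
    show "y \<in> entries ` Y \<and> a - y \<in> entries ` Z" using y by blast
    fix y' assume y': "y' \<in> entries ` Y \<and> a - y' \<in> entries ` Z"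
    have eq: "y' - y = y' + sc (- 1) y" "y' - y = (a - y) + sc (- 1) (a - y')"
      by (simp_all add: fun_eq_iff)
    have "y' - y \<in> entries ` Y" unfolding eq(1) using y y' by (intro Y_add Y_sc) auto
    moreover have "y' - y \<in> entries ` Z" unfolding eq(2) using y y' by (intro Z_add Z_sc) auto
    ultimately have "y' - y = 0" by (rule disj)
    then show "y' = y" by simp
  qed
  \<comment> \<open>\<open>K0\<close> carries no sign, and replacing the norm by the larger
    \<open>C\<close> requires a nonnegative factor; hence the maximum with 0.\<close>
  have dec: "\<exists>y z. y \<in> Y \<and> z \<in> Z \<and> a = entries y + entries z \<and> vnorm D y \<le> max K0 0 * C" if a: "bd a C" for a :: "_ \<Rightarrow> 'k" and C
  proof -
    obtain f where f: "f \<in> vcarrier D" "entries f = a" using entries_surj[OF a] by blast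
    obtain y z where yz: "y \<in> Y" "z \<in> Z" "f = vadd D y z" using YZ[OF f(1)] by blast
    have nf: "vnorm D f \<le> C" "0 \<le> vnorm D f" using a f bd_entries_iff[OF f(1)] dual_norm_nonneg by auto
    have "vnorm D y \<le> K0 * vnorm D f" using K0[OF yz(1,2)] dual_norm_nonneg[of z] ZD yz by auto
    also have "\<dots> \<le> max K0 0 * C" using nf by (intro mult_mono) auto
    finally show ?thesis using yz f entries_ops(2) by blast
  qed
  have P_ex: "P a \<in> entries ` Y \<and> a - P a \<in> entries ` Z" if a: "car bd a" for a
  proof -
    obtain y z where "y \<in> Y" "z \<in> Z" "a = entries y + entries z" using a dec unfolding car_def by blast
    then have *: "entries y \<in> entries ` Y" "a - entries y \<in> entries ` Z" by simp_all
    show ?thesis unfolding P_eq[OF *] using * by blast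
  qed
  have P: "blin bd bd P"
  proof (rule blinI[where K = "max K0 0"])
    fix a b :: "'k arr" assume ab: "car bd a" "car bd b"
    have eq: "a + b - (P a + P b) = (a - P a) + (b - P b)" by simp
    show "P (a + b) = P a + P b"
    proof (rule P_eq)
      show "P a + P b \<in> entries ` Y" using P_ex[OF ab(1)] P_ex[OF ab(2)] by (intro Y_add) auto
      show "a + b - (P a + P b) \<in> entries ` Z"
        unfolding eq using P_ex[OF ab(1)] P_ex[OF ab(2)] by (intro Z_add) auto
    qed
  next
    fix c and a :: "'k arr" assume a: "car bd a"
    have eq: "sc c a - sc c (P a) = sc c (a - P a)" by (simp only: sc_diff)
    show "P (sc c a) = sc c (P a)"
    proof (rule P_eq)
      show "sc c (P a) \<in> entries ` Y" using P_ex[OF a] by (intro Y_sc) auto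
      show "sc c a - sc c (P a) \<in> entries ` Z" unfolding eq using P_ex[OF a] by (intro Z_sc) auto
    qed
  next
    fix a :: "'k arr" and C assume a: "bd a C"
    obtain y z where yz: "y \<in> Y" "z \<in> Z" "a = entries y + entries z" "vnorm D y \<le> max K0 0 * C" using dec[OF a] by blast
    have "P a = entries y" using yz by (intro P_eq) auto
    then show "bd (P a) (max K0 0 * C)" using yz YD bd_entries_iff[of y] by auto
  qed simp
  have P_Y: "P a = a \<longleftrightarrow> a \<in> entries ` Y" if "car bd a" for a
  proof
    assume "P a = a"
    then show "a \<in> entries ` Y" using P_ex[OF that] by simp
  next
    assume "a \<in> entries ` Y"
    then show "P a = a" by (rule P_eq) (simp only: diff_self Z_0)
  qed
  have P_Z: "P a = 0 \<longleftrightarrow> a \<in> entries ` Z" if "car bd a" for a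
  proof
    assume "P a = 0"
    then show "a \<in> entries ` Z" using P_ex[OF that] by (simp only: diff_zero)
  next
    assume "a \<in> entries ` Z"
    then show "P a = 0" by (intro P_eq Y_0) (simp only: diff_zero)
  qed
  have PP: "P (P a) = P a" if "car bd a" for a
  proof (rule P_eq)
    show "P a \<in> entries ` Y" using P_ex[OF that] by blast
  qed (simp only: diff_self Z_0)
  have mem: "f \<in> S \<longleftrightarrow> entries f \<in> entries ` S" if "S \<subseteq> vcarrier D" "f \<in> vcarrier D" for f and S :: "(_ \<Rightarrow> 'k) set"
    using that entries_inj by blast
  have car: "car bd (entries f)" if "f \<in> vcarrier D" for f :: "_ \<Rightarrow> 'k"
    using V.carI[OF bd_entries_norm[OF that]] .
  have "norm_iso bd (\<lambda>a C. bd a C \<and> P a = a) \<or> norm_iso bd (\<lambda>a C. bd a C \<and> P a = 0)"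
    by (rule primary_forms[OF P PP])
  then show "isomorphic_spaces D (D\<lparr>vcarrier := Y\<rparr>) \<or> isomorphic_spaces D (D\<lparr>vcarrier := Z\<rparr>)"
  proof
    assume "norm_iso bd (\<lambda>a C. bd a C \<and> P a = a)"
    then have "isomorphic_spaces D (D\<lparr>vcarrier := Y\<rparr>)"
      by (rule isomorphic_subspace[OF YD, rotated]) (simp add: mem[OF YD] P_Y[OF car])
    then show ?thesis ..
  next
    assume "norm_iso bd (\<lambda>a C. bd a C \<and> P a = 0)"
    then have "isomorphic_spaces D (D\<lparr>vcarrier := Z\<rparr>)"
      by (rule isomorphic_subspace[OF ZD, rotated]) (simp add: mem[OF ZD] P_Z[OF car])
    then show ?thesis ..
  qed
qed

end

theorem theorem5p1:
  fixes N :: nat and p :: "nat \<Rightarrow> real"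
  assumes "N \<ge> 1"
    and "\<And>i. i \<in> {1..N} \<Longrightarrow> 1 < p i"
    and "min 1 (\<Sum>i=1..N. 1 / p i) = 1"
  shows "primary (dual_space (proj_tensor {1..N}
    (\<lambda>i. lp_space (p i) :: ('k::{real_normed_field, euclidean_space}, nat \<Rightarrow> 'k) nspace)))"
proof -
  interpret exponents "{1..N}" p
  proof
    show "1 \<le> (\<Sum>i=1..N. 1 / p i)" using assms(3) by (metis min.cobounded2)
  qed (use assms(1,2) in auto)
  show ?thesis unfolding proj_tensor_def by (rule primary_dual)
qed

end
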